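(* Let $n\ge 2$, $0\le m\le n$, let $P=(p_{jk})$ be a real $n\times n$-matrix, and let $a_j,b_j$ ($j\le n$) be coefficients satisfying the standing assumptions and not depending on $t$, i.e. $a_j(x,t)\equiv a_j(x)$ and $b_j(x,t)\equiv b_j(x)$. Then the (autonomous) initial-boundary value problem $$\partial_t u_j + a_j(x)\partial_x u_j + b_j(x)u_j = 0,\quad 0<x<1,\ t>0,\ j\le n,$$ $$u_j(0,t) = \sum_{k=1}^m p_{jk}u_k(1,t)+\sum_{k=m+1}^n p_{jk}u_k(0,t),\quad t\ge 0,\ 1\le j\le m,$$ $$u_j(1,t) = \sum_{k=1}^m p_{jk}u_k(1,t)+\sum_{k=m+1}^n p_{jk}u_k(0,t),\quad t\ge 0,\ m<j\le n,$$ $$u_j(x,0)=\varphi_j(x),\quad 0\le x\le 1,\ j\le n,$$ is finite time stabilizable (FTS) if and only if the spectrum of the operator $\mathcal{A}$ is empty, where $\mathcal{A}:D(\mathcal{A})\subset L^2(0,1)^n\to L^2(0,1)^n$ is defined by $$(\mathcal{A}v)(x)=-A(x)\frac{dv}{dx}-B(x)v,\qquad D(\mathcal{A})=\{v\in L^2(0,1)^n : \partial_x v\in L^2(0,1)^n,\ v_{out}=Pv_{in}\},$$ with $A(x)=\mathrm{diag}(a_1(x),\dots,a_n(x))$, $B(x)=\mathrm{diag}(b_1(x),\dots,b_n(x))$, $v_{out}=(v_1(0),\dots,v_m(0),v_{m+1}(1),\dots,v_n(1))$ and $v_{in}=(v_1(1),\dots,v_m(1),v_{m+1}(0),\dots,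v_n(0))$.
   Context: Let $\Pi=\{(x,t): 0\le x\le 1,\ 0\le t<\infty\}$. Unknowns and initial data are real-valued; $L^2(0,1)^n$ is normed by $\|u\|=\max_{j\le n}\|u_j\|_{L^2(0,1)}$. Standing assumptions on the coefficients: there is $a>0$ with $a_j\ge a$ on $\Pi$ for $1\le j\le m$ and $a_j\le -a$ on $\Pi$ for $m+1\le j\le n$; the real-valued functions $a_j,b_j$ belong to $C^1(\Pi)$ and are bounded in $\Pi$ together with their first order derivatives. $C_0^\infty([0,1])$ is the space of functions in $C^\infty([0,1])$ with support within $(0,1)$. For $\varphi\in C_0^\infty([0,1])^n$ the problem has a unique classical $C^1$-solution in $\Pi$. For $\varphi\in L^2(0,1)^n$, a function $u\in C([0,\infty),L^2(0,1))^n$ is an $L^2$-generalized solution if for any sequence $\varphi^l\in C_0^\infty([0,1])^n$ with $\varphi^l\to\varphi$ in $L^2(0,1)^n$, the classical $C^1$-solutions $u^l$ with initial data $\varphi^l$ satisfy $\|u(\cdot,t)-u^l(\cdot,t)\|_{L^2(0,1)^n}\to 0$ as $l\to\infty$, uniformly in $t\in[0,T]$ for each $T>0$. For every $\varphi\in L^2(0,1)^n$ there is a unique $L^2$-generalized solution. The problem is finite time stabilizable (FTS) if there exists $T_e>0$ such that for every $\varphi\in L^2(0,1)^n$ the $L^2$-generalized solution is zero for all $t>T_e$. The spectrum of $\mathcal{A}$ is the usual spectrum in $\mathbb{C}$, with $\mathcal{A}$ considered on complex-valued functions. *)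

theory Defs
  imports "HOL-Analysis.Analysis"
begin

text \<open>
  Vectors with \<open>n\<close> components are families indexed by \<^typ>\<open>nat\<close> of which only the components
  \<open>1, \<dots>, n\<close> matter. Functions on \<open>[0,1]\<close>, \<open>(0,1)\<close> or \<open>\<Pi>\<close> are functions on the whole of
  \<^typ>\<open>real\<close> or \<^typ>\<open>real \<times> real\<close> of which only the values on the respective set matter.
  Points of \<open>\<Pi>\<close> are pairs \<open>(x, t)\<close>.
\<close>


section \<open>The space \<open>L\<^sup>2(0,1)\<^sup>n\<close>\<close>

text \<open>
  Elements of \<open>L\<^sup>2(0,1)\<close> are represented by square integrable Lebesgue measurable functions;
  equality of classes is equality almost everywhere. The value type is \<^typ>\<open>real\<close> for the
  evolution problem and \<^typ>\<open>complex\<close> for the spectrum.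
\<close>

abbreviation M01 :: "real measure"
  where "M01 \<equiv> lebesgue_on {0<..<1}"

definition L2 :: "(real \<Rightarrow> 'b::{banach,second_countable_topology}) set"
  where "L2 = {f \<in> borel_measurable M01. integrable M01 (\<lambda>x. (norm (f x))\<^sup>2)}"

definition L2_norm :: "(real \<Rightarrow> 'b::{banach,second_countable_topology}) \<Rightarrow> real"
  where "L2_norm f = sqrt (LINT x|M01. (norm (f x))\<^sup>2)"

definition L2_vec :: "nat \<Rightarrow> (nat \<Rightarrow> real \<Rightarrow> 'b::{banach,second_countable_topology}) set"
  where "L2_vec n = {v. \<forall>j\<in>{1..n}. v j \<in> L2}"

definition L2_vec_norm :: "nat \<Rightarrow> (nat \<Rightarrow> real \<Rightarrow> 'b::{banach,second_countable_topology}) \<Rightarrow> real"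
  where "L2_vec_norm n v = Max ((\<lambda>j. L2_norm (v j)) ` {1..n})"

definition ae_eq :: "nat \<Rightarrow> (nat \<Rightarrow> real \<Rightarrow> 'b) \<Rightarrow> (nat \<Rightarrow> real \<Rightarrow> 'b) \<Rightarrow> bool"
  where "ae_eq n v w \<longleftrightarrow> (\<forall>j\<in>{1..n}. AE x in M01. v j x = w j x)"


section \<open>Smooth functions\<close>

text \<open>\<open>C\<^sub>0\<^sup>\<infinity>([0,1])\<close>: \<open>D k\<close> is the \<open>k\<close>-th derivative, one-sided at the end points.\<close>

definition C0_inf :: "(real \<Rightarrow> real) set"
  where "C0_inf = {\<psi>.
    (\<exists>D. (\<forall>x\<in>{0..1}. D 0 x = \<psi> x) \<and>
         (\<forall>k. \<forall>x\<in>{0..1}. (D k has_real_derivative D (Suc k) x) (at x within {0..1}))) \<and>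
    closure {x\<in>{0..1}. \<psi> x \<noteq> 0} \<subseteq> {0<..<1}}"

definition Pi_strip :: "(real \<times> real) set"
  where "Pi_strip = {0..1} \<times> {0..}"

definition C1_with :: "(real \<times> real \<Rightarrow> real) \<Rightarrow> (real \<times> real \<Rightarrow> real) \<Rightarrow> (real \<times> real \<Rightarrow> real) \<Rightarrow> bool"
  where "C1_with f fx ft \<longleftrightarrow>
    continuous_on Pi_strip fx \<and> continuous_on Pi_strip ft \<and>
    (\<forall>z\<in>Pi_strip. (f has_derivative (\<lambda>h. fx z * fst h + ft z * snd h)) (at z within Pi_strip))"

definition C1 :: "(real \<times> real \<Rightarrow> real) \<Rightarrow> bool"
  where "C1 f \<longleftrightarrow> (\<exists>fx ft. C1_with f fx ft)"

definition C1_bounded :: "(real \<times> real \<Rightarrow> real) \<Rightarrow> bool"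
  where "C1_bounded f \<longleftrightarrow> (\<exists>fx ft. C1_with f fx ft \<and>
    bounded (f ` Pi_strip) \<and> bounded (fx ` Pi_strip) \<and> bounded (ft ` Pi_strip))"


section \<open>The initial-boundary value problem\<close>

definition standing_assumptions ::
  "nat \<Rightarrow> nat \<Rightarrow> (nat \<Rightarrow> real \<times> real \<Rightarrow> real) \<Rightarrow> (nat \<Rightarrow> real \<times> real \<Rightarrow> real) \<Rightarrow> bool"
  where "standing_assumptions n m a b \<longleftrightarrow>
    (\<exists>\<alpha>>0. (\<forall>j\<in>{1..m}. \<forall>z\<in>Pi_strip. a j z \<ge> \<alpha>) \<and>
           (\<forall>j\<in>{m+1..n}. \<forall>z\<in>Pi_strip. a j z \<le> - \<alpha>)) \<and>
    (\<forall>j\<in>{1..n}. C1_bounded (a j) \<and> C1_bounded (b j))"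

definition classical_solution ::
  "nat \<Rightarrow> nat \<Rightarrow> (nat \<Rightarrow> nat \<Rightarrow> real) \<Rightarrow> (nat \<Rightarrow> real \<times> real \<Rightarrow> real) \<Rightarrow>
   (nat \<Rightarrow> real \<times> real \<Rightarrow> real) \<Rightarrow> (nat \<Rightarrow> real \<Rightarrow> real) \<Rightarrow> (nat \<Rightarrow> real \<times> real \<Rightarrow> real) \<Rightarrow> bool"
  where "classical_solution n m p a b \<phi> u \<longleftrightarrow>
    (\<forall>j\<in>{1..n}. C1 (u j)) \<and>
    (\<forall>j\<in>{1..n}. \<forall>x t. 0 < x \<and> x < 1 \<and> 0 < t \<longrightarrow>
       deriv (\<lambda>s. u j (x, s)) t + a j (x, t) * deriv (\<lambda>y. u j (y, t)) x
         + b j (x, t) * u j (x, t) = 0) \<and>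
    (\<forall>j\<in>{1..m}. \<forall>t\<ge>0.
       u j (0, t) = (\<Sum>k=1..m. p j k * u k (1, t)) + (\<Sum>k=m+1..n. p j k * u k (0, t))) \<and>
    (\<forall>j\<in>{m+1..n}. \<forall>t\<ge>0.
       u j (1, t) = (\<Sum>k=1..m. p j k * u k (1, t)) + (\<Sum>k=m+1..n. p j k * u k (0, t))) \<and>
    (\<forall>j\<in>{1..n}. \<forall>x\<in>{0..1}. u j (x, 0) = \<phi> j x)"

text \<open>Here \<open>u t\<close> is a representative of the element \<open>u(\<cdot>, t)\<close> of \<open>L\<^sup>2(0,1)\<^sup>n\<close>.\<close>

definition L2_generalized_solution ::
  "nat \<Rightarrow> nat \<Rightarrow> (nat \<Rightarrow> nat \<Rightarrow> real) \<Rightarrow> (nat \<Rightarrow> real \<times> real \<Rightarrow> real) \<Rightarrow>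
   (nat \<Rightarrow> real \<times> real \<Rightarrow> real) \<Rightarrow> (nat \<Rightarrow> real \<Rightarrow> real) \<Rightarrow> (real \<Rightarrow> nat \<Rightarrow> real \<Rightarrow> real) \<Rightarrow> bool"
  where "L2_generalized_solution n m p a b \<phi> u \<longleftrightarrow>
    (\<forall>t\<ge>0. u t \<in> L2_vec n) \<and>
    (\<forall>t\<ge>0. ((\<lambda>s. L2_vec_norm n (\<lambda>j x. u s j x - u t j x)) \<longlongrightarrow> 0) (at t within {0..})) \<and>
    (\<forall>\<phi>l ul.
       (\<forall>l. \<forall>j\<in>{1..n}. \<phi>l l j \<in> C0_inf) \<and>
       (\<lambda>l. L2_vec_norm n (\<lambda>j x. \<phi>l l j x - \<phi> j x)) \<longlonglongrightarrow> 0 \<and>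
       (\<forall>l. classical_solution n m p a b (\<phi>l l) (ul l)) \<longrightarrow>
       (\<forall>T>0. uniform_limit {0..T}
          (\<lambda>l t. L2_vec_norm n (\<lambda>j x. u t j x - ul l j (x, t))) (\<lambda>t. 0) sequentially))"

definition FTS ::
  "nat \<Rightarrow> nat \<Rightarrow> (nat \<Rightarrow> nat \<Rightarrow> real) \<Rightarrow> (nat \<Rightarrow> real \<times> real \<Rightarrow> real) \<Rightarrow>
   (nat \<Rightarrow> real \<times> real \<Rightarrow> real) \<Rightarrow> bool"
  where "FTS n m p a b \<longleftrightarrow>
    (\<exists>Te>0. \<forall>\<phi>\<in>L2_vec n. \<forall>u. L2_generalized_solution n m p a b \<phi> u \<longrightarrow>
       (\<forall>t>Te. ae_eq n (u t) (\<lambda>j x. 0)))"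


section \<open>The operator \<open>\<A>\<close> and its spectrum\<close>

text \<open>The derivative in the domain of \<open>\<A>\<close> is the distributional one.\<close>

definition has_weak_deriv :: "(real \<Rightarrow> complex) \<Rightarrow> (real \<Rightarrow> complex) \<Rightarrow> bool"
  where "has_weak_deriv v w \<longleftrightarrow>
    (\<forall>\<psi>\<in>C0_inf. (LINT x|M01. deriv \<psi> x *\<^sub>R v x) = - (LINT x|M01. \<psi> x *\<^sub>R w x))"

text \<open>An \<open>L\<^sup>2\<close> weak derivative is determined up to equality almost everywhere.\<close>

definition weak_deriv :: "(real \<Rightarrow> complex) \<Rightarrow> real \<Rightarrow> complex"
  where "weak_deriv v = (SOME w. w \<in> L2 \<and> has_weak_deriv v w)"

definition v_out :: "nat \<Rightarrow> (nat \<Rightarrow> real \<Rightarrow> complex) \<Rightarrow> nat \<Rightarrow> complex"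
  where "v_out m v j = (if j \<le> m then v j 0 else v j 1)"

definition v_in :: "nat \<Rightarrow> (nat \<Rightarrow> real \<Rightarrow> complex) \<Rightarrow> nat \<Rightarrow> complex"
  where "v_in m v j = (if j \<le> m then v j 1 else v j 0)"

text \<open>The boundary values of \<open>v\<close> are those of its continuous representative \<open>c\<close>.\<close>

definition A_domain :: "nat \<Rightarrow> nat \<Rightarrow> (nat \<Rightarrow> nat \<Rightarrow> real) \<Rightarrow> (nat \<Rightarrow> real \<Rightarrow> complex) set"
  where "A_domain n m p = {v \<in> L2_vec n.
    (\<forall>j\<in>{1..n}. \<exists>w\<in>L2. has_weak_deriv (v j) w) \<and>
    (\<exists>c. (\<forall>j\<in>{1..n}. continuous_on {0..1} (c j)) \<and> ae_eq n v c \<and>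
         (\<forall>j\<in>{1..n}. v_out m c j = (\<Sum>k=1..n. of_real (p j k) * v_in m c k)))}"

definition A_op ::
  "(nat \<Rightarrow> real \<Rightarrow> real) \<Rightarrow> (nat \<Rightarrow> real \<Rightarrow> real) \<Rightarrow>
   (nat \<Rightarrow> real \<Rightarrow> complex) \<Rightarrow> nat \<Rightarrow> real \<Rightarrow> complex"
  where "A_op a b v = (\<lambda>j x. - of_real (a j x) * weak_deriv (v j) x - of_real (b j x) * v j x)"

text \<open>
  Spectrum of an unbounded operator \<open>T\<close> on \<open>L\<^sup>2(0,1)\<^sup>n\<close> with domain \<open>D\<close>: \<open>z\<close> is in the
  resolvent set if \<open>z - T\<close> maps \<open>D\<close> bijectively onto \<open>L\<^sup>2(0,1)\<^sup>n\<close> with bounded inverse.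
\<close>

definition resolvent_set ::
  "nat \<Rightarrow> (nat \<Rightarrow> real \<Rightarrow> complex) set \<Rightarrow>
   ((nat \<Rightarrow> real \<Rightarrow> complex) \<Rightarrow> nat \<Rightarrow> real \<Rightarrow> complex) \<Rightarrow> complex set"
  where "resolvent_set n D T = {z.
    (\<forall>v\<in>D. ae_eq n (\<lambda>j x. z * v j x - T v j x) (\<lambda>j x. 0) \<longrightarrow> ae_eq n v (\<lambda>j x. 0)) \<and>
    (\<forall>f\<in>L2_vec n. \<exists>v\<in>D. ae_eq n (\<lambda>j x. z * v j x - T v j x) f) \<and>
    (\<exists>C. \<forall>v\<in>D. L2_vec_norm n v \<le> C * L2_vec_norm n (\<lambda>j x. z * v j x - T v j x))}"

definition op_spectrum ::
  "nat \<Rightarrow> (nat \<Rightarrow> real \<Rightarrow> complex) set \<Rightarrow>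
   ((nat \<Rightarrow> real \<Rightarrow> complex) \<Rightarrow> nat \<Rightarrow> real \<Rightarrow> complex) \<Rightarrow> complex set"
  where "op_spectrum n D T = - resolvent_set n D T"

end

theory Submission
  imports
    Defs
    "HOL-Complex_Analysis.Complex_Analysis"
    "HOL-Library.Poly_Mapping"
    "Jordan_Normal_Form.Determinant"
begin

text \<open>
  Write \<open>\<tau>\<^sub>k > 0\<close> for the time that component \<open>k\<close> needs to cross the interval along its
  characteristics and \<open>\<rho>\<^sub>k\<close> for the damping exponent that it collects on the way. Both sides of the
  equivalence say that \<open>\<Delta>(z) = det (I - P E(z))\<close> has no zero in the complex plane, where
  \<open>E(z) = diag (exp (- z \<tau>\<^sub>k - \<rho>\<^sub>k))\<close>.

  For the spectrum this is the theory of linear ordinary differential equations: \<open>z v - \<A> v = f\<close> is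
  solved componentwise by variation of constants, and the boundary condition turns into a linear
  system with matrix \<open>I - P E(z)\<close> for the outgoing boundary values. A nonzero determinant gives a
  unique solution with a bound, a kernel vector gives an eigenfunction (\<open>spectrum_empty_iff\<close>).

  If \<open>\<Delta>(z) = 0\<close> and \<open>v\<close> is the eigenfunction, the real part of \<open>exp (z t) v(x)\<close> is a classical
  solution for initial data that need not lie in \<open>C\<^sub>0\<^sup>\<infinity>\<close>. By the energy estimate (\<open>energy_estimate\<close>),
  classical solutions depend continuously on their data in \<open>L\<^sup>2\<close>, uniformly on bounded time
  intervals, so it is the generalized solution of its data. The real parts for \<open>v\<close> and for
  \<open>- \<i> v\<close> cannot both become extinct (\<open>FTS_imp_char_nonzero\<close>).

  Conversely, let \<open>\<Delta>\<close> have no zero. As an entire function of exponential type it equals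
  \<open>exp (\<alpha> z + \<beta>)\<close>, and it tends to \<open>1\<close> as \<open>Re z \<longlonglongrightarrow> \<infinity>\<close>; hence \<open>\<Delta> = 1\<close>. Now read the entries
  of \<open>I - P E\<close> not as functions of \<open>z\<close> but as elements of the group algebra of the additive group
  of the reals, in which \<open>exp (- r z)\<close> stands for the group element \<open>r\<close>. Evaluation at real \<open>z\<close> is
  injective on the group algebra, so already there the determinant is \<open>1\<close>
  (\<open>zero_free_delay_det\<close>) and the adjugate is an inverse. Let the group act on functions of
  time by shifts: the outgoing boundary values solve a system of difference equations with delays
  \<open>\<tau>\<^sub>k\<close>, its matrix is \<open>I - P E\<close>, and the inverse is a matrix of finite linear combinations of
  shifts. So the solution is a finite sum of shifts of the initial data. This formula yields a
  classical solution for all data in \<open>C\<^sub>0\<^sup>\<infinity>\<close> and shows that it is zero from a time on that does not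
  depend on the data (\<open>finite_time_extinction\<close>). As \<open>C\<^sub>0\<^sup>\<infinity>\<close> is dense in \<open>L\<^sup>2\<close>, generalized
  solutions inherit the extinction.
\<close>


section \<open>Smooth functions with support in the open unit interval\<close>

text \<open>
  The derivatives of all orders are a witness, as in \<open>C0_inf\<close>; restricting the witness to the unit
  interval restricts the function.
\<close>

definition smooth :: "(real \<Rightarrow> real) \<Rightarrow> bool"
  where "smooth f \<longleftrightarrow> (\<exists>D. D 0 = f \<and> (\<forall>k x. (D k has_real_derivative D (Suc k) x) (at x)))"

text \<open>
  Smoothness by coinduction: iterated choice of a derivative inside a class that is closed under
  differentiation yields the derivatives of all orders.
\<close>

lemma smooth_if_closed_under_deriv:
  assumes "X f"
    and step: "\<And>g. X g \<Longrightarrow> \<exists>g'. X g' \<and> (\<forall>x. (g has_real_derivative g' x) (at x))"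
  shows "smooth f"
proof -
  have "\<exists>D. \<forall>n. (X (D n) \<and> (n = 0 \<longrightarrow> D n = f)) \<and>
      (\<forall>x. (D n has_real_derivative D (Suc n) x) (at x))"
  proof (rule dependent_nat_choice)
    show "\<exists>g. X g \<and> (0 = (0::nat) \<longrightarrow> g = f)" using assms(1) by blast
    fix g and n :: nat assume "X g \<and> (n = 0 \<longrightarrow> g = f)"
    then obtain g' where "X g'" "\<forall>x. (g has_real_derivative g' x) (at x)" using step by blast
    then show "\<exists>g'. (X g' \<and> (Suc n = 0 \<longrightarrow> g' = f)) \<and> (\<forall>x. (g has_real_derivative g' x) (at x))"
      by blast
  qed
  then obtain D where "\<forall>n. (X (D n) \<and> (n = 0 \<longrightarrow> D n = f)) \<and>
      (\<forall>x. (D n has_real_derivative D (Suc n) x) (at x))" by blast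
  then show ?thesis unfolding smooth_def by (intro exI[of _ D]) simp
qed

lemma smooth_has_deriv:
  assumes "smooth f"
  obtains f' where "smooth f'" "\<And>x. (f has_real_derivative f' x) (at x)"
proof -
  from assms obtain D where D: "D 0 = f" "\<And>k x. (D k has_real_derivative D (Suc k) x) (at x)"
    unfolding smooth_def by blast
  have "smooth (D 1)" unfolding smooth_def by (rule exI[of _ "\<lambda>k. D (Suc k)"]) (use D in auto)
  moreover have "(f has_real_derivative D 1 x) (at x)" for x using D(2)[of 0] D(1) by simp
  ultimately show ?thesis by (rule that)
qed

lemma smooth_continuous: "smooth f \<Longrightarrow> continuous_on S f"
  by (erule smooth_has_deriv) (rule DERIV_continuous_on, rule DERIV_subset, assumption, simp)

lemma smooth_poly: "smooth (poly p)"
proof (rule smooth_if_closed_under_deriv[where X = "\<lambda>g. \<exists>p. g = poly p"])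
  fix g :: "real \<Rightarrow> real" assume "\<exists>p. g = poly p"
  then obtain p where "g = poly p" ..
  then show "\<exists>g'. (\<exists>p. g' = poly p) \<and> (\<forall>x. (g has_real_derivative g' x) (at x))"
    using poly_DERIV[of p] by (intro exI[of _ "poly (pderiv p)"]) auto
qed blast

text \<open>
  Products of smooth functions are not closed under differentiation, but by the Leibniz rule
  their sums are.
\<close>

inductive sum_of_products :: "(real \<Rightarrow> real) \<Rightarrow> bool" where
  prod: "smooth f \<Longrightarrow> smooth g \<Longrightarrow> sum_of_products (\<lambda>x. f x * g x)"
| sum: "sum_of_products f \<Longrightarrow> sum_of_products g \<Longrightarrow> sum_of_products (\<lambda>x. f x + g x)"

lemma smooth_mult:
  assumes "smooth f" "smooth g"
  shows "smooth (\<lambda>x. f x * g x)"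
proof (rule smooth_if_closed_under_deriv[where X = sum_of_products])
  show "sum_of_products (\<lambda>x. f x * g x)" using assms by (rule prod)
next
  fix h assume "sum_of_products h"
  then show "\<exists>h'. sum_of_products h' \<and> (\<forall>x. (h has_real_derivative h' x) (at x))"
  proof induction
    case (prod f g)
    obtain f' where f': "smooth f'" "\<And>x. (f has_real_derivative f' x) (at x)"
      using smooth_has_deriv prod(1) by blast
    obtain g' where g': "smooth g'" "\<And>x. (g has_real_derivative g' x) (at x)"
      using smooth_has_deriv prod(2) by blast
    show ?case
    proof (intro exI conjI allI)
      show "sum_of_products (\<lambda>x. f' x * g x + f x * g' x)"
        using prod f' g' by (intro sum_of_products.intros)
      show "((\<lambda>x. f x * g x) has_real_derivative (f' x * g x + f x * g' x)) (at x)" for x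
        by (rule derivative_eq_intros f' g')+ simp
    qed
  next
    case (sum f g)
    obtain f' g' where "sum_of_products f'" "sum_of_products g'"
      "\<And>x. (f has_real_derivative f' x) (at x)" "\<And>x. (g has_real_derivative g' x) (at x)"
      using sum.IH by blast
    then show ?case
      by (intro exI[of _ "\<lambda>x. f' x + g' x"] conjI allI DERIV_add sum_of_products.sum)
  qed
qed

lemma smooth_affine:
  assumes "smooth f"
  shows "smooth (\<lambda>x. f (c * x + d))"
proof -
  from assms obtain D where D: "D 0 = f" "\<And>k x. (D k has_real_derivative D (Suc k) x) (at x)"
    unfolding smooth_def by blast
  show ?thesis unfolding smooth_def
  proof (intro exI[of _ "\<lambda>k x. c ^ k * D k (c * x + d)"] conjI allI)
    show "(\<lambda>x. c ^ 0 * D 0 (c * x + d)) = (\<lambda>x. f (c * x + d))" using D by simp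
    fix k x
    have "((\<lambda>x. D k (c * x + d)) has_real_derivative D (Suc k) (c * x + d) * c) (at x)"
      by (rule DERIV_chain2[OF D(2)]) (auto intro!: derivative_eq_intros)
    then show "((\<lambda>x. c ^ k * D k (c * x + d)) has_real_derivative
        c ^ Suc k * D (Suc k) (c * x + d)) (at x)"
      by (auto intro!: derivative_eq_intros)
  qed
qed

text \<open>
  The flat functions \<open>p(1/x) exp (-1/x)\<close>. The polynomial varies in order to close the class
  under differentiation. At zero all of them have derivative zero, because
  \<open>exp (- y)\<close> decays faster than every polynomial grows.
\<close>

definition flat :: "real poly \<Rightarrow> real \<Rightarrow> real"
  where "flat p x = (if x \<le> 0 then 0 else poly p (1 / x) * exp (- (1 / x)))"

lemma poly_times_exp_tendsto_0: "((\<lambda>y. poly p y * exp (- y)) \<longlongrightarrow> (0::real)) at_top"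
proof -
  have "((\<lambda>y. \<Sum>i\<le>degree p. coeff p i * (y ^ i / exp y)) \<longlongrightarrow> (\<Sum>i\<le>degree p. coeff p i * 0)) at_top"
    by (intro tendsto_intros tendsto_power_div_exp_0)
  moreover have "(\<lambda>y. \<Sum>i\<le>degree p. coeff p i * (y ^ i / exp y)) = (\<lambda>y. poly p y * exp (- y))"
    by (simp add: poly_altdef sum_distrib_right exp_minus divide_inverse mult.assoc)
  ultimately show ?thesis by simp
qed

lemma flat_has_deriv:
  "(flat p has_real_derivative flat ([:0, 0, 1:] * (p - pderiv p)) x) (at x)"
proof -
  consider "x > 0" | "x = 0" | "x < 0" by linarith
  then show ?thesis
  proof cases
    case 1
    have "((\<lambda>x. poly p (1 / x) * exp (- (1 / x))) has_real_derivative
        flat ([:0, 0, 1:] * (p - pderiv p)) x) (at x)"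
      unfolding flat_def using 1
      by (auto intro!: derivative_eq_intros DERIV_chain2[OF poly_DERIV]
          simp: field_simps power2_eq_square)
    then show ?thesis
      by (rule has_field_derivative_transform_within[where d = x]) (use 1 in \<open>auto simp: flat_def dist_real_def\<close>)
  next
    case 2
    have "((\<lambda>h. flat p h / h) \<longlongrightarrow> 0) (at_left 0)"
      by (rule tendsto_eventually) (auto simp: eventually_at_filter flat_def)
    moreover have "((\<lambda>h. flat p h / h) \<longlongrightarrow> 0) (at_right 0)"
    proof -
      have "((\<lambda>y. poly (pCons 0 p) (inverse y) * exp (- inverse y)) \<longlongrightarrow> 0) (at_right (0::real))"
        by (rule filterlim_compose[OF poly_times_exp_tendsto_0 filterlim_inverse_at_top_right])
      then show ?thesis
        by (rule Lim_transform_eventually)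
          (auto simp: eventually_at_filter flat_def divide_inverse)
    qed
    ultimately have "((\<lambda>h. flat p h / h) \<longlongrightarrow> 0) (at 0)"
      by (simp add: filterlim_split_at)
    then show ?thesis unfolding 2 DERIV_def by (simp add: flat_def)
  next
    case 3
    have "((\<lambda>x. 0) has_real_derivative flat ([:0, 0, 1:] * (p - pderiv p)) x) (at x)"
      using 3 by (simp add: flat_def)
    then show ?thesis
      by (rule has_field_derivative_transform_within[where d = "- x"]) (use 3 in \<open>auto simp: flat_def dist_real_def\<close>)
  qed
qed

lemma smooth_flat: "smooth (flat p)"
proof (rule smooth_if_closed_under_deriv[where X = "\<lambda>g. \<exists>p. g = flat p"])
  fix g :: "real \<Rightarrow> real" assume "\<exists>p. g = flat p"
  then obtain p where "g = flat p" ..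
  then show "\<exists>g'. (\<exists>p. g' = flat p) \<and> (\<forall>x. (g has_real_derivative g' x) (at x))"
    using flat_has_deriv[of p] by (intro exI[of _ "flat ([:0, 0, 1:] * (p - pderiv p))"]) auto
qed blast

text \<open>
  Each factor is zero near one end of the unit interval. At an inner point the arguments of \<open>flat 1\<close>
  tend to infinity with \<open>k\<close>, and \<open>exp (-1/y)\<close> tends to \<open>1\<close> as \<open>y\<close> grows, so the cutoffs
  tend to \<open>1\<close> pointwise.
\<close>

definition cutoff :: "nat \<Rightarrow> real \<Rightarrow> real"
  where "cutoff k x = flat 1 (real k * x - 1) * flat 1 (real k * (1 - x) - 1)"

lemma smooth_cutoff: "smooth (cutoff k)"
proof -
  have "smooth (\<lambda>x. flat 1 (real k * x + -1) * flat 1 (- real k * x + (real k - 1)))"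
    by (intro smooth_mult smooth_affine smooth_flat)
  moreover have "(\<lambda>x. flat 1 (real k * x + -1) * flat 1 (- real k * x + (real k - 1))) = cutoff k"
    by (auto simp: cutoff_def algebra_simps)
  ultimately show ?thesis by simp
qed

lemma cutoff_bounds: "0 \<le> cutoff k x" "cutoff k x \<le> 1"
proof -
  have *: "0 \<le> flat 1 y" "flat 1 y \<le> 1" for y by (auto simp: flat_def)
  show "0 \<le> cutoff k x" unfolding cutoff_def using * by simp
  show "cutoff k x \<le> 1" unfolding cutoff_def using * by (simp add: mult_le_one)
qed

lemma cutoff_eq_0: 
  assumes "x < 1 / real (Suc k) \<or> 1 - 1 / real (Suc k) < x" 
  shows "cutoff k x = 0"
proof -
  have "real k * x \<le> 1 \<or> real k * (1 - x) \<le> 1"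
  proof (cases "k = 0")
    case False
    have "1 / real (Suc k) \<le> 1 / real k" using False by (simp add: frac_le)
    with assms have "x \<le> 1 / real k \<or> 1 - x \<le> 1 / real k" by linarith
    then show ?thesis using False by (simp add: field_simps)
  qed simp
  then show ?thesis by (auto simp: cutoff_def flat_def)
qed

lemma cutoff_tendsto_1:
  assumes "0 < x" "x < 1"
  shows "(\<lambda>k. cutoff k x) \<longlonglongrightarrow> 1"
proof -
  have *: "(\<lambda>k. flat 1 (real k * y - 1)) \<longlonglongrightarrow> 1" if "y > 0" for y
  proof -
    have lim: "filterlim (\<lambda>k. real k * y - 1) at_top sequentially"
      using that by real_asymp
    have "(\<lambda>k. exp (- inverse (real k * y - 1))) \<longlonglongrightarrow> exp (- 0)"
      by (intro tendsto_exp tendsto_minus tendsto_inverse_0_at_top lim)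
    moreover have "\<forall>\<^sub>F k in sequentially. exp (- inverse (real k * y - 1)) = flat 1 (real k * y - 1)"
      using lim[unfolded filterlim_at_top_dense, rule_format, of 0]
      by eventually_elim (auto simp: flat_def divide_inverse)
    ultimately show ?thesis by (auto intro: Lim_transform_eventually)
  qed
  show ?thesis unfolding cutoff_def
    using tendsto_mult[OF *[of x] *[of "1 - x"]] assms by simp
qed

text \<open>
  Compact support in the open interval, in the form used below: the function vanishes near both
  end points.
\<close>

lemma C0_inf_iff:
  "\<psi> \<in> C0_inf \<longleftrightarrow>
    (\<exists>D. (\<forall>x\<in>{0..1}. D 0 x = \<psi> x) \<and>
         (\<forall>k. \<forall>x\<in>{0..1}. (D k has_real_derivative D (Suc k) x) (at x within {0..1}))) \<and>
    (\<exists>d>0. \<forall>x\<in>{0..1}. x < d \<or> 1 - d < x \<longrightarrow> \<psi> x = 0)"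
  (is "_ \<longleftrightarrow> ?D \<and> ?z")
proof -
  let ?C = "closure {x \<in> {0..1}. \<psi> x \<noteq> 0}"
  have "?C \<subseteq> {0<..<1} \<longleftrightarrow> ?z"
  proof
    assume cl: "?C \<subseteq> {0<..<1}"
    have op: "open (- ?C)" by (rule open_Compl[OF closed_closure])
    have sep: "\<exists>e>0. \<forall>y. dist y x < e \<longrightarrow> y \<notin> ?C" if "x \<notin> ?C" for x
      using op[unfolded open_dist] that by simp
    have "0 \<notin> ?C" "1 \<notin> ?C" using cl by (meson greaterThanLessThan_iff less_irrefl subsetD)+
    obtain e1 where e1: "e1 > 0" "\<forall>y. dist y 0 < e1 \<longrightarrow> y \<notin> ?C"
      using sep[OF \<open>0 \<notin> ?C\<close>] by blast
    obtain e2 where e2: "e2 > 0" "\<forall>y. dist y 1 < e2 \<longrightarrow> y \<notin> ?C"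
      using sep[OF \<open>1 \<notin> ?C\<close>] by blast
    have z: "\<psi> x = 0" if "x \<in> {0..1}" "x \<notin> ?C" for x
      using that closure_subset[of "{x \<in> {0..1}. \<psi> x \<noteq> 0}"] by blast
    show ?z
    proof (intro exI[of _ "min e1 e2"] conjI ballI impI)
      show "0 < min e1 e2" using e1 e2 by simp
      fix x :: real assume x: "x \<in> {0..1}" "x < min e1 e2 \<or> 1 - min e1 e2 < x"
      then have "dist x 0 < e1 \<or> dist x 1 < e2" by (auto simp: dist_real_def)
      then have "x \<notin> ?C" using e1(2)[rule_format, of x] e2(2)[rule_format, of x] by blast
      with x(1) show "\<psi> x = 0" by (rule z)
    qed
  next
    assume ?z
    then obtain d where d: "d > 0" "\<forall>x\<in>{0..1}. x < d \<or> 1 - d < x \<longrightarrow> \<psi> x = 0" by blast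
    have "?C \<subseteq> {d..1 - d}"
    proof (rule closure_minimal)
      show "{x \<in> {0..1}. \<psi> x \<noteq> 0} \<subseteq> {d..1 - d}"
      proof
        fix x assume "x \<in> {x \<in> {0..1}. \<psi> x \<noteq> 0}"
        with d(2) have "\<not> (x < d \<or> 1 - d < x)" by blast
        then show "x \<in> {d..1 - d}" by auto
      qed
    qed simp
    also have "\<dots> \<subseteq> {0<..<1}" using \<open>d > 0\<close> by auto
    finally show "?C \<subseteq> {0<..<1}" .
  qed
  then show ?thesis unfolding C0_inf_def mem_Collect_eq by (rule arg_cong)
qed

lemma C0_infI:
  assumes "smooth \<psi>" "d > 0" and zero: "\<And>x. x < d \<or> 1 - d < x \<Longrightarrow> \<psi> x = 0"
  shows "\<psi> \<in> C0_inf"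
  unfolding C0_inf_iff
proof
  from assms(1) obtain D where D: "D 0 = \<psi>" "\<And>k x. (D k has_real_derivative D (Suc k) x) (at x)"
    unfolding smooth_def by blast
  have "(D k has_real_derivative D (Suc k) x) (at x within {0..1})" for k x
    by (rule DERIV_subset[OF D(2)]) simp
  with D(1) show "\<exists>D. (\<forall>x\<in>{0..1}. D 0 x = \<psi> x) \<and>
      (\<forall>k. \<forall>x\<in>{0..1}. (D k has_real_derivative D (Suc k) x) (at x within {0..1}))"
    by blast
  show "\<exists>d>0. \<forall>x\<in>{0..1}. x < d \<or> 1 - d < x \<longrightarrow> \<psi> x = 0" using assms by blast
qed

lemma cutoff_mult_in_C0_inf:
  assumes "smooth f"
  shows "(\<lambda>x. f x * cutoff k x) \<in> C0_inf"
proof (rule C0_infI[where d = "1 / real (Suc k)"])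
  show "smooth (\<lambda>x. f x * cutoff k x)" by (rule smooth_mult[OF assms smooth_cutoff])
  show "f x * cutoff k x = 0" if "x < 1 / real (Suc k) \<or> 1 - 1 / real (Suc k) < x" for x
    by (simp only: cutoff_eq_0[OF that] mult_zero_right)
qed simp

lemma C0_inf_D:
  assumes "\<psi> \<in> C0_inf"
  obtains \<psi>' d where "\<forall>x\<in>{0..1}. (\<psi> has_real_derivative \<psi>' x) (at x within {0..1})"
    "continuous_on {0..1} \<psi>'" "0 < d"
    "\<forall>x\<in>{0..1}. x < d \<or> 1 - d < x \<longrightarrow> \<psi> x = 0"
proof -
  from assms obtain D d where "\<forall>x\<in>{0..1}. D 0 x = \<psi> x"
      "\<forall>k. \<forall>x\<in>{0..1}. (D k has_real_derivative D (Suc k) x) (at x within {0..1})"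
    and d: "d > 0" "\<forall>x\<in>{0..1}. x < d \<or> 1 - d < x \<longrightarrow> \<psi> x = 0"
    unfolding C0_inf_iff by blast
  then have D0: "D 0 x = \<psi> x"
    and D: "(D k has_real_derivative D (Suc k) x) (at x within {0..1})" if "x \<in> {0..1}" for k x
    using that by blast+
  have 1: "(\<psi> has_real_derivative D 1 x) (at x within {0..1})" if "x \<in> {0..1}" for x
  proof (rule has_field_derivative_transform_within[where d = 1])
    show "(D 0 has_real_derivative D 1 x) (at x within {0..1})" using D[OF that, of 0] by simp
  qed (use D0 that in auto)
  have 2: "continuous_on {0..1} (D 1)"
    unfolding continuous_on_eq_continuous_within
  proof
    fix x :: real assume "x \<in> {0..1}"
    from DERIV_continuous[OF D[OF this, of 1]]
    show "continuous (at x within {0..1}) (D 1)" .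
  qed
  show ?thesis by (rule that[OF _ 2 d]) (use 1 in blast)
qed

lemma C0_inf_continuous:
  assumes "\<psi> \<in> C0_inf" shows "continuous_on {0..1} \<psi>"
  using assms by (rule C0_inf_D) (rule DERIV_continuous_on, blast)

lemma C0_inf_deriv:
  assumes "\<forall>x\<in>{0..1}. (\<psi> has_real_derivative \<psi>' x) (at x within {0..1})" "x \<in> {0<..<1}"
  shows "deriv \<psi> x = \<psi>' x"
proof (rule DERIV_imp_deriv)
  have "at x within {0..1} = at x" by (rule at_within_interior) (use assms(2) in simp)
  moreover have "x \<in> {0..1}" using assms(2) by simp
  ultimately show "(\<psi> has_real_derivative \<psi>' x) (at x)" using assms(1) by metis
qed

lemma C0_inf_diff:
  assumes "f \<in> C0_inf" "g \<in> C0_inf"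
  shows "(\<lambda>x. f x - K * g x) \<in> C0_inf"
proof -
  obtain D d where D: "\<forall>x\<in>{0..1}. D 0 x = f x"
      "\<forall>k. \<forall>x\<in>{0..1}. (D k has_real_derivative D (Suc k) x) (at x within {0..1})"
      "d > 0" "\<forall>x\<in>{0..1}. x < d \<or> 1 - d < x \<longrightarrow> f x = 0"
    using assms(1) unfolding C0_inf_iff by blast
  obtain E e where E: "\<forall>x\<in>{0..1}. E 0 x = g x"
      "\<forall>k. \<forall>x\<in>{0..1}. (E k has_real_derivative E (Suc k) x) (at x within {0..1})"
      "e > 0" "\<forall>x\<in>{0..1}. x < e \<or> 1 - e < x \<longrightarrow> g x = 0"
    using assms(2) unfolding C0_inf_iff by blast
  show ?thesis unfolding C0_inf_iff
  proof (intro conjI exI[of _ "\<lambda>k x. D k x - K * E k x"] exI[of _ "min d e"] allI ballI impI)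
    fix k and x :: real assume "x \<in> {0..1}"
    then show "((\<lambda>x. D k x - K * E k x) has_real_derivative D (Suc k) x - K * E (Suc k) x) (at x within {0..1})"
      using D(2) E(2) by (intro DERIV_diff DERIV_cmult) blast+
  qed (use D(1,3,4) E(1,3,4) in auto)
qed

text \<open>
  The mean value zero is what makes the primitive vanish near the right end point.
\<close>

lemma C0_inf_primitive:
  assumes "\<eta> \<in> C0_inf" "integral {0..1} \<eta> = 0"
  shows "(\<lambda>x. integral {0..x} \<eta>) \<in> C0_inf"
proof -
  obtain D d where D: "\<forall>x\<in>{0..1}. D 0 x = \<eta> x"
      "\<forall>k. \<forall>x\<in>{0..1}. (D k has_real_derivative D (Suc k) x) (at x within {0..1})"
      "d > 0" "\<forall>x\<in>{0..1}. x < d \<or> 1 - d < x \<longrightarrow> \<eta> x = 0"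
    using assms(1) unfolding C0_inf_iff by blast
  have cont: "continuous_on {0..1} \<eta>" by (rule C0_inf_continuous[OF assms(1)])
  then have int: "\<eta> integrable_on {0..1}" by (rule integrable_continuous_real)
  define E where "E k = (case k of 0 \<Rightarrow> \<lambda>x. integral {0..x} \<eta> | Suc k \<Rightarrow> D k)" for k
  show ?thesis unfolding C0_inf_iff
  proof (intro conjI exI[of _ E] exI[of _ "min d 1"] allI ballI impI)
    show "E 0 x = integral {0..x} \<eta>" for x by (simp add: E_def)
    show "(E k has_real_derivative E (Suc k) x) (at x within {0..1})" if "x \<in> {0..1}" for k x
    proof (cases k)
      case 0
      then show ?thesis
        using integral_has_real_derivative[OF cont that] D(1) that by (simp add: E_def)
    next
      case (Suc i)
      then show ?thesis using D(2) that by (simp add: E_def)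
    qed
    show "0 < min d 1" using D(3) by simp
    fix x :: real assume x: "x \<in> {0..1}" "x < min d 1 \<or> 1 - min d 1 < x"
    from x(2) show "integral {0..x} \<eta> = 0"
    proof
      assume "x < min d 1"
      then have "integral {0..x} \<eta> = integral {0..x} (\<lambda>x. 0)"
        using D(4) x(1) by (intro integral_cong) auto
      then show ?thesis by simp
    next
      assume "1 - min d 1 < x"
      then have "integral {x..1} \<eta> = integral {x..1} (\<lambda>x. 0)"
        using D(4) x(1) by (intro integral_cong) auto
      moreover have "integral {0..x} \<eta> + integral {x..1} \<eta> = integral {0..1} \<eta>"
        by (rule Henstock_Kurzweil_Integration.integral_combine) (use x(1) int in auto)
      ultimately show ?thesis using assms(2) by simp
    qed
  qed
qed


section \<open>Square integrable functions and density\<close>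

lemma finite_measure_M01: "finite_measure M01"
  by (rule finite_measure_lebesgue_on) (simp add: lmeasurable_interval)

text \<open>
  With the square of the norm, \<open>norm_add_sq_le\<close> can take the place of the triangle inequality
  in all density arguments.
\<close>

definition L2_sq :: "(real \<Rightarrow> 'b::{banach,second_countable_topology}) \<Rightarrow> real"
  where "L2_sq f = (LINT x|M01. (norm (f x))\<^sup>2)"

lemma L2_norm_eq_sqrt: "L2_norm f = sqrt (L2_sq f)"
  by (simp add: L2_norm_def L2_sq_def)

lemma L2_sq_nonneg: "0 \<le> L2_sq f"
  unfolding L2_sq_def by (rule integral_nonneg_AE) simp

lemma L2D:
  assumes "f \<in> L2"
  shows "f \<in> borel_measurable M01" "integrable M01 (\<lambda>x. (norm (f x))\<^sup>2)"
  using assms by (auto simp: L2_def)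

lemma L2_dominated:
  fixes f :: "real \<Rightarrow> 'a::{banach,second_countable_topology}"
    and h :: "real \<Rightarrow> 'b::{banach,second_countable_topology}"
  assumes f: "f \<in> L2" and h: "h \<in> borel_measurable M01"
    and le: "\<And>x. x \<in> {0<..<1} \<Longrightarrow> norm (h x) \<le> K * norm (f x)"
  shows "h \<in> L2"
proof -
  have "integrable M01 (\<lambda>x. K\<^sup>2 * (norm (f x))\<^sup>2)" using L2D(2)[OF f] by simp
  then have "integrable M01 (\<lambda>x. (norm (h x))\<^sup>2)"
  proof (rule Bochner_Integration.integrable_bound)
    show "(\<lambda>x. (norm (h x))\<^sup>2) \<in> borel_measurable M01" using h by measurable
    show "AE x in M01. norm ((norm (h x))\<^sup>2) \<le> norm (K\<^sup>2 * (norm (f x))\<^sup>2)"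
    proof (rule AE_I2)
      fix x assume "x \<in> space M01"
      then have "(norm (h x))\<^sup>2 \<le> (K * norm (f x))\<^sup>2" using le by (intro power_mono) auto
      then show "norm ((norm (h x))\<^sup>2) \<le> norm (K\<^sup>2 * (norm (f x))\<^sup>2)"
        by (simp add: power_mult_distrib)
    qed
  qed
  with h show ?thesis by (simp add: L2_def)
qed

lemma L2_const: "(\<lambda>x. c) \<in> L2"
  unfolding L2_def using finite_measure.integrable_const[OF finite_measure_M01] by simp

lemma L2_bounded:
  fixes f :: "real \<Rightarrow> 'a::{banach,second_countable_topology}"
  assumes "f \<in> borel_measurable M01" "\<And>x. x \<in> {0<..<1} \<Longrightarrow> norm (f x) \<le> K"
  shows "f \<in> L2"
  by (rule L2_dominated[OF L2_const[of "1::real"], of _ K]) (use assms in auto)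

lemma measurable_M01_continuous:
  "continuous_on {0..1} f \<Longrightarrow> f \<in> borel_measurable M01"
  by (rule continuous_imp_measurable_on_sets_lebesgue) (auto elim: continuous_on_subset)

lemma L2_continuous:
  fixes f :: "real \<Rightarrow> 'a::{banach,second_countable_topology}"
  assumes "continuous_on {0..1} f"
  shows "f \<in> L2"
proof -
  have "compact (f ` {0..1})" using assms by (intro compact_continuous_image) auto
  from compact_imp_bounded[OF this] obtain K where K: "\<forall>y\<in>f ` {0..1}. norm y \<le> K"
    unfolding bounded_iff by blast
  show ?thesis
  proof (rule L2_bounded[of _ K])
    show "f \<in> borel_measurable M01" by (rule measurable_M01_continuous[OF assms])
  qed (use K in auto)
qed

lemma norm_add_sq_le: "(norm (x + y))\<^sup>2 \<le> 2 * (norm x)\<^sup>2 + 2 * (norm y)\<^sup>2"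
proof -
  have "(norm (x + y))\<^sup>2 \<le> (norm x + norm y)\<^sup>2" by (intro power_mono norm_triangle_ineq) simp
  also have "\<dots> \<le> 2 * (norm x)\<^sup>2 + 2 * (norm y)\<^sup>2"
    using sum_squares_bound[of "norm x" "norm y"] by (simp add: power2_sum)
  finally show ?thesis .
qed

lemma
  fixes f g :: "real \<Rightarrow> 'a::{banach,second_countable_topology}"
  assumes f: "f \<in> L2" and g: "g \<in> L2"
  shows L2_add: "(\<lambda>x. f x + g x) \<in> L2"
    and L2_sq_add: "L2_sq (\<lambda>x. f x + g x) \<le> 2 * L2_sq f + 2 * L2_sq g"
proof -
  have m: "(\<lambda>x. f x + g x) \<in> borel_measurable M01" using L2D(1)[OF f] L2D(1)[OF g] by measurable
  have i: "integrable M01 (\<lambda>x. 2 * (norm (f x))\<^sup>2 + 2 * (norm (g x))\<^sup>2)"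
    using L2D(2)[OF f] L2D(2)[OF g] by simp
  have j: "integrable M01 (\<lambda>x. (norm (f x + g x))\<^sup>2)"
  proof (rule Bochner_Integration.integrable_bound[OF i])
    show "(\<lambda>x. (norm (f x + g x))\<^sup>2) \<in> borel_measurable M01" using m by measurable
    show "AE x in M01. norm ((norm (f x + g x))\<^sup>2) \<le> norm (2 * (norm (f x))\<^sup>2 + 2 * (norm (g x))\<^sup>2)"
    proof (rule AE_I2)
      fix x
      show "norm ((norm (f x + g x))\<^sup>2) \<le> norm (2 * (norm (f x))\<^sup>2 + 2 * (norm (g x))\<^sup>2)"
        using norm_add_sq_le[of "f x" "g x"] by simp
    qed
  qed
  with m show "(\<lambda>x. f x + g x) \<in> L2" by (simp add: L2_def)
  have "L2_sq (\<lambda>x. f x + g x) \<le> (LINT x|M01. 2 * (norm (f x))\<^sup>2 + 2 * (norm (g x))\<^sup>2)"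
    unfolding L2_sq_def by (rule integral_mono[OF j i]) (rule norm_add_sq_le)
  also have "\<dots> = 2 * L2_sq f + 2 * L2_sq g"
    unfolding L2_sq_def using L2D(2)[OF f] L2D(2)[OF g] by simp
  finally show "L2_sq (\<lambda>x. f x + g x) \<le> 2 * L2_sq f + 2 * L2_sq g" .
qed

lemma L2_uminus:
  assumes "f \<in> L2" shows "(\<lambda>x. - f x) \<in> L2"
  by (rule L2_dominated[OF assms, of _ 1]) (use L2D(1)[OF assms] in auto)

lemma L2_diff:
  assumes "f \<in> L2" "g \<in> L2" shows "(\<lambda>x. f x - g x) \<in> L2"
  using L2_add[OF assms(1) L2_uminus[OF assms(2)]] by simp

lemma L2_mult_continuous:
  fixes f g :: "real \<Rightarrow> 'a::{banach,second_countable_topology,real_normed_algebra}"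
  assumes f: "f \<in> L2" and g: "continuous_on {0..1} g"
  shows "(\<lambda>x. g x * f x) \<in> L2"
proof -
  have "compact (g ` {0..1})" using g by (intro compact_continuous_image) auto
  from compact_imp_bounded[OF this] obtain K where K: "\<forall>y\<in>g ` {0..1}. norm y \<le> K"
    unfolding bounded_iff by blast
  show ?thesis
  proof (rule L2_dominated[OF f, of _ K])
    show "(\<lambda>x. g x * f x) \<in> borel_measurable M01"
      using L2D(1)[OF f] measurable_M01_continuous[OF g] by measurable
    show "norm (g x * f x) \<le> K * norm (f x)" if "x \<in> {0<..<1}" for x
      using K that by (intro order_trans[OF norm_mult_ineq] mult_right_mono) auto
  qed
qed

lemma L2_mult_integrable:
  fixes f :: "real \<Rightarrow> 'a::{banach,second_countable_topology,real_normed_algebra}"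
  assumes f: "f \<in> L2" and g: "g \<in> L2"
  shows "integrable M01 (\<lambda>x. f x * g x)"
proof (rule Bochner_Integration.integrable_bound)
  show "integrable M01 (\<lambda>x. (norm (f x))\<^sup>2 + (norm (g x))\<^sup>2)"
    using L2D(2)[OF f] L2D(2)[OF g] by simp
  show "(\<lambda>x. f x * g x) \<in> borel_measurable M01" using L2D(1)[OF f] L2D(1)[OF g] by measurable
  show "AE x in M01. norm (f x * g x) \<le> norm ((norm (f x))\<^sup>2 + (norm (g x))\<^sup>2)"
  proof (rule AE_I2)
    fix x
    have "norm (f x * g x) \<le> norm (f x) * norm (g x)" by (rule norm_mult_ineq)
    also have "\<dots> \<le> (norm (f x))\<^sup>2 + (norm (g x))\<^sup>2"
      using sum_squares_bound[of "norm (f x)" "norm (g x)"]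
        mult_nonneg_nonneg[OF norm_ge_zero[of "f x"] norm_ge_zero[of "g x"]] by linarith
    finally show "norm (f x * g x) \<le> norm ((norm (f x))\<^sup>2 + (norm (g x))\<^sup>2)" by simp
  qed
qed

lemma L2_integrable:
  fixes f :: "real \<Rightarrow> 'a::{banach,second_countable_topology,real_normed_algebra_1}"
  assumes "f \<in> L2" shows "integrable M01 f"
  using L2_mult_integrable[OF assms L2_const[of 1]] by simp

lemma L2_sq_eq_0_iff:
  assumes "f \<in> L2"
  shows "L2_sq f = 0 \<longleftrightarrow> (AE x in M01. f x = 0)"
  unfolding L2_sq_def using integral_nonneg_eq_0_iff_AE[OF L2D(2)[OF assms]] by simp

lemma L2_sq_dominated_convergence:
  fixes f :: "real \<Rightarrow> 'a::{banach,second_countable_topology}"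
  assumes "f \<in> borel_measurable M01" "\<And>k. s k \<in> borel_measurable M01"
    and w: "w \<in> L2" and lim: "AE x in M01. (\<lambda>k. s k x) \<longlonglongrightarrow> f x"
    and bound: "\<And>k x. x \<in> {0<..<1} \<Longrightarrow> norm (s k x - f x) \<le> norm (w x)"
  shows "(\<lambda>k. L2_sq (\<lambda>x. s k x - f x)) \<longlonglongrightarrow> 0"
proof -
  have "(\<lambda>k. LINT x|M01. (norm (s k x - f x))\<^sup>2) \<longlonglongrightarrow> (LINT x|M01. 0)"
  proof (rule integral_dominated_convergence)
    show "integrable M01 (\<lambda>x. (norm (w x))\<^sup>2)" by (rule L2D(2)[OF w])
    show "(\<lambda>x. (norm (s k x - f x))\<^sup>2) \<in> borel_measurable M01" for k using assms(1,2) by measurable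
    show "AE x in M01. norm ((norm (s k x - f x))\<^sup>2) \<le> (norm (w x))\<^sup>2" for k
      using bound by (intro AE_I2) (auto intro!: power_mono)
    show "AE x in M01. (\<lambda>k. (norm (s k x - f x))\<^sup>2) \<longlonglongrightarrow> 0"
      using lim
    proof eventually_elim
      case (elim x)
      from tendsto_power[OF tendsto_norm_zero[OF LIM_zero[OF elim]], of 2] show ?case by simp
    qed
  qed simp
  then show ?thesis by (simp add: L2_sq_def)
qed

definition C0_inf_approximable :: "(real \<Rightarrow> real) \<Rightarrow> bool"
  where "C0_inf_approximable f \<longleftrightarrow>
    f \<in> L2 \<and> (\<forall>e>0. \<exists>\<psi>\<in>C0_inf. \<psi> \<in> L2 \<and> L2_sq (\<lambda>x. \<psi> x - f x) < e)"

lemma C0_inf_L2: "\<psi> \<in> C0_inf \<Longrightarrow> \<psi> \<in> L2"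
  by (intro L2_continuous C0_inf_continuous)

lemma C0_inf_approximable_closed:
  assumes f: "f \<in> L2"
    and ex: "\<And>e. e > 0 \<Longrightarrow> \<exists>g. C0_inf_approximable g \<and> L2_sq (\<lambda>x. g x - f x) < e"
  shows "C0_inf_approximable f"
  unfolding C0_inf_approximable_def
proof (intro conjI f allI impI)
  fix e :: real assume "e > 0"
  then obtain g where g: "C0_inf_approximable g" "L2_sq (\<lambda>x. g x - f x) < e / 4"
    using ex[of "e / 4"] by auto
  then obtain \<psi> where psi: "\<psi> \<in> C0_inf" "\<psi> \<in> L2" "L2_sq (\<lambda>x. \<psi> x - g x) < e / 4" and g2: "g \<in> L2"
    using \<open>e > 0\<close> unfolding C0_inf_approximable_def
      by (meson zero_less_divide_iff zero_less_numeral)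
  have "L2_sq (\<lambda>x. \<psi> x - f x) = L2_sq (\<lambda>x. (\<psi> x - g x) + (g x - f x))" by simp
  also have "\<dots> \<le> 2 * L2_sq (\<lambda>x. \<psi> x - g x) + 2 * L2_sq (\<lambda>x. g x - f x)"
    by (intro L2_sq_add L2_diff psi g2 f)
  also have "\<dots> < e" using psi(3) g(2) by simp
  finally show "\<exists>\<psi>\<in>C0_inf. \<psi> \<in> L2 \<and> L2_sq (\<lambda>x. \<psi> x - f x) < e" using psi by blast
qed

lemma C0_inf_approximable_limit:
  assumes f: "f \<in> L2" and s: "\<And>k. C0_inf_approximable (s k)"
    and lim: "(\<lambda>k. L2_sq (\<lambda>x. s k x - f x)) \<longlonglongrightarrow> 0"
  shows "C0_inf_approximable f"
proof (rule C0_inf_approximable_closed[OF f])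
  fix e :: real assume "e > 0"
  from order_tendstoD(2)[OF lim this] obtain k where "L2_sq (\<lambda>x. s k x - f x) < e"
    by (auto simp: eventually_sequentially)
  with s show "\<exists>g. C0_inf_approximable g \<and> L2_sq (\<lambda>x. g x - f x) < e" by blast
qed

lemma C0_inf_approximable_C0_inf:
  assumes "\<psi> \<in> C0_inf" shows "C0_inf_approximable \<psi>"
  unfolding C0_inf_approximable_def
proof (intro conjI allI impI)
  show L: "\<psi> \<in> L2" by (rule C0_inf_L2[OF assms])
  fix e :: real assume "e > 0"
  then show "\<exists>\<psi>'\<in>C0_inf. \<psi>' \<in> L2 \<and> L2_sq (\<lambda>x. \<psi>' x - \<psi> x) < e"
    using assms L by (intro bexI[of _ \<psi>]) (auto simp: L2_sq_def)
qed

text \<open>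
  Cut off near the end points; the cutoffs are bounded by \<open>1\<close> and tend to \<open>1\<close>.
\<close>

lemma C0_inf_approximable_poly: "C0_inf_approximable (poly p)"
proof (rule C0_inf_approximable_limit)
  show L: "poly p \<in> L2" by (intro L2_continuous smooth_continuous smooth_poly)
  show "C0_inf_approximable (\<lambda>x. poly p x * cutoff k x)" for k
    by (intro C0_inf_approximable_C0_inf cutoff_mult_in_C0_inf smooth_poly)
  show "(\<lambda>k. L2_sq (\<lambda>x. poly p x * cutoff k x - poly p x)) \<longlonglongrightarrow> 0"
  proof (rule L2_sq_dominated_convergence[OF _ _ L])
    show "poly p \<in> borel_measurable M01"
      by (intro measurable_M01_continuous smooth_continuous smooth_poly)
    show "(\<lambda>x. poly p x * cutoff k x) \<in> borel_measurable M01" for k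
      by (intro measurable_M01_continuous continuous_on_mult smooth_continuous smooth_poly smooth_cutoff)
    show "AE x in M01. (\<lambda>k. poly p x * cutoff k x) \<longlonglongrightarrow> poly p x"
    proof (rule AE_I2)
      fix x assume "x \<in> space M01"
      then have "(\<lambda>k. poly p x * cutoff k x) \<longlonglongrightarrow> poly p x * 1"
        by (intro tendsto_mult tendsto_const cutoff_tendsto_1) auto
      then show "(\<lambda>k. poly p x * cutoff k x) \<longlonglongrightarrow> poly p x" by simp
    qed
    show "norm (poly p x * cutoff k x - poly p x) \<le> norm (poly p x)" for k x
    proof -
      have "norm (poly p x * cutoff k x - poly p x) = norm (poly p x) * \<bar>cutoff k x - 1\<bar>"
        by (simp add: algebra_simps flip: abs_mult)
      also have "\<dots> \<le> norm (poly p x)"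
        using cutoff_bounds[of k x] by (intro mult_left_le) auto
      finally show ?thesis .
    qed
  qed
qed

text \<open>
  By the Weierstrass approximation theorem.
\<close>

lemma C0_inf_approximable_continuous:
  assumes "continuous_on {0..1} f" shows "C0_inf_approximable f"
proof (rule C0_inf_approximable_closed[OF L2_continuous[OF assms]])
  fix e :: real assume "e > 0"
  define d where "d = sqrt (e / 2)"
  have d: "d > 0" "d\<^sup>2 = e / 2" using \<open>e > 0\<close> by (auto simp: d_def)
  obtain q where q: "real_polynomial_function q" "\<And>x. x \<in> {0..1} \<Longrightarrow> \<bar>f x - q x\<bar> < d"
    using Stone_Weierstrass_real_polynomial_function[OF _ assms d(1)] compact_Icc by blast
  then obtain c N where "q = (\<lambda>x. \<Sum>i\<le>N. c i * x ^ i)"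
    by (auto simp: real_polynomial_function_iff_sum)
  then have qp: "q = poly (\<Sum>i\<le>N. monom (c i) i)" by (auto simp: poly_sum poly_monom)
  have qL: "q \<in> L2" unfolding qp by (intro L2_continuous smooth_continuous smooth_poly)
  have "L2_sq (\<lambda>x. q x - f x) \<le> (LINT x|M01. d\<^sup>2)"
    unfolding L2_sq_def
  proof (rule integral_mono)
    show "integrable M01 (\<lambda>x. (norm (q x - f x))\<^sup>2)"
      using L2D(2)[OF L2_diff[OF qL L2_continuous[OF assms]]] .
    show "integrable M01 (\<lambda>x. d\<^sup>2)" by (rule finite_measure.integrable_const[OF finite_measure_M01])
    show "(norm (q x - f x))\<^sup>2 \<le> d\<^sup>2" if "x \<in> space M01" for x
      using q(2)[of x] that by (intro power_mono) (auto simp: abs_minus_commute)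
  qed
  also have "\<dots> = d\<^sup>2" by (simp add: measure_restrict_space)
  finally have "L2_sq (\<lambda>x. q x - f x) < e" using d \<open>e > 0\<close> by simp
  then show "\<exists>g. C0_inf_approximable g \<and> L2_sq (\<lambda>x. g x - f x) < e"
    using C0_inf_approximable_poly unfolding qp by blast
qed

text \<open>
  A measurable function is an almost everywhere limit of continuous functions. These may be
  truncated at the bound of the limit, which makes dominated convergence applicable.
\<close>

lemma C0_inf_dense_bounded:
  assumes m: "f \<in> borel_measurable M01" and b: "\<And>x. \<bar>f x\<bar> \<le> K"
  shows "C0_inf_approximable f"
proof -
  have "f measurable_on {0<..<1}" using m by (simp add: measurable_on_iff_borel_measurable)
  then obtain N g where N: "negligible N" and g: "\<And>k. continuous_on UNIV (g k)"
    and lim: "\<And>x. x \<notin> N \<Longrightarrow> (\<lambda>k. g k x) \<longlonglongrightarrow> (if x \<in> {0<..<1} then f x else 0)"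
    unfolding measurable_on_def by auto
  define h where "h k x = max (- K) (min K (g k x))" for k x
  have h: "continuous_on {0..1} (h k)" for k
    unfolding h_def by (intro continuous_intros continuous_on_subset[OF g]) auto
  have K: "K \<ge> 0" using b[of 0] by linarith
  have hb: "\<bar>h k x\<bar> \<le> K" for k x using K by (auto simp: h_def)
  show ?thesis
  proof (rule C0_inf_approximable_limit[where s = h])
    show "f \<in> L2" by (rule L2_bounded[OF m, of K]) (use b in auto)
    show "C0_inf_approximable (h k)" for k by (rule C0_inf_approximable_continuous[OF h])
    show "(\<lambda>k. L2_sq (\<lambda>x. h k x - f x)) \<longlonglongrightarrow> 0"
    proof (rule L2_sq_dominated_convergence[OF m measurable_M01_continuous[OF h]])
      show "(\<lambda>x. 2 * K) \<in> L2" by (rule L2_const)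
      show "norm (h k x - f x) \<le> norm (2 * K)" for k x
        using hb[of k x] b[of x] by simp
      have "AE x in lebesgue. x \<notin> N" using N
        by (auto simp: negligible_iff_null_sets intro: AE_not_in)
      then have "AE x in M01. x \<notin> N" by (subst AE_restrict_space_iff) auto
      then show "AE x in M01. (\<lambda>k. h k x) \<longlonglongrightarrow> f x"
        using AE_space
      proof eventually_elim
        case (elim x)
        then have "(\<lambda>k. g k x) \<longlonglongrightarrow> f x" using lim[of x] by simp
        then have "(\<lambda>k. h k x) \<longlonglongrightarrow> max (- K) (min K (f x))"
          unfolding h_def by (intro tendsto_max tendsto_min tendsto_const)
        moreover have "max (- K) (min K (f x)) = f x" using b[of x] by linarith
        ultimately show ?case by simp
      qed
    qed
  qed
qed

text \<open>
  By truncation at height \<open>k\<close>.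
\<close>

lemma C0_inf_dense_L2:
  assumes f: "f \<in> L2" shows "C0_inf_approximable f"
proof (rule C0_inf_approximable_limit[OF f])
  define h where "h k x = max (- real k) (min (real k) (f x))" for k x
  have m: "h k \<in> borel_measurable M01" for k unfolding h_def using L2D(1)[OF f] by measurable
  show "C0_inf_approximable (h k)" for k
    by (rule C0_inf_dense_bounded[OF m, of k "real k"]) (auto simp: h_def)
  show "(\<lambda>k. L2_sq (\<lambda>x. h k x - f x)) \<longlonglongrightarrow> 0"
  proof (rule L2_sq_dominated_convergence[OF L2D(1)[OF f] m f])
    show "norm (h k x - f x) \<le> norm (f x)" for k x unfolding h_def real_norm_def by linarith
    show "AE x in M01. (\<lambda>k. h k x) \<longlonglongrightarrow> f x"
    proof (rule AE_I2)
      fix x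
      obtain k0 :: nat where k0: "\<bar>f x\<bar> \<le> real k0" using real_arch_simple by blast
      have "\<forall>\<^sub>F k in sequentially. h k x = f x"
        unfolding eventually_sequentially
      proof (intro exI[of _ k0] allI impI)
        fix k assume "k0 \<le> k"
        then have "\<bar>f x\<bar> \<le> real k" using k0 by linarith
        then show "h k x = f x" unfolding h_def by linarith
      qed
      then show "(\<lambda>k. h k x) \<longlonglongrightarrow> f x" by (rule tendsto_eventually)
    qed
  qed
qed

lemma L2_vec_norm_nonneg: "n \<ge> 1 \<Longrightarrow> 0 \<le> L2_vec_norm n v"
  unfolding L2_vec_norm_def
  by (rule Max_ge_iff[THEN iffD2]) (auto simp: L2_norm_eq_sqrt L2_sq_nonneg intro!: bexI[of _ 1])

lemma L2_vec_norm_le: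
  assumes "n \<ge> 1" "\<And>j. j \<in> {1..n} \<Longrightarrow> L2_norm (v j) \<le> c"
  shows "L2_vec_norm n v \<le> c"
  unfolding L2_vec_norm_def by (rule Max.boundedI) (use assms in auto)

lemma L2_norm_le_L2_vec_norm: "j \<in> {1..n} \<Longrightarrow> L2_norm (v j) \<le> L2_vec_norm n v"
  unfolding L2_vec_norm_def by (rule Max_ge) auto

lemma L2_vec_norm_minus_commute:
  "L2_vec_norm n (\<lambda>j x. u j x - v j x) = L2_vec_norm n (\<lambda>j x. v j x - u j x)"
  by (simp add: L2_vec_norm_def L2_norm_def norm_minus_commute)

lemma L2_vec_norm_cong:
  assumes "\<And>j x. j \<in> {1..n} \<Longrightarrow> x \<in> {0<..<1} \<Longrightarrow> u j x = v j x"
  shows "L2_vec_norm n u = L2_vec_norm n v"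
proof -
  have "L2_norm (u j) = L2_norm (v j)" if "j \<in> {1..n}" for j
    unfolding L2_norm_def using assms[OF that]
    by (intro arg_cong[of _ _ sqrt] Bochner_Integration.integral_cong) auto
  then show ?thesis unfolding L2_vec_norm_def by (intro arg_cong[of _ _ Max] image_cong) auto
qed

lemma L2_vec_norm_le_0_iff:
  assumes "v \<in> L2_vec n" "L2_vec_norm n v \<le> 0"
  shows "ae_eq n v (\<lambda>j x. 0)"
  unfolding ae_eq_def
proof
  fix j assume j: "j \<in> {1..n}"
  have "v j \<in> L2" using assms(1) j by (simp add: L2_vec_def)
  moreover have "L2_sq (v j) = 0"
    using order_trans[OF L2_norm_le_L2_vec_norm[OF j] assms(2)] L2_sq_nonneg[of "v j"]
      by (simp add: L2_norm_eq_sqrt)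
  ultimately show "AE x in M01. v j x = 0" using L2_sq_eq_0_iff by blast
qed

lemma C0_inf_dense_vec:
  assumes "\<phi> \<in> L2_vec n" and "n \<ge> 1"
  obtains \<phi>l where "\<forall>l. \<forall>j\<in>{1..n}. \<phi>l l j \<in> C0_inf"
    "(\<lambda>l. L2_vec_norm n (\<lambda>j x. \<phi>l l j x - \<phi> j x)) \<longlonglongrightarrow> 0"
proof -
  have "\<exists>\<psi>. j \<in> {1..n} \<longrightarrow> \<psi> \<in> C0_inf \<and> L2_sq (\<lambda>x. \<psi> x - \<phi> j x) < (1 / real (Suc l))\<^sup>2" for l j
  proof (cases "j \<in> {1..n}")
    case True
    then have "C0_inf_approximable (\<phi> j)" using assms(1) C0_inf_dense_L2 by (auto simp: L2_vec_def)
    moreover have "(1 / real (Suc l))\<^sup>2 > 0" by simp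
    ultimately show ?thesis unfolding C0_inf_approximable_def by blast
  qed blast
  then have "\<forall>l j. \<exists>\<psi>. j \<in> {1..n} \<longrightarrow> \<psi> \<in> C0_inf \<and> L2_sq (\<lambda>x. \<psi> x - \<phi> j x) < (1 / real (Suc l))\<^sup>2"
    by (intro allI)
  from this[unfolded choice_iff]
  obtain \<phi>l where p: "\<And>l j. j \<in> {1..n} \<longrightarrow> \<phi>l l j \<in> C0_inf \<and>
      L2_sq (\<lambda>x. \<phi>l l j x - \<phi> j x) < (1 / real (Suc l))\<^sup>2" by blast
  have le: "L2_vec_norm n (\<lambda>j x. \<phi>l l j x - \<phi> j x) \<le> 1 / real (Suc l)" for l
  proof (rule L2_vec_norm_le[OF assms(2)])
    fix j assume "j \<in> {1..n}"
    then have "L2_sq (\<lambda>x. \<phi>l l j x - \<phi> j x) \<le> (1 / real (Suc l))\<^sup>2" using p[of j l] by simp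
    then show "L2_norm (\<lambda>x. \<phi>l l j x - \<phi> j x) \<le> 1 / real (Suc l)"
      unfolding L2_norm_eq_sqrt by (intro real_le_lsqrt) auto
  qed
  have "(\<lambda>l. L2_vec_norm n (\<lambda>j x. \<phi>l l j x - \<phi> j x)) \<longlonglongrightarrow> 0"
  proof (rule tendsto_sandwich[OF _ _ tendsto_const LIMSEQ_inverse_real_of_nat])
    show "\<forall>\<^sub>F l in sequentially. L2_vec_norm n (\<lambda>j x. \<phi>l l j x - \<phi> j x) \<le> inverse (real (Suc l))"
      using le by (simp add: inverse_eq_divide)
  qed (simp add: L2_vec_norm_nonneg[OF assms(2)])
  with p show ?thesis by (intro that[of \<phi>l]) auto
qed


section \<open>Weak derivatives\<close>

lemma M01_absolutely_integrable:
  fixes f :: "real \<Rightarrow> 'a::euclidean_space"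
  assumes "integrable M01 f"
  shows "f absolutely_integrable_on {0..1}"
proof -
  have "f absolutely_integrable_on {0<..<1}"
    using assms unfolding set_integrable_def by (simp add: integrable_restrict_space)
  then show ?thesis
    by (simp add: absolutely_integrable_on_def integrable_on_open_interval_real)
qed

lemma M01_integral_eq:
  fixes f :: "real \<Rightarrow> 'a::euclidean_space"
  assumes "integrable M01 f"
  shows "(LINT x|M01. f x) = integral {0..1} f"
  using lebesgue_integral_eq_integral[OF assms] by (simp add: integral_open_interval_real)

lemma primitive_continuous:
  fixes w :: "real \<Rightarrow> 'a::euclidean_space"
  assumes "w absolutely_integrable_on {0..1}"
  shows "continuous_on {0..1} (\<lambda>x. integral {0..x} w)"
  by (rule indefinite_integral_continuous_1)
    (use assms in \<open>simp add: absolutely_integrable_on_def\<close>)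

lemma absolutely_integrable_mult_continuous:
  fixes w :: "real \<Rightarrow> complex"
  assumes w: "w absolutely_integrable_on {a..b}" and h: "continuous_on {a..b} h"
  shows "(\<lambda>s. w s * h s) absolutely_integrable_on {a..b}"
proof -
  have bil: "bilinear ((*) :: complex \<Rightarrow> complex \<Rightarrow> complex)"
    by (simp add: bilinear_conv_bounded_bilinear bounded_bilinear_mult)
  have "(\<lambda>s. h s * w s) absolutely_integrable_on {a..b}"
  proof (rule absolutely_integrable_bounded_measurable_product[OF bil])
    show "h \<in> borel_measurable (lebesgue_on {a..b})"
      by (rule continuous_imp_measurable_on_sets_lebesgue[OF h]) simp
    show "bounded (h ` {a..b})" by (intro compact_imp_bounded compact_continuous_image h) simp
  qed (use w in auto)
  then show ?thesis by (simp add: mult.commute)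
qed

text \<open>
  Integration by parts for a primitive \<open>F\<close> of an integrable \<open>w\<close> and a \<open>C\<^sup>1\<close> function \<open>h\<close>. Let \<open>\<Phi>\<close> be
  the difference of the two sides and \<open>V\<close> the primitive of \<open>|w|\<close>. Between two points both \<open>h\<close>
  and \<open>F\<close> vary little, which gives \<open>|\<Phi> t - \<Phi> s| \<le> 2 K |t - s| |V t - V s|\<close> for a bound \<open>K\<close> of
  \<open>h'\<close>. As \<open>V\<close> is continuous, \<open>\<Phi>\<close> has derivative zero at every point, so it is constant.
\<close>

lemma primitive_product_rule:
  fixes w h h' :: "real \<Rightarrow> complex"
  assumes w: "w absolutely_integrable_on {0..1}"
    and F: "\<And>x. x \<in> {0..1} \<Longrightarrow> F x = F 0 + integral {0..x} w"
    and h: "\<And>x. x \<in> {0..1} \<Longrightarrow> (h has_vector_derivative h' x) (at x within {0..1})"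
    and h': "continuous_on {0..1} h'"
    and x: "x \<in> {0..1}"
  shows "F x * h x = F 0 * h 0 + integral {0..x} (\<lambda>s. w s * h s + F s * h' s)"
proof -
  have ch: "continuous_on {0..1} h"
    by (rule continuous_on_vector_derivative) (rule h)
  have "continuous_on {0..1} (\<lambda>x. F 0 + integral {0..x} w)"
    by (intro continuous_intros primitive_continuous w)
  then have cF: "continuous_on {0..1} F"
    by (rule continuous_on_eq) (rule F[symmetric])
  define V where "V x = integral {0..x} (\<lambda>s. norm (w s))" for x
  have nw: "(\<lambda>s. norm (w s)) absolutely_integrable_on {0..1}"
    using set_integrable_norm[OF w] by simp
  have cV: "continuous_on {0..1} V" unfolding V_def by (rule primitive_continuous[OF nw])
  have "compact (h' ` {0..1})" using h' by (intro compact_continuous_image) auto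
  from compact_imp_bounded[OF this] obtain K where K: "\<And>s. s \<in> {0..1} \<Longrightarrow> norm (h' s) \<le> K"
    unfolding bounded_iff by blast
  have K0: "K \<ge> 0" using order_trans[OF norm_ge_zero K[of 0]] by simp
  have wi: "w integrable_on {s..t}" "(\<lambda>s. norm (w s)) integrable_on {s..t}" if "0 \<le> s" "t \<le> 1"
    for s t
    using integrable_on_subinterval[of w "{0..1}" s t] integrable_on_subinterval[of "\<lambda>s. norm (w s)" "{0..1}" s t]
      w that by (auto simp: absolutely_integrable_on_def)
  have Fdiff: "F t - F s = integral {s..t} w" if "0 \<le> s" "s \<le> t" "t \<le> 1" for s t
    using Henstock_Kurzweil_Integration.integral_combine[of 0 s t w] wi[of 0 t] that F[of s] F[of t]
      by (simp add: algebra_simps)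
  have Vdiff: "V t - V s = integral {s..t} (\<lambda>s. norm (w s))" if "0 \<le> s" "s \<le> t" "t \<le> 1" for s t
    using Henstock_Kurzweil_Integration.integral_combine[of 0 s t "\<lambda>s. norm (w s)"] wi[of 0 t] that
      by (simp add: V_def algebra_simps)
  have Vmono: "V s \<le> V t" if "0 \<le> s" "s \<le> t" "t \<le> 1" for s t
    using Vdiff[OF that] wi(2)[of s t] that integral_nonneg[of "\<lambda>s. norm (w s)" "{s..t}"] by simp
  have Fle: "norm (F t - F s) \<le> V t - V s" if "0 \<le> s" "s \<le> t" "t \<le> 1" for s t
    unfolding Fdiff[OF that] Vdiff[OF that]
    by (rule integral_norm_bound_integral) (use wi[of s t] that in auto)
  have hint: "h t - h s = integral {s..t} h'" if st: "0 \<le> s" "s \<le> t" "t \<le> 1" for s t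
  proof -
    have "(h' has_integral h t - h s) {s..t}"
    proof (rule fundamental_theorem_of_calculus[OF st(2)])
      fix u assume "u \<in> {s..t}"
      then have "u \<in> {0..1}" using st by simp
      from has_vector_derivative_within_subset[OF h[OF this]]
      show "(h has_vector_derivative h' u) (at u within {s..t})" using st by simp
    qed
    then show ?thesis by (simp add: integral_unique)
  qed
  have hle: "norm (h t - h s) \<le> K * (t - s)" if st: "0 \<le> s" "s \<le> t" "t \<le> 1" for s t
    unfolding hint[OF st]
  proof (rule integral_bound[OF st(2)])
    show "continuous_on {s..t} h'" by (rule continuous_on_subset[OF h']) (use st in auto)
    show "norm (h' u) \<le> K" if "u \<in> {s..t}" for u using K[of u] that st by simp
  qed
  define q where "q s = w s * h s + F s * h' s" for s
  have Fh: "(\<lambda>s. F s * h' s) absolutely_integrable_on {0..1}"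
    by (intro absolutely_integrable_continuous_real continuous_intros cF h')
  have qa: "q absolutely_integrable_on {0..1}"
    unfolding q_def
      by (rule set_integral_add(1)[OF absolutely_integrable_mult_continuous[OF w ch] Fh])
  have qi: "q integrable_on {s..t}" if "0 \<le> s" "t \<le> 1" for s t
    using integrable_on_subinterval[of q "{0..1}" s t] qa that
      by (auto simp: absolutely_integrable_on_def)
  define \<Phi> where "\<Phi> x = F x * h x - integral {0..x} q" for x
  have est: "norm (\<Phi> t - \<Phi> s) \<le> 2 * K * (t - s) * (V t - V s)" if st: "0 \<le> s" "s \<le> t" "t \<le> 1"
    for s t
  proof -
    have hi: "(\<lambda>r. F s * h' r) integrable_on {s..t}"
      by (intro integrable_continuous_real continuous_intros continuous_on_subset[OF h']) (use st in auto)
    have "\<Phi> t - \<Phi> s = F t * h t - F s * h s - integral {s..t} q"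
      using Henstock_Kurzweil_Integration.integral_combine[of 0 s t q] qi[of 0 t] st
        by (simp add: \<Phi>_def algebra_simps)
    also have "F t * h t - F s * h s = (F t - F s) * h t + F s * (h t - h s)"
      by (simp add: algebra_simps)
    also have "\<dots> = integral {s..t} (\<lambda>r. w r * h t + F s * h' r)"
      unfolding Fdiff[OF st] hint[OF st]
      by (subst Henstock_Kurzweil_Integration.integral_add) (use wi[of s t] st hi in \<open>auto intro: integrable_on_mult_left\<close>)
    also have "\<dots> - integral {s..t} q = integral {s..t} (\<lambda>r. w r * h t + F s * h' r - q r)"
      by (rule Henstock_Kurzweil_Integration.integral_diff[symmetric])
        (use wi[of s t] st hi qi in \<open>auto intro!: Henstock_Kurzweil_Integration.integrable_add integrable_on_mult_left\<close>)
    finally have eq: "\<Phi> t - \<Phi> s = integral {s..t} (\<lambda>r. w r * h t + F s * h' r - q r)" .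
    have "norm (\<Phi> t - \<Phi> s) \<le> integral {s..t} (\<lambda>r. norm (w r) * (K * (t - s)) + (V t - V s) * K)"
      unfolding eq
    proof (rule integral_norm_bound_integral)
      show "(\<lambda>r. w r * h t + F s * h' r - q r) integrable_on {s..t}"
        using wi[of s t] st hi qi
        by (auto intro!: Henstock_Kurzweil_Integration.integrable_diff Henstock_Kurzweil_Integration.integrable_add integrable_on_mult_left)
      show "(\<lambda>r. norm (w r) * (K * (t - s)) + (V t - V s) * K) integrable_on {s..t}"
        using wi[of s t] st
          by (intro Henstock_Kurzweil_Integration.integrable_add integrable_on_mult_left) auto
      fix r assume r: "r \<in> {s..t}"
      have "norm (w r * h t + F s * h' r - q r) = norm (w r * (h t - h r) - (F r - F s) * h' r)"
        by (simp add: q_def algebra_simps)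
      also have "\<dots> \<le> norm (w r) * norm (h t - h r) + norm (F r - F s) * norm (h' r)"
        using norm_triangle_ineq4[of "w r * (h t - h r)" "(F r - F s) * h' r"]
          by (simp add: norm_mult)
      also have "\<dots> \<le> norm (w r) * (K * (t - s)) + (V t - V s) * K"
      proof (intro add_mono mult_left_mono mult_mono)
        have "norm (h t - h r) \<le> K * (t - r)" using hle[of r t] r st by simp
        also have "\<dots> \<le> K * (t - s)" using r K0 by (intro mult_left_mono) auto
        finally show "norm (h t - h r) \<le> K * (t - s)" .
        have "norm (F r - F s) \<le> V r - V s" using Fle[of s r] r st by simp
        also have "\<dots> \<le> V t - V s" using Vmono[of r t] r st by simp
        finally show "norm (F r - F s) \<le> V t - V s" .
        show "0 \<le> V t - V s" using Vmono[OF st] by simp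
        show "norm (h' r) \<le> K" using K[of r] r st by simp
      qed auto
      finally show "norm (w r * h t + F s * h' r - q r) \<le> norm (w r) * (K * (t - s)) + (V t - V s) * K" .
    qed
    also have "\<dots> = integral {s..t} (\<lambda>r. norm (w r)) * (K * (t - s)) + (V t - V s) * K * (t - s)"
      using wi[of s t] st
      by (subst Henstock_Kurzweil_Integration.integral_add) (auto intro: integrable_on_mult_left)
    also have "\<dots> = 2 * K * (t - s) * (V t - V s)"
      unfolding Vdiff[OF st, symmetric] by (simp add: algebra_simps)
    finally show ?thesis .
  qed
  have est2: "norm (\<Phi> t - \<Phi> s) \<le> 2 * K * \<bar>t - s\<bar> * \<bar>V t - V s\<bar>" if "s \<in> {0..1}" "t \<in> {0..1}" for s t
  proof (cases "s \<le> t")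
    case True
    then show ?thesis using est[of s t] Vmono[of s t] that by simp
  next
    case False
    then show ?thesis using est[of t s] Vmono[of t s] that
      by (simp add: norm_minus_commute abs_minus_commute)
  qed
  have "\<exists>c. \<forall>x\<in>{0..1}. \<Phi> x = c"
  proof (rule has_derivative_zero_constant)
    fix s :: real assume s: "s \<in> {0..1}"
    have "((\<lambda>t. norm (\<Phi> t - \<Phi> s - 0) / norm (t - s)) \<longlongrightarrow> 0) (at s within {0..1})"
    proof (rule tendsto_sandwich[where f = "\<lambda>_. 0" and h = "\<lambda>t. 2 * K * \<bar>V t - V s\<bar>"])
      have "((\<lambda>t. V t) \<longlongrightarrow> V s) (at s within {0..1})" using cV s by (simp add: continuous_on)
      then have "((\<lambda>t. 2 * K * \<bar>V t - V s\<bar>) \<longlongrightarrow> 2 * K * \<bar>V s - V s\<bar>) (at s within {0..1})"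
        by (intro tendsto_mult tendsto_const tendsto_rabs tendsto_diff)
      then show "((\<lambda>t. 2 * K * \<bar>V t - V s\<bar>) \<longlongrightarrow> 0) (at s within {0..1})" by simp
      show "\<forall>\<^sub>F t in at s within {0..1}. norm (\<Phi> t - \<Phi> s - 0) / norm (t - s) \<le> 2 * K * \<bar>V t - V s\<bar>"
        unfolding eventually_at_filter
      proof (rule always_eventually, intro allI impI)
        fix t assume t: "t \<noteq> s" "t \<in> {0..1}"
        then have "\<bar>t - s\<bar> > 0" by simp
        then show "norm (\<Phi> t - \<Phi> s - 0) / norm (t - s) \<le> 2 * K * \<bar>V t - V s\<bar>"
          using est2[OF s t(2)] by (simp add: pos_divide_le_eq mult_ac)
      qed
    qed simp_all
    then show "(\<Phi> has_derivative (\<lambda>h. 0)) (at s within {0..1})"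
      by (simp add: has_derivative_iff_norm bounded_linear_zero)
  qed simp
  then have "\<Phi> x = \<Phi> 0" using x by (metis atLeastAtMost_iff order_refl zero_le_one)
  then have "F x * h x = F 0 * h 0 + integral {0..x} q" by (simp add: \<Phi>_def algebra_simps)
  moreover have "q = (\<lambda>s. w s * h s + F s * h' s)" by (rule ext) (simp add: q_def)
  ultimately show ?thesis by simp
qed

lemma L2_absolutely_integrable: "(w :: real \<Rightarrow> complex) \<in> L2 \<Longrightarrow> w absolutely_integrable_on {0..1}"
  by (intro M01_absolutely_integrable L2_integrable)

lemma L2_scaleR_integrable:
  fixes g :: "real \<Rightarrow> complex"
  assumes "g \<in> L2" "continuous_on {0..1} \<eta>"
  shows "integrable M01 (\<lambda>x. \<eta> x *\<^sub>R g x)"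
proof -
  have "integrable M01 (\<lambda>x. complex_of_real (\<eta> x) * g x)"
    by (rule L2_mult_integrable[OF L2_continuous assms(1)]) (intro continuous_on_of_real assms(2))
  then show ?thesis by (simp add: scaleR_conv_of_real)
qed

lemma has_weak_deriv_cong_AE:
  assumes "has_weak_deriv c w" and eq: "AE x in M01. v x = c x"
    and m: "v \<in> borel_measurable M01" "c \<in> borel_measurable M01"
  shows "has_weak_deriv v w"
proof -
  have "(LINT x|M01. deriv \<psi> x *\<^sub>R v x) = (LINT x|M01. deriv \<psi> x *\<^sub>R c x)" if psi: "\<psi> \<in> C0_inf"
    for \<psi>
  proof (rule integral_cong_AE)
    obtain \<psi>' where p: "\<forall>x\<in>{0..1}. (\<psi> has_real_derivative \<psi>' x) (at x within {0..1})"
      and c: "continuous_on {0..1} \<psi>'" by (rule C0_inf_D[OF psi])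
    have "deriv \<psi> x = \<psi>' x" if "x \<in> {0<..<1}" for x
      by (rule C0_inf_deriv[OF p that])
    then have "deriv \<psi> \<in> borel_measurable M01 \<longleftrightarrow> \<psi>' \<in> borel_measurable M01"
      by (intro measurable_cong) simp
    then have d: "deriv \<psi> \<in> borel_measurable M01" using measurable_M01_continuous[OF c] by blast
    show "(\<lambda>x. deriv \<psi> x *\<^sub>R v x) \<in> borel_measurable M01" "(\<lambda>x. deriv \<psi> x *\<^sub>R c x) \<in> borel_measurable M01"
      by (intro borel_measurable_scaleR d m)+
    show "AE x in M01. deriv \<psi> x *\<^sub>R v x = deriv \<psi> x *\<^sub>R c x" using eq by eventually_elim simp
  qed
  then show ?thesis using assms(1) unfolding has_weak_deriv_def by simp
qed

lemma has_weak_deriv_primitive: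
  assumes w: "w \<in> L2" and c: "\<And>x. x \<in> {0..1} \<Longrightarrow> c x = c 0 + integral {0..x} w"
  shows "has_weak_deriv c w"
  unfolding has_weak_deriv_def
proof
  fix \<psi> assume psi: "\<psi> \<in> C0_inf"
  obtain \<psi>' d where p: "\<forall>x\<in>{0..1}. (\<psi> has_real_derivative \<psi>' x) (at x within {0..1})"
    and cp: "continuous_on {0..1} \<psi>'" and d: "0 < d" "\<forall>x\<in>{0..1}. x < d \<or> 1 - d < x \<longrightarrow> \<psi> x = 0"
    by (rule C0_inf_D[OF psi])
  have wa: "w absolutely_integrable_on {0..1}" by (rule L2_absolutely_integrable[OF w])
  have "continuous_on {0..1} (\<lambda>x. c 0 + integral {0..x} w)"
    by (intro continuous_intros primitive_continuous wa)
  then have cc: "continuous_on {0..1} c"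
    by (rule continuous_on_eq) (rule c[symmetric])
  have cpsi: "continuous_on {0..1} \<psi>" by (rule C0_inf_continuous[OF psi])
  have "c 1 * of_real (\<psi> 1) = c 0 * of_real (\<psi> 0) +
      integral {0..1} (\<lambda>s. w s * of_real (\<psi> s) + c s * of_real (\<psi>' s))"
  proof (rule primitive_product_rule[OF wa c])
    show "((\<lambda>x. complex_of_real (\<psi> x)) has_vector_derivative complex_of_real (\<psi>' x)) (at x within {0..1})"
      if "x \<in> {0..1}" for x
      using bspec[OF p that] by (intro has_vector_derivative_of_real)
        (simp add: has_real_derivative_iff_has_vector_derivative)
    show "continuous_on {0..1} (\<lambda>x. complex_of_real (\<psi>' x))" by (intro continuous_intros cp)
  qed auto
  moreover have "\<psi> 0 = 0" "\<psi> 1 = 0" using d by auto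
  ultimately have 0: "integral {0..1} (\<lambda>s. w s * of_real (\<psi> s) + c s * of_real (\<psi>' s)) = 0" by simp
  have i1: "integrable M01 (\<lambda>x. of_real (\<psi> x) * w x)"
    by (rule L2_mult_integrable[OF L2_continuous w]) (intro continuous_intros cpsi)
  have i2: "integrable M01 (\<lambda>x. of_real (\<psi>' x) * c x)"
    by (rule L2_mult_integrable[OF L2_continuous L2_continuous[OF cc]]) (intro continuous_intros cp)
  have "(LINT x|M01. of_real (\<psi>' x) * c x) + (LINT x|M01. of_real (\<psi> x) * w x) =
      (LINT x|M01. of_real (\<psi>' x) * c x + of_real (\<psi> x) * w x)"
    using i1 i2 by simp
  also have "\<dots> = integral {0..1} (\<lambda>x. of_real (\<psi>' x) * c x + of_real (\<psi> x) * w x)"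
    by (rule M01_integral_eq) (use i1 i2 in simp)
  also have "\<dots> = 0" using 0 by (simp add: mult.commute add.commute)
  finally have "(LINT x|M01. of_real (\<psi>' x) * c x) = - (LINT x|M01. \<psi> x *\<^sub>R w x)"
    by (simp add: scaleR_conv_of_real eq_neg_iff_add_eq_0)
  moreover have "(LINT x|M01. deriv \<psi> x *\<^sub>R c x) = (LINT x|M01. of_real (\<psi>' x) * c x)"
    by (rule Bochner_Integration.integral_cong) (use C0_inf_deriv[OF p] in \<open>simp_all add: scaleR_conv_of_real\<close>)
  ultimately show "(LINT x|M01. deriv \<psi> x *\<^sub>R c x) = - (LINT x|M01. \<psi> x *\<^sub>R w x)" by simp
qed

text \<open>
  If \<open>\<psi>\<close> is orthogonal to \<open>g\<close>, then \<open>\<parallel>\<psi> - g\<parallel>\<^sup>2 = \<parallel>\<psi>\<parallel>\<^sup>2 + \<parallel>g\<parallel>\<^sup>2 \<ge> \<parallel>g\<parallel>\<^sup>2\<close>. But \<open>\<psi>\<close> can be chosen close to \<open>g\<close>.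
\<close>

lemma L2_real_orthogonal_C0_inf:
  fixes g :: "real \<Rightarrow> real"
  assumes g: "g \<in> L2" and orth: "\<And>\<psi>. \<psi> \<in> C0_inf \<Longrightarrow> (LINT x|M01. \<psi> x * g x) = 0"
  shows "AE x in M01. g x = 0"
proof -
  have "L2_sq g \<le> e" if "e > 0" for e
  proof -
    obtain \<psi> where psi: "\<psi> \<in> C0_inf" "\<psi> \<in> L2" "L2_sq (\<lambda>x. \<psi> x - g x) < e"
      using C0_inf_dense_L2[OF g] \<open>e > 0\<close> unfolding C0_inf_approximable_def by blast
    have i: "integrable M01 (\<lambda>x. \<psi> x * g x)" "integrable M01 (\<lambda>x. (\<psi> x)\<^sup>2)" "integrable M01 (\<lambda>x. (g x)\<^sup>2)"
      using L2_mult_integrable[OF psi(2) g] L2D(2)[OF psi(2)] L2D(2)[OF g] by simp_all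
    have "L2_sq (\<lambda>x. \<psi> x - g x) = (LINT x|M01. (\<psi> x)\<^sup>2 - 2 * (\<psi> x * g x) + (g x)\<^sup>2)"
      unfolding L2_sq_def by (simp add: power2_eq_square algebra_simps)
    also have "\<dots> = L2_sq \<psi> - 2 * (LINT x|M01. \<psi> x * g x) + L2_sq g"
      unfolding L2_sq_def using i by simp
    finally have "L2_sq (\<lambda>x. \<psi> x - g x) = L2_sq \<psi> - 2 * (LINT x|M01. \<psi> x * g x) + L2_sq g" .
    with orth[OF psi(1)] have "L2_sq (\<lambda>x. \<psi> x - g x) = L2_sq \<psi> + L2_sq g" by simp
    with psi(3) L2_sq_nonneg[of \<psi>] show ?thesis by linarith
  qed
  then have "L2_sq g \<le> 0" by (rule field_le_epsilon) simp
  then have "L2_sq g = 0" using L2_sq_nonneg[of g] by (rule antisym)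
  then show ?thesis using L2_sq_eq_0_iff[OF g] by simp
qed

lemma L2_orthogonal_C0_inf:
  fixes g :: "real \<Rightarrow> complex"
  assumes g: "g \<in> L2" and orth: "\<And>\<psi>. \<psi> \<in> C0_inf \<Longrightarrow> (LINT x|M01. \<psi> x *\<^sub>R g x) = 0"
  shows "AE x in M01. g x = 0"
proof -
  have m: "g \<in> borel_measurable M01" by (rule L2D(1)[OF g])
  have i: "integrable M01 (\<lambda>x. \<psi> x *\<^sub>R g x)" if "\<psi> \<in> C0_inf" for \<psi>
    by (rule L2_scaleR_integrable[OF g C0_inf_continuous[OF that]])
  have "AE x in M01. Re (g x) = 0"
  proof (rule L2_real_orthogonal_C0_inf)
    show "(\<lambda>x. Re (g x)) \<in> L2"
      by (rule L2_dominated[OF g, of _ 1]) (use m abs_Re_le_cmod in auto)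
    show "(LINT x|M01. \<psi> x * Re (g x)) = 0" if "\<psi> \<in> C0_inf" for \<psi>
      using arg_cong[OF orth[OF that], of Re] integral_Re[OF i[OF that]] by simp
  qed
  moreover have "AE x in M01. Im (g x) = 0"
  proof (rule L2_real_orthogonal_C0_inf)
    show "(\<lambda>x. Im (g x)) \<in> L2"
      by (rule L2_dominated[OF g, of _ 1]) (use m abs_Im_le_cmod in auto)
    show "(LINT x|M01. \<psi> x * Im (g x)) = 0" if "\<psi> \<in> C0_inf" for \<psi>
      using arg_cong[OF orth[OF that], of Im] integral_Im[OF i[OF that]] by simp
  qed
  ultimately show ?thesis by eventually_elim (simp add: complex_eq_iff)
qed

lemma weak_deriv_unique:
  assumes "has_weak_deriv v w1" "has_weak_deriv v w2" and w: "w1 \<in> L2" "w2 \<in> L2"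
  shows "AE x in M01. w1 x = w2 x"
proof -
  have "AE x in M01. w1 x - w2 x = 0"
  proof (rule L2_orthogonal_C0_inf[OF L2_diff[OF w]])
    fix \<psi> assume psi: "\<psi> \<in> C0_inf"
    have "(LINT x|M01. \<psi> x *\<^sub>R w1 x) = (LINT x|M01. \<psi> x *\<^sub>R w2 x)"
      using assms(1)[unfolded has_weak_deriv_def, rule_format, OF psi]
        assms(2)[unfolded has_weak_deriv_def, rule_format, OF psi] by simp
    then show "(LINT x|M01. \<psi> x *\<^sub>R (w1 x - w2 x)) = 0"
      using L2_scaleR_integrable[OF w(1) C0_inf_continuous[OF psi]]
        L2_scaleR_integrable[OF w(2) C0_inf_continuous[OF psi]] by (simp add: scaleR_diff_right)
  qed
  then show ?thesis by eventually_elim simp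
qed

text \<open>
  The choice in \<open>weak_deriv\<close> is harmless once some square integrable weak derivative exists.
\<close>

lemma weak_deriv_AE_eq:
  assumes "w \<in> L2" "has_weak_deriv v w"
  shows "weak_deriv v \<in> L2" "has_weak_deriv v (weak_deriv v)" "AE x in M01. weak_deriv v x = w x"
proof -
  have *: "weak_deriv v \<in> L2 \<and> has_weak_deriv v (weak_deriv v)"
    unfolding weak_deriv_def by (rule someI[of _ w]) (use assms in blast)
  then show "weak_deriv v \<in> L2" "has_weak_deriv v (weak_deriv v)" by blast+
  from weak_deriv_unique[OF this(2) assms(2) this(1) assms(1)]
  show "AE x in M01. weak_deriv v x = w x" .
qed

text \<open>
  The exceptional set is open in the interval, and a nonempty open set is not negligible.
\<close>

lemma continuous_AE_eq_const:
  fixes d :: "real \<Rightarrow> 'a::real_normed_vector"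
  assumes d: "continuous_on {0..1} d" and ae: "AE x in M01. d x = C" and x: "x \<in> {0..1}"
  shows "d x = C"
proof -
  define S where "S = {x \<in> {0<..<1}. d x \<noteq> C}"
  have "open S"
  proof -
    have "open ({0<..<1} \<inter> d -` (- {C}))"
      by (rule continuous_open_preimage[OF continuous_on_subset[OF d]]) auto
    then show ?thesis by (simp add: S_def vimage_def Int_def)
  qed
  have "AE x in lebesgue. x \<in> {0<..<1} \<longrightarrow> d x = C"
    using ae by (subst (asm) AE_restrict_space_iff) auto
  then have "AE x in lebesgue. x \<notin> S" by eventually_elim (auto simp: S_def)
  then have "S \<in> null_sets lebesgue"
    using \<open>open S\<close> by (subst AE_iff_null_sets) auto
  then have "negligible S" by (simp add: negligible_iff_null_sets)
  with \<open>open S\<close> have "S = {}" using open_not_negligible by blast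
  then have "\<And>y. y \<in> {0<..<1} \<Longrightarrow> d y = C" by (auto simp: S_def)
  from continuous_constant_on_closure[of "{0<..<1}" d, OF _ this] d x
  show ?thesis by simp
qed

text \<open>
  The lemma of du Bois-Reymond. The difference \<open>d\<close> of \<open>c\<close> and the primitive of \<open>w\<close> has weak
  derivative zero, so it is orthogonal to the derivatives of test functions. These are the test
  functions with mean value zero. Subtracting a multiple of a fixed test function from an
  arbitrary one makes its mean value zero, so \<open>d\<close> minus a suitable constant is orthogonal to all
  test functions.
\<close>

lemma weak_deriv_fundamental_theorem:
  assumes c: "continuous_on {0..1} c" and w: "w \<in> L2" and wd: "has_weak_deriv c w"
    and x: "x \<in> {0..1}"
  shows "c x = c 0 + integral {0..x} w"
proof -
  define W where "W x = integral {0..x} w" for x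
  define d where "d x = c x - W x" for x
  have cW: "continuous_on {0..1} W"
    unfolding W_def by (rule primitive_continuous[OF L2_absolutely_integrable[OF w]])
  have cd: "continuous_on {0..1} d" unfolding d_def by (intro continuous_intros c cW)
  have wdW: "has_weak_deriv W w" by (rule has_weak_deriv_primitive[OF w]) (simp add: W_def)
  note i0 = L2_scaleR_integrable[OF L2_continuous]
  have zero: "(LINT x|M01. \<eta> x *\<^sub>R d x) = 0" if eta: "\<eta> \<in> C0_inf" "integral {0..1} \<eta> = 0" for \<eta>
  proof -
    define \<psi> where "\<psi> x = integral {0..x} \<eta>" for x
    have psi: "\<psi> \<in> C0_inf" unfolding \<psi>_def using eta by (rule C0_inf_primitive)
    have ceta: "continuous_on {0..1} \<eta>" by (rule C0_inf_continuous[OF eta(1)])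
    have der: "\<forall>x\<in>{0..1}. (\<psi> has_real_derivative \<eta> x) (at x within {0..1})"
      unfolding \<psi>_def using integral_has_real_derivative[OF ceta] by blast
    have eq: "(LINT x|M01. deriv \<psi> x *\<^sub>R v x) = (LINT x|M01. \<eta> x *\<^sub>R v x)" for v :: "real \<Rightarrow> complex"
      by (rule Bochner_Integration.integral_cong) (use C0_inf_deriv[OF der] in simp_all)
    have "(LINT x|M01. \<eta> x *\<^sub>R c x) = (LINT x|M01. \<eta> x *\<^sub>R W x)"
      using wd wdW psi unfolding has_weak_deriv_def eq[symmetric] by simp
    then show ?thesis
      using i0[OF c ceta] i0[OF cW ceta] by (simp add: d_def scaleR_diff_right)
  qed
  \<comment> \<open>any fixed test function with nonzero integral will do\<close>
  define \<eta>0 where "\<eta>0 = (\<lambda>x. poly 1 x * cutoff 3 x)"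
  have e0: "\<eta>0 \<in> C0_inf" unfolding \<eta>0_def by (intro cutoff_mult_in_C0_inf smooth_poly)
  have ce0: "continuous_on {0..1} \<eta>0" by (rule C0_inf_continuous[OF e0])
  define I where "I = integral {0..1} \<eta>0"
  have "I \<noteq> 0"
  proof
    assume "I = 0"
    then have "\<forall>x\<in>{0..1}. \<eta>0 x = 0"
      unfolding I_def
        by (subst (asm) integral_eq_0_iff) (use ce0 cutoff_bounds in \<open>auto simp: \<eta>0_def\<close>)
    then have "\<eta>0 (1/2) = 0" by auto
    then show False by (simp add: \<eta>0_def cutoff_def flat_def)
  qed
  \<comment> \<open>the weighted mean of \<open>d\<close>, which is its value if \<open>d\<close> is constant\<close>
  define C where "C = (LINT x|M01. \<eta>0 x *\<^sub>R d x) / of_real I"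
  have "AE x in M01. d x - C = 0"
  proof (rule L2_orthogonal_C0_inf)
    show "(\<lambda>x. d x - C) \<in> L2" by (intro L2_continuous continuous_intros cd)
    fix \<eta> assume eta: "\<eta> \<in> C0_inf"
    have ceta: "continuous_on {0..1} \<eta>" by (rule C0_inf_continuous[OF eta])
    define J where "J = integral {0..1} \<eta>"
    define q where "q = J / I"
    have "(LINT x|M01. (\<eta> x - q * \<eta>0 x) *\<^sub>R d x) = 0"
    proof (rule zero)
      show "(\<lambda>x. \<eta> x - q * \<eta>0 x) \<in> C0_inf" by (rule C0_inf_diff[OF eta e0])
      have "integral {0..1} (\<lambda>x. \<eta> x - q * \<eta>0 x) = J - q * I"
        unfolding J_def I_def
        using integrable_continuous_real[OF ceta] integrable_continuous_real[OF ce0]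
        by (subst Henstock_Kurzweil_Integration.integral_diff) (simp_all add: integrable_on_mult_right)
      then show "integral {0..1} (\<lambda>x. \<eta> x - q * \<eta>0 x) = 0" using \<open>I \<noteq> 0\<close> by (simp add: q_def)
    qed
    then have "(LINT x|M01. \<eta> x *\<^sub>R d x) = q *\<^sub>R (LINT x|M01. \<eta>0 x *\<^sub>R d x)"
      using i0[OF cd ceta] i0[OF cd ce0] by (simp add: scaleR_diff_left flip: scaleR_scaleR)
    also have "\<dots> = J *\<^sub>R C" using \<open>I \<noteq> 0\<close> by (simp add: C_def q_def scaleR_conv_of_real)
    finally have 1: "(LINT x|M01. \<eta> x *\<^sub>R d x) = J *\<^sub>R C" .
    have "(LINT x|M01. \<eta> x *\<^sub>R C) = (LINT x|M01. \<eta> x) *\<^sub>R C"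
      using L2_integrable[OF L2_continuous[OF ceta]] by simp
    also have "(LINT x|M01. \<eta> x) = J"
      unfolding J_def by (rule M01_integral_eq[OF L2_integrable[OF L2_continuous[OF ceta]]])
    finally show "(LINT x|M01. \<eta> x *\<^sub>R (d x - C)) = 0"
      using i0[OF cd ceta] i0[OF continuous_on_const[of _ C] ceta] 1
        by (simp add: scaleR_diff_right)
  qed
  then have "AE x in M01. d x = C" by eventually_elim simp
  from continuous_AE_eq_const[OF cd this] have "d x = d 0" using x by simp
  then show ?thesis by (simp add: d_def W_def algebra_simps)
qed


section \<open>Exponential polynomials and delay matrices\<close>

text \<open>
  Finitely supported functions on an additive monoid form its monoid algebra; this is the linear
  extension of a map \<open>\<Phi>\<close> from the monoid to its algebra. It is used for the monoid of real numbers,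
  with two choices of \<open>\<Phi>\<close>: exponentials, and shifts of a function.
\<close>

definition gr_lin :: "('a \<Rightarrow> 'v::real_vector) \<Rightarrow> ('a \<Rightarrow>\<^sub>0 real) \<Rightarrow> 'v"
  where "gr_lin \<Phi> q = (\<Sum>r\<in>Poly_Mapping.keys q. Poly_Mapping.lookup q r *\<^sub>R \<Phi> r)"

lemma gr_lin_superset:
  assumes "finite A" "Poly_Mapping.keys q \<subseteq> A"
  shows "gr_lin \<Phi> q = (\<Sum>r\<in>A. Poly_Mapping.lookup q r *\<^sub>R \<Phi> r)"
  unfolding gr_lin_def
  by (rule sum.mono_neutral_left) (use assms in \<open>auto simp: in_keys_iff\<close>)

lemma gr_lin_add: "gr_lin \<Phi> (p + q) = gr_lin \<Phi> p + gr_lin \<Phi> q"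
proof -
  let ?A = "Poly_Mapping.keys p \<union> Poly_Mapping.keys q"
  have "gr_lin \<Phi> (p + q) = (\<Sum>r\<in>?A. Poly_Mapping.lookup (p + q) r *\<^sub>R \<Phi> r)"
    by (rule gr_lin_superset) (simp_all add: Poly_Mapping.keys_add)
  also have "\<dots> = gr_lin \<Phi> p + gr_lin \<Phi> q"
    by (simp add: gr_lin_superset[where A = ?A] lookup_add scaleR_left_distrib sum.distrib)
  finally show ?thesis .
qed

lemma gr_lin_zero [simp]: "gr_lin \<Phi> 0 = 0"
  by (simp add: gr_lin_def)

lemma gr_lin_sum: "gr_lin \<Phi> (\<Sum>a\<in>A. f a) = (\<Sum>a\<in>A. gr_lin \<Phi> (f a))"
  by (induction A rule: infinite_finite_induct) (simp_all add: gr_lin_add)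

lemma gr_lin_uminus: "gr_lin \<Phi> (- q) = - gr_lin \<Phi> q"
  using gr_lin_add[of \<Phi> q "- q"] by (simp add: minus_unique)

lemma gr_lin_single: "gr_lin \<Phi> (Poly_Mapping.single r c) = c *\<^sub>R \<Phi> r"
  by (subst gr_lin_superset[of "{r}"]) auto

lemma gr_lin_one: "gr_lin \<Phi> (1 :: 'a::zero \<Rightarrow>\<^sub>0 real) = \<Phi> 0"
  by (simp add: gr_lin_single flip: single_one)

lemma sum_of_singles: "q = (\<Sum>r\<in>Poly_Mapping.keys q. Poly_Mapping.single r (Poly_Mapping.lookup q r))"
proof (rule poly_mapping_eqI)
  fix k
  have *: "Poly_Mapping.lookup (\<Sum>r\<in>A. Poly_Mapping.single r (Poly_Mapping.lookup q r)) k =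
      (if k \<in> A then Poly_Mapping.lookup q k else 0)" if "finite A" for A
    using that by (induction A) (auto simp: lookup_add lookup_single when_def)
  show "Poly_Mapping.lookup q k =
      Poly_Mapping.lookup (\<Sum>r\<in>Poly_Mapping.keys q. Poly_Mapping.single r (Poly_Mapping.lookup q r)) k"
    by (simp add: * in_keys_iff)
qed

text \<open>
  Multiplicativity of both instances is this identity, combined with
  \<open>exp (x + y) = exp x * exp y\<close> in one case and with composition of shifts in the other.
\<close>

lemma gr_lin_mult:
  fixes p q :: "'a::comm_monoid_add \<Rightarrow>\<^sub>0 real"
  shows "gr_lin \<Phi> (p * q) = gr_lin (\<lambda>r. gr_lin (\<lambda>s. \<Phi> (r + s)) q) p"
proof -
  have "gr_lin \<Phi> (p * q) = gr_lin \<Phi> (\<Sum>r\<in>Poly_Mapping.keys p. \<Sum>s\<in>Poly_Mapping.keys q.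
      Poly_Mapping.single r (Poly_Mapping.lookup p r) * Poly_Mapping.single s (Poly_Mapping.lookup q s))"
    by (subst (1) sum_of_singles[of p], subst (1) sum_of_singles[of q]) (simp add: sum_product)
  also have "\<dots> = (\<Sum>r\<in>Poly_Mapping.keys p. \<Sum>s\<in>Poly_Mapping.keys q.
      (Poly_Mapping.lookup p r * Poly_Mapping.lookup q s) *\<^sub>R \<Phi> (r + s))"
    by (simp add: gr_lin_sum mult_single gr_lin_single)
  also have "\<dots> = gr_lin (\<lambda>r. gr_lin (\<lambda>s. \<Phi> (r + s)) q) p"
    by (simp add: gr_lin_def scaleR_right.sum)
  finally show ?thesis .
qed

definition exp_poly :: "complex \<Rightarrow> (real \<Rightarrow>\<^sub>0 real) \<Rightarrow> complex"
  where "exp_poly z q = gr_lin (\<lambda>r. exp (- (of_real r * z))) q"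

definition shift_sum :: "(real \<Rightarrow>\<^sub>0 real) \<Rightarrow> (real \<Rightarrow> real) \<Rightarrow> real \<Rightarrow> real"
  where "shift_sum q h t = gr_lin (\<lambda>r. h (t - r)) q"

lemma exp_poly_mult: "exp_poly z (p * q) = exp_poly z p * exp_poly z q"
proof -
  have "exp_poly z (p * q) = gr_lin (\<lambda>r. gr_lin (\<lambda>s. exp (- (of_real r * z)) * exp (- (of_real s * z))) q) p"
    by (simp add: exp_poly_def gr_lin_mult ring_distribs exp_diff exp_minus field_simps flip: exp_add)
  also have "\<dots> = exp_poly z p * exp_poly z q"
    by (simp add: exp_poly_def gr_lin_def sum_product scaleR_right.sum mult.commute)
  finally show ?thesis .
qed

lemma comm_ring_hom_exp_poly: "comm_ring_hom (exp_poly z)"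
  by unfold_locales (simp_all add: exp_poly_mult, simp_all add: exp_poly_def gr_lin_add gr_lin_one)

lemma shift_sum_mult: "shift_sum (p * q) h t = shift_sum p (shift_sum q h) t"
  by (simp add: shift_sum_def gr_lin_mult diff_diff_eq)

lemma exp_poly_bound:
  obtains C R where "C > 0" "R > 0" "\<And>z. cmod (exp_poly z q) \<le> C * exp (R * cmod z)"
proof -
  define R where "R = 1 + (\<Sum>r\<in>Poly_Mapping.keys q. \<bar>r\<bar>)"
  define C where "C = 1 + (\<Sum>r\<in>Poly_Mapping.keys q. \<bar>Poly_Mapping.lookup q r\<bar>)"
  have R: "\<bar>r\<bar> \<le> R" if "r \<in> Poly_Mapping.keys q" for r
    unfolding R_def using member_le_sum[OF that, of abs] by simp
  have "cmod (exp_poly z q) \<le> C * exp (R * cmod z)" for z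
  proof -
    have "cmod (exp_poly z q) \<le> (\<Sum>r\<in>Poly_Mapping.keys q. \<bar>Poly_Mapping.lookup q r\<bar> * exp (R * cmod z))"
      unfolding exp_poly_def gr_lin_def
    proof (rule sum_norm_le)
      fix r assume r: "r \<in> Poly_Mapping.keys q"
      have "Re (- (of_real r * z)) \<le> \<bar>r\<bar> * cmod z"
        using abs_Re_le_cmod[of "- (of_real r * z)"] by (simp add: norm_mult)
      also have "\<dots> \<le> R * cmod z" using R[OF r] by (rule mult_right_mono) simp
      finally show "norm (Poly_Mapping.lookup q r *\<^sub>R exp (- (of_real r * z))) \<le>
          \<bar>Poly_Mapping.lookup q r\<bar> * exp (R * cmod z)"
        by (simp add: mult_left_mono)
    qed
    also have "\<dots> \<le> C * exp (R * cmod z)" by (simp add: C_def sum_distrib_right distrib_right)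
    finally show ?thesis .
  qed
  moreover have "C > 0" "R > 0" unfolding C_def R_def by (simp_all add: add_pos_nonneg sum_nonneg)
  ultimately show ?thesis using that by blast
qed

lemma holomorphic_exp_poly: "(\<lambda>z. exp_poly z q) holomorphic_on UNIV"
  unfolding exp_poly_def gr_lin_def scaleR_conv_of_real by (intro holomorphic_intros)

text \<open>
  Multiply by \<open>exp (r\<^sub>0 x)\<close> for the smallest frequency \<open>r\<^sub>0\<close> and let \<open>x\<close> tend to infinity: only the
  coefficient of \<open>r\<^sub>0\<close> survives.
\<close>

lemma exp_poly_zero_on_reals:
  assumes "\<And>x::real. exp_poly (of_real x) q = 0"
  shows "q = 0"
proof (rule ccontr)
  assume "q \<noteq> 0"
  define K where "K = Poly_Mapping.keys q"
  have K: "finite K" "K \<noteq> {}" using \<open>q \<noteq> 0\<close> by (auto simp: K_def)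
  define r0 where "r0 = Min K"
  have r0: "r0 \<in> K" "\<And>r. r \<in> K \<Longrightarrow> r0 \<le> r" using K by (auto simp: r0_def)
  have "((\<lambda>x::real. \<Sum>r\<in>K. Poly_Mapping.lookup q r * exp (- ((r - r0) * x))) \<longlongrightarrow>
      (\<Sum>r\<in>K. if r = r0 then Poly_Mapping.lookup q r else 0)) at_top"
  proof (rule tendsto_sum)
    fix r assume "r \<in> K"
    show "((\<lambda>x::real. Poly_Mapping.lookup q r * exp (- ((r - r0) * x))) \<longlongrightarrow>
        (if r = r0 then Poly_Mapping.lookup q r else 0)) at_top"
    proof (cases "r = r0")
      case False
      then have "r - r0 > 0" using r0(2)[OF \<open>r \<in> K\<close>] by simp
      then have "((\<lambda>x::real. exp (- ((r - r0) * x))) \<longlongrightarrow> 0) at_top" by real_asymp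
      from tendsto_mult_right_zero[OF this] False show ?thesis by simp
    qed simp
  qed
  moreover have "(\<Sum>r\<in>K. Poly_Mapping.lookup q r * exp (- ((r - r0) * x))) = 0" for x :: real
  proof -
    have "exp (of_real (- ((r - r0) * x))) = exp (of_real (r0 * x)) * exp (- (of_real r * of_real x :: complex))"
      for r
      by (simp add: algebra_simps flip: exp_add)
    then have "of_real (\<Sum>r\<in>K. Poly_Mapping.lookup q r * exp (- ((r - r0) * x))) =
        exp (of_real (r0 * x)) * exp_poly (of_real x) q"
      unfolding of_real_sum of_real_mult exp_of_real[symmetric]
      by (simp add: exp_poly_def gr_lin_def K_def sum_distrib_left scaleR_conv_of_real mult.left_commute)
    also have "\<dots> = 0" by (simp only: assms mult_zero_right)
    finally show ?thesis by (simp only: of_real_eq_0_iff)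
  qed
  ultimately have "((\<lambda>x::real. 0::real) \<longlongrightarrow> Poly_Mapping.lookup q r0) at_top"
    using r0(1) K(1) by (simp add: sum.delta')
  then have "Poly_Mapping.lookup q r0 = 0"
    by (simp add: tendsto_const_iff)
  with r0(1) show False by (simp add: K_def in_keys_iff)
qed

text \<open>
  The map \<open>w \<mapsto> w / (2 A - w)\<close> takes the half plane \<open>Re w < A\<close> into the unit disc and fixes the
  origin, so the Schwarz lemma applies to its composition with \<open>g\<close>, rescaled to the unit disc.
  At half the radius it gives \<open>2 |g| \<le> |2 A - g| \<le> 2 A + |g|\<close>.
\<close>

lemma Borel_Caratheodory_half:
  assumes g: "g holomorphic_on UNIV" and "g 0 = 0" and "A > 0" "\<rho> > 0"
    and Re: "\<And>z. cmod z < \<rho> \<Longrightarrow> Re (g z) < A" and z: "cmod z = \<rho> / 2"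
  shows "cmod (g z) \<le> 2 * A"
proof -
  define h where "h w = g (of_real \<rho> * w) / (2 * of_real A - g (of_real \<rho> * w))" for w
  have lt: "Re (g (of_real \<rho> * w)) < A" if "cmod w < 1" for w
    using Re[of "of_real \<rho> * w"] that \<open>\<rho> > 0\<close> by (simp add: norm_mult)
  have nz: "2 * of_real A - g (of_real \<rho> * w) \<noteq> 0" if "cmod w < 1" for w
  proof
    assume "2 * of_real A - g (of_real \<rho> * w) = 0"
    then have "Re (g (of_real \<rho> * w)) = 2 * A" by (simp add: complex_eq_iff)
    with lt[OF that] \<open>A > 0\<close> show False by simp
  qed
  have "(\<lambda>w. of_real \<rho> * w) holomorphic_on ball 0 1" by (intro holomorphic_intros)
  from holomorphic_on_compose_gen[OF this g]
  have gh: "(\<lambda>w. g (of_real \<rho> * w)) holomorphic_on ball 0 1" by (simp add: o_def)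
  have hol: "h holomorphic_on ball 0 1"
    unfolding h_def
    by (rule holomorphic_on_divide[OF gh holomorphic_on_diff[OF holomorphic_on_const gh]]) (use nz in simp)
  have less: "cmod (g (of_real \<rho> * w)) < cmod (2 * of_real A - g (of_real \<rho> * w))" if "cmod w < 1"
    for w
  proof -
    let ?u = "g (of_real \<rho> * w)"
    have "(cmod (2 * of_real A - ?u))\<^sup>2 - (cmod ?u)\<^sup>2 = 4 * A * (A - Re ?u)"
      unfolding cmod_power2 by (simp add: power2_eq_square algebra_simps)
    also have "\<dots> > 0" using lt[OF that] \<open>A > 0\<close> by simp
    finally have "(cmod ?u)\<^sup>2 < (cmod (2 * of_real A - ?u))\<^sup>2" by simp
    then show ?thesis by (rule power_less_imp_less_base) simp
  qed
  have bnd: "cmod (h w) < 1" if "cmod w < 1" for w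
    using less[OF that] nz[OF that] by (simp add: h_def norm_divide divide_less_eq_1)
  define w where "w = z / of_real \<rho>"
  have w: "cmod w = 1 / 2" "of_real \<rho> * w = z" using z \<open>\<rho> > 0\<close> by (simp_all add: w_def norm_divide)
  have "cmod (h w) \<le> cmod w"
  proof (rule Schwarz_Lemma(1)[OF hol _ bnd])
    show "h 0 = 0" using \<open>g 0 = 0\<close> by (simp add: h_def)
    show "cmod w < 1" using w by simp
  qed
  then have quot: "cmod (g z) / cmod (2 * of_real A - g z) \<le> 1 / 2"
    by (simp add: h_def w norm_divide)
  have pos: "cmod (2 * of_real A - g z) > 0" using nz[of w] w by simp
  have "2 * cmod (g z) \<le> cmod (2 * of_real A - g z)"
    using quot[unfolded pos_divide_le_eq[OF pos]] by linarith
  also have "\<dots> \<le> 2 * A + cmod (g z)" using norm_triangle_ineq4[of "2 * of_real A" "g z"] \<open>A > 0\<close>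
    by simp
  finally show ?thesis by simp
qed

text \<open>
  A logarithm \<open>g\<close> of \<open>f\<close> has real part of at most linear growth; by \<open>Borel_Caratheodory_half\<close> so
  has \<open>g\<close> itself, and by Liouville \<open>g\<close> is affine with some slope \<open>\<alpha>\<close>. Then \<open>f (x + w) / f x\<close> does
  not depend on \<open>x\<close>, and its limit is \<open>1\<close>, so \<open>exp (\<alpha> w) = 1\<close> for all \<open>w\<close>.
\<close>

lemma zero_free_exponential_type_const:
  assumes hol: "f holomorphic_on UNIV" and nz: "\<And>z. f z \<noteq> 0"
    and CR: "C > 0" "R > 0" "\<And>z. cmod (f z) \<le> C * exp (R * cmod z)"
    and lim: "\<And>w. ((\<lambda>x::real. f (of_real x + w)) \<longlongrightarrow> 1) at_top"
  shows "f z = 1"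
proof -
  obtain g where g: "g holomorphic_on UNIV" and f: "\<And>z. f z = exp (g z)"
    using holomorphic_logarithm_exists[OF convex_UNIV open_UNIV hol nz UNIV_I] by (metis UNIV_I)
  define h where "h z = g z - g 0" for z
  have h: "h holomorphic_on UNIV" "h 0 = 0" unfolding h_def by (auto intro!: holomorphic_intros g)
  have Re: "Re (g z) \<le> ln C + R * cmod z" for z
  proof -
    have "exp (Re (g z)) \<le> exp (ln C + R * cmod z)" using CR(3)[of z] CR(1) by (simp add: f exp_add)
    then show ?thesis by simp
  qed
  \<comment> \<open>the summand 1 makes the bound on \<open>Re h\<close> strict\<close>
  define K where "K = \<bar>ln C\<bar> + \<bar>Re (g 0)\<bar> + 1"
  have bound: "cmod (h z) \<le> (2 * K + 4 * R) * cmod z ^ 1" if "1 \<le> cmod z" for z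
  proof -
    have "cmod (h z) \<le> 2 * (K + R * (2 * cmod z))"
    proof (rule Borel_Caratheodory_half[OF h])
      show "0 < K + R * (2 * cmod z)" using \<open>R > 0\<close> by (simp add: K_def add_pos_nonneg)
      show "0 < 2 * cmod z" using that by linarith
      fix w assume "cmod w < 2 * cmod z"
      then have "R * cmod w \<le> R * (2 * cmod z)" using \<open>R > 0\<close> by simp
      then show "Re (h w) < K + R * (2 * cmod z)"
        using Re[of w] abs_ge_self[of "ln C"] abs_ge_minus_self[of "Re (g 0)"]
        unfolding h_def K_def minus_complex.sel by linarith
    qed simp
    also have "\<dots> \<le> (2 * K + 4 * R) * cmod z ^ 1"
    proof -
      have "2 * K * 1 \<le> 2 * K * cmod z" by (intro mult_left_mono that) (simp add: K_def)
      then show ?thesis by (simp add: algebra_simps)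
    qed
    finally show ?thesis .
  qed
  define \<alpha> where "\<alpha> = deriv h 0"
  have hl: "h z = \<alpha> * z" for z
    using Liouville_polynomial[OF h(1) bound, where \<xi> = z] h(2) by (simp add: \<alpha>_def)
  have fe: "f z = exp (g 0) * exp (\<alpha> * z)" for z
    using hl[of z] by (simp add: f h_def exp_add[symmetric] algebra_simps)
  have quot: "exp (\<alpha> * w) = 1" for w
  proof -
    have "((\<lambda>x::real. f (of_real x + w) / f (of_real x + 0)) \<longlongrightarrow> 1 / 1) at_top"
      by (intro tendsto_divide lim) simp
    moreover have "f (of_real x + w) / f (of_real x + 0) = exp (\<alpha> * w)" for x :: real
      by (simp add: fe distrib_left exp_add)
    ultimately have "((\<lambda>x::real. exp (\<alpha> * w)) \<longlongrightarrow> 1) at_top" by simp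
    then show ?thesis by (simp add: tendsto_const_iff)
  qed
  have "((\<lambda>x::real. exp (g 0)) \<longlongrightarrow> 1) at_top"
    using lim[of 0] by (simp add: fe quot)
  then show ?thesis by (simp add: fe quot tendsto_const_iff)
qed

text \<open>
  Components are numbered from \<open>1\<close>, the rows and columns of a matrix from \<open>0\<close>.
\<close>

definition fmat :: "nat \<Rightarrow> (nat \<Rightarrow> nat \<Rightarrow> 'a) \<Rightarrow> 'a mat"
  where "fmat n A = mat n n (\<lambda>(i, j). A (Suc i) (Suc j))"

definition fdet :: "nat \<Rightarrow> (nat \<Rightarrow> nat \<Rightarrow> 'a::comm_ring_1) \<Rightarrow> 'a"
  where "fdet n A = Determinant.det (fmat n A)"

lemma fmat_carrier: "fmat n A \<in> carrier_mat n n"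
  by (simp add: fmat_def)

lemma sum_1_n: "(\<Sum>k=1..n. f k) = (\<Sum>k=0..<n. f (Suc k))"
  by (simp add: sum.atLeast1_atMost_eq lessThan_atLeast0)

text \<open>
  The inverse is the adjugate divided by the determinant. The lemma serves the complex numbers, where
  the determinant is nonzero, and the group algebra, where it is \<open>1\<close>.
\<close>

lemma fdet_unit_inverse:
  fixes A :: "nat \<Rightarrow> nat \<Rightarrow> 'a::comm_ring_1"
  assumes "fdet n A * e = 1"
  obtains B where
    "\<And>i j. i \<in> {1..n} \<Longrightarrow> j \<in> {1..n} \<Longrightarrow> (\<Sum>k=1..n. A i k * B k j) = (if i = j then 1 else 0)"
    "\<And>i j. i \<in> {1..n} \<Longrightarrow> j \<in> {1..n} \<Longrightarrow> (\<Sum>k=1..n. B i k * A k j) = (if i = j then 1 else 0)"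
proof -
  define J where "J = adj_mat (fmat n A)"
  note J = adj_mat[OF fmat_carrier[of n A], folded J_def]
  define B where "B i j = J $$ (i - 1, j - 1) * e" for i j
  have 1: "(\<Sum>k=1..n. A i k * B k j) = (if i = j then 1 else 0)" if "i \<in> {1..n}" "j \<in> {1..n}" for i j
  proof -
    have ij: "i - 1 < n" "j - 1 < n" "Suc (i - 1) = i" "Suc (j - 1) = j" using that by auto
    have "(\<Sum>k=1..n. A i k * B k j) = (fmat n A * J) $$ (i - 1, j - 1) * e"
      unfolding sum_1_n using J(1) ij
      by (simp add: B_def fmat_def scalar_prod_def sum_distrib_right mult.assoc)
    also have "\<dots> = (if i = j then 1 else 0)"
      using ij assms by (auto simp: J(2) fdet_def)
    finally show ?thesis .
  qed
  have 2: "(\<Sum>k=1..n. B i k * A k j) = (if i = j then 1 else 0)" if "i \<in> {1..n}" "j \<in> {1..n}" for i j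
  proof -
    have ij: "i - 1 < n" "j - 1 < n" "Suc (i - 1) = i" "Suc (j - 1) = j" using that by auto
    have "(\<Sum>k=1..n. B i k * A k j) = (J * fmat n A) $$ (i - 1, j - 1) * e"
      unfolding sum_1_n using J(1) ij
      by (simp add: B_def fmat_def scalar_prod_def sum_distrib_right sum_distrib_left mult.assoc mult.commute mult.left_commute)
    also have "\<dots> = (if i = j then 1 else 0)"
      using ij assms by (auto simp: J(3) fdet_def)
    finally show ?thesis .
  qed
  show ?thesis by (rule that[OF 1 2])
qed

lemma fdet_zero_kernel:
  fixes A :: "nat \<Rightarrow> nat \<Rightarrow> 'a::field"
  assumes "fdet n A = 0"
  obtains v where "\<exists>i\<in>{1..n}. v i \<noteq> 0" "\<And>i. i \<in> {1..n} \<Longrightarrow> (\<Sum>k=1..n. A i k * v k) = 0"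
proof -
  obtain u where u: "u \<in> carrier_vec n" "u \<noteq> 0\<^sub>v n" "fmat n A *\<^sub>v u = 0\<^sub>v n"
    using assms det_0_iff_vec_prod_zero[OF fmat_carrier[of n A]] unfolding fdet_def by blast
  define v where "v i = vec_index u (i - 1)" for i
  have "\<exists>i<n. vec_index u i \<noteq> 0"
  proof (rule ccontr)
    assume "\<not> ?thesis"
    then have "u = 0\<^sub>v n" using u(1) by (intro eq_vecI) auto
    with u(2) show False by simp
  qed
  then obtain i where "i < n" "vec_index u i \<noteq> 0" by blast
  then have "\<exists>i\<in>{1..n}. v i \<noteq> 0" by (intro bexI[of _ "Suc i"]) (auto simp: v_def)
  moreover have "(\<Sum>k=1..n. A i k * v k) = 0" if "i \<in> {1..n}" for i
  proof -
    have i: "i - 1 < n" "Suc (i - 1) = i" using that by auto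
    have "(\<Sum>k=1..n. A i k * v k) = vec_index (fmat n A *\<^sub>v u) (i - 1)"
      unfolding sum_1_n using u(1) i by (simp add: v_def fmat_def scalar_prod_def)
    then show ?thesis using u(3) i by simp
  qed
  ultimately show ?thesis by (rule that)
qed

lemma fdet_leibniz:
  "fdet n A = (\<Sum>\<pi> | \<pi> permutes {0..<n}. of_int (sign \<pi>) * (\<Prod>i = 0..<n. A (Suc i) (Suc (\<pi> i))))"
proof -
  have "(\<Prod>i = 0..<n. fmat n A $$ (i, \<pi> i)) = (\<Prod>i = 0..<n. A (Suc i) (Suc (\<pi> i)))"
    if "\<pi> permutes {0..<n}" for \<pi>
  proof (rule prod.cong)
    fix i assume i: "i \<in> {0..<n}"
    then have "\<pi> i \<in> {0..<n}" using permutes_in_image[OF that] by blast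
    with i show "fmat n A $$ (i, \<pi> i) = A (Suc i) (Suc (\<pi> i))" by (simp add: fmat_def)
  qed simp
  then show ?thesis unfolding fdet_def det_def'[OF fmat_carrier] by (intro sum.cong) auto
qed

lemma tendsto_fdet:
  fixes A :: "'b \<Rightarrow> nat \<Rightarrow> nat \<Rightarrow> complex"
  assumes "\<And>i j. i \<in> {1..n} \<Longrightarrow> j \<in> {1..n} \<Longrightarrow> ((\<lambda>x. A x i j) \<longlongrightarrow> B i j) F"
  shows "((\<lambda>x. fdet n (A x)) \<longlongrightarrow> fdet n B) F"
  unfolding fdet_leibniz
proof (intro tendsto_sum tendsto_mult tendsto_const tendsto_prod)
  fix \<pi> i assume "\<pi> \<in> {\<pi>. \<pi> permutes {0..<n}}" "i \<in> {0..<n}"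
  then have "\<pi> i \<in> {0..<n}" "i \<in> {0..<n}" using permutes_in_image[of \<pi> "{0..<n}" i] by simp_all
  then show "((\<lambda>x. A x (Suc i) (Suc (\<pi> i))) \<longlongrightarrow> B (Suc i) (Suc (\<pi> i))) F"
    by (intro assms) auto
qed

lemma fdet_identity: "fdet n (\<lambda>i j. if i = j then 1 else 0) = (1 :: 'a::comm_ring_1)"
proof -
  have "fmat n (\<lambda>i j. if i = j then 1 else 0) = (1\<^sub>m n :: 'a mat)" unfolding fmat_def
    by (rule eq_matI) auto
  then show ?thesis unfolding fdet_def by (simp only: Determinant.det_one)
qed

text \<open>
  The matrix \<open>I - P E\<close> of the delay system, with a delay \<open>r\<close> represented by the group element \<open>r\<close>. It acts
  on functions of time by shifts, and \<open>exp_poly z\<close> turns it into the characteristic matrix.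
\<close>

definition delay_mat :: "(nat \<Rightarrow> real) \<Rightarrow> (nat \<Rightarrow> nat \<Rightarrow> real) \<Rightarrow> nat \<Rightarrow> nat \<Rightarrow> (real \<Rightarrow>\<^sub>0 real)"
  where "delay_mat \<tau> c j k = (if j = k then 1 else 0) - Poly_Mapping.single (\<tau> k) (c j k)"

definition char_mat :: "(nat \<Rightarrow> real) \<Rightarrow> (nat \<Rightarrow> nat \<Rightarrow> real) \<Rightarrow> complex \<Rightarrow> nat \<Rightarrow> nat \<Rightarrow> complex"
  where "char_mat \<tau> c z j k = (if j = k then 1 else 0) - of_real (c j k) * exp (- (of_real (\<tau> k) * z))"

lemma exp_poly_delay_mat: "exp_poly z (delay_mat \<tau> c j k) = char_mat \<tau> c z j k"
proof -
  interpret comm_ring_hom "exp_poly z" by (rule comm_ring_hom_exp_poly)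
  show ?thesis
    by (simp add: delay_mat_def char_mat_def hom_minus) (simp add: exp_poly_def gr_lin_single scaleR_conv_of_real)
qed

lemma exp_poly_fdet: "exp_poly z (fdet n (delay_mat \<tau> c)) = fdet n (char_mat \<tau> c z)"
proof -
  have "fmat n (char_mat \<tau> c z) = map_mat (exp_poly z) (fmat n (delay_mat \<tau> c))"
    unfolding fmat_def by (rule eq_matI) (auto simp: exp_poly_delay_mat)
  then show ?thesis
    unfolding fdet_def by (simp add: comm_ring_hom.hom_det[OF comm_ring_hom_exp_poly])
qed

text \<open>
  The characteristic determinant is of exponential type and tends to \<open>1\<close> to the right, since all
  delays are positive. Without zeros it is identically \<open>1\<close>, and evaluation on the real axis
  reflects this back to the group algebra.
\<close>

theorem zero_free_delay_det:
  assumes tau: "\<And>k. k \<in> {1..n} \<Longrightarrow> \<tau> k > 0"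
    and nz: "\<And>z. fdet n (char_mat \<tau> c z) \<noteq> 0"
  shows "fdet n (delay_mat \<tau> c) = 1"
proof -
  define q where "q = fdet n (delay_mat \<tau> c)"
  obtain C R where CR: "C > 0" "R > 0" "\<And>z. cmod (exp_poly z q) \<le> C * exp (R * cmod z)"
    using exp_poly_bound by blast
  have lim: "((\<lambda>x::real. exp_poly (of_real x + w) q) \<longlongrightarrow> 1) at_top" for w
  proof -
    have "((\<lambda>x::real. fdet n (char_mat \<tau> c (of_real x + w))) \<longlongrightarrow>
        fdet n (\<lambda>i j. if i = j then 1 else 0)) at_top"
    proof (rule tendsto_fdet)
      fix i j assume "i \<in> {1..n}" "j \<in> {1..n}"
      then have t: "\<tau> j > 0" using tau by blast
      have "((\<lambda>x::real. exp (- (\<tau> j * (x + Re w)))) \<longlongrightarrow> 0) at_top" using t by real_asymp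
      then have "((\<lambda>x::real. exp (- (of_real (\<tau> j) * (of_real x + w)))) \<longlongrightarrow> 0) at_top"
        by (subst tendsto_norm_zero_iff[symmetric]) simp
      from tendsto_diff[OF tendsto_const tendsto_mult_right_zero[OF this, of "of_real (c i j)"],
          of "if i = j then 1 else 0"]
      show "((\<lambda>x::real. char_mat \<tau> c (of_real x + w) i j) \<longlongrightarrow> (if i = j then 1 else 0)) at_top"
        by (simp add: char_mat_def)
    qed
    then show ?thesis by (simp add: q_def exp_poly_fdet fdet_identity)
  qed
  have one: "exp_poly z q = 1" for z
    by (rule zero_free_exponential_type_const[OF holomorphic_exp_poly _ CR lim])
      (simp_all add: q_def exp_poly_fdet nz)
  interpret comm_ring_hom "exp_poly z" for z by (rule comm_ring_hom_exp_poly)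
  have "q - 1 = 0" by (rule exp_poly_zero_on_reals) (simp add: hom_minus one)
  then show ?thesis by (simp add: q_def)
qed


section \<open>Characteristics and the spectrum\<close>

text \<open>
  Extending the coefficients by constants beyond the unit interval makes characteristics available on
  the whole line and all derivatives two-sided.
\<close>

definition clamp01 :: "real \<Rightarrow> real"
  where "clamp01 x = max 0 (min 1 x)"

lemma clamp01_in [simp]: "clamp01 x \<in> {0..1}" and clamp01_id: "x \<in> {0..1} \<Longrightarrow> clamp01 x = x"
  by (auto simp: clamp01_def)

lemma continuous_clamp01: "continuous_on {0..1} f \<Longrightarrow> continuous_on UNIV (\<lambda>x. f (clamp01 x))"
  by (rule continuous_on_compose2[of "{0..1}"]) (auto simp: clamp01_def intro!: continuous_intros)

definition primitive :: "(real \<Rightarrow> real) \<Rightarrow> real \<Rightarrow> real \<Rightarrow> real"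
  where "primitive g c = (SOME Q. (\<forall>x. (Q has_real_derivative g x) (at x)) \<and> Q c = 0)"

lemma primitive:
  assumes g: "continuous_on UNIV g"
  shows "(primitive g c has_real_derivative g x) (at x)" "primitive g c c = 0"
proof -
  have "\<exists>F. \<forall>x::real. -\<infinity> < ereal x \<longrightarrow> ereal x < \<infinity> \<longrightarrow> (F has_vector_derivative g x) (at x)"
    by (rule einterval_antiderivative) (use g in \<open>auto simp: continuous_on_eq_continuous_at\<close>)
  then obtain F where F: "\<And>x. (F has_real_derivative g x) (at x)"
    by (auto simp: has_real_derivative_iff_has_vector_derivative)
  have "\<exists>Q. (\<forall>x. (Q has_real_derivative g x) (at x)) \<and> Q c = 0"
  proof (intro exI[of _ "\<lambda>x. F x - F c"] conjI allI)
    fix x show "((\<lambda>x. F x - F c) has_real_derivative g x) (at x)"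
      using DERIV_diff[OF F DERIV_const[of "F c"]] by simp
  qed simp
  from someI_ex[OF this] show "(primitive g c has_real_derivative g x) (at x)" "primitive g c c = 0"
    unfolding primitive_def by blast+
qed

lemma has_vector_derivative_cexp:
  assumes "(u has_vector_derivative u') (at x within S)"
  shows "((\<lambda>x. exp (u x) :: complex) has_vector_derivative u' * exp (u x)) (at x within S)"
  using field_vector_diff_chain_within[OF assms DERIV_subset[OF DERIV_exp subset_UNIV]]
    by (simp add: o_def)

lemma finite_family_bounded:
  fixes g :: "nat \<Rightarrow> real \<Rightarrow> 'a::real_normed_vector"
  assumes "\<And>j. j \<in> {1..n} \<Longrightarrow> continuous_on {0..1} (g j)"
  obtains K where "K > 0" "\<forall>j\<in>{1..n}. \<forall>x\<in>{0..1}. norm (g j x) \<le> K"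
proof -
  have "bounded (\<Union>j\<in>{1..n}. g j ` {0..1})"
    by (intro bounded_UN ballI compact_imp_bounded compact_continuous_image assms) auto
  then obtain K where "\<forall>y\<in>(\<Union>j\<in>{1..n}. g j ` {0..1}). norm y \<le> K" unfolding bounded_iff by blast
  then have "\<forall>j\<in>{1..n}. \<forall>x\<in>{0..1}. norm (g j x) \<le> max K 1"
    by (intro ballI max.coboundedI1) blast
  moreover have "max K 1 > 0" by simp
  ultimately show ?thesis by (rule that[rotated])
qed

text \<open>
  Integrate \<open>|f| \<le> (|f|\<^sup>2 / s + s) / 2\<close> with \<open>s\<close> the norm of \<open>f\<close>; the interval has length \<open>1\<close>.
\<close>

lemma integral_norm_le_L2_norm:
  fixes f :: "real \<Rightarrow> complex"
  assumes f: "f \<in> L2"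
  shows "integral {0..1} (\<lambda>x. norm (f x)) \<le> L2_norm f"
proof -
  define s where "s = L2_norm f"
  have s2: "s\<^sup>2 = L2_sq f" by (simp add: s_def L2_norm_eq_sqrt L2_sq_nonneg)
  have i: "integrable M01 (\<lambda>x. norm (f x))" using L2_integrable[OF f] by simp
  have i2: "integrable M01 (\<lambda>x. (norm (f x))\<^sup>2 / s)" using L2D(2)[OF f] by simp
  have ci: "integrable M01 (\<lambda>x. s)" by (rule finite_measure.integrable_const[OF finite_measure_M01])
  have eq: "integral {0..1} (\<lambda>x. norm (f x)) = (LINT x|M01. norm (f x))"
    by (rule M01_integral_eq[OF i, symmetric])
  show ?thesis
  proof (cases "s = 0")
    case True
    then have "AE x in M01. f x = 0" using s2 L2_sq_eq_0_iff[OF f] by simp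
    then have "AE x in M01. norm (f x) = 0" by eventually_elim simp
    then have "(LINT x|M01. norm (f x)) = (LINT x|M01. 0)"
      by (intro integral_cong_AE) (use i in auto)
    then show ?thesis using True by (simp add: eq s_def)
  next
    case False
    moreover have "s \<ge> 0" by (simp add: s_def L2_norm_eq_sqrt L2_sq_nonneg)
    ultimately have "s > 0" by simp
    have "(LINT x|M01. norm (f x)) \<le> (LINT x|M01. ((norm (f x))\<^sup>2 / s + s) / 2)"
    proof (rule integral_mono[OF i])
      show "integrable M01 (\<lambda>x. ((norm (f x))\<^sup>2 / s + s) / 2)"
        by (rule integrable_divide[OF Bochner_Integration.integrable_add[OF i2 ci]])
      show "norm (f x) \<le> ((norm (f x))\<^sup>2 / s + s) / 2" for x
        using sum_squares_bound[of "norm (f x)" s] \<open>s > 0\<close>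
        by (simp add: field_simps power2_eq_square)
    qed
    also have "\<dots> = (L2_sq f / s + s) / 2"
      using Bochner_Integration.integral_add[OF i2 ci]
        by (simp add: L2_sq_def measure_restrict_space)
    also have "\<dots> = s" using \<open>s > 0\<close> unfolding s2[symmetric] by (simp add: power2_eq_square)
    finally show ?thesis by (simp add: eq s_def)
  qed
qed

lemma L2_norm_le_bound:
  fixes v :: "real \<Rightarrow> 'a::{banach,second_countable_topology}"
  assumes v: "v \<in> L2" and "AE x in M01. v x = c x" and c: "\<And>x. x \<in> {0..1} \<Longrightarrow> norm (c x) \<le> C" and "C \<ge> 0"
  shows "L2_norm v \<le> C"
proof -
  have "L2_sq v \<le> (LINT x|M01. C\<^sup>2)"
    unfolding L2_sq_def
  proof (rule integral_mono_AE[OF L2D(2)[OF v] finite_measure.integrable_const[OF finite_measure_M01]])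
    show "AE x in M01. (norm (v x))\<^sup>2 \<le> C\<^sup>2"
      using assms(2) AE_space
    proof eventually_elim
      case (elim x)
      then show ?case using c[of x] by (auto intro!: power_mono)
    qed
  qed
  also have "\<dots> = C\<^sup>2" by (simp add: measure_restrict_space)
  finally show ?thesis unfolding L2_norm_eq_sqrt using \<open>C \<ge> 0\<close> by (rule real_le_lsqrt[rotated 1])
qed

locale hyperbolic_system =
  fixes n m :: nat and p :: "nat \<Rightarrow> nat \<Rightarrow> real" and a b :: "nat \<Rightarrow> real \<Rightarrow> real" and \<alpha> :: real
  assumes n: "1 \<le> n" and m: "m \<le> n"
    and a_cont: "\<And>j. j \<in> {1..n} \<Longrightarrow> continuous_on {0..1} (a j)"
    and b_cont: "\<And>j. j \<in> {1..n} \<Longrightarrow> continuous_on {0..1} (b j)"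
    and alpha: "0 < \<alpha>"
    and a_pos: "\<And>j x. j \<in> {1..m} \<Longrightarrow> x \<in> {0..1} \<Longrightarrow> \<alpha> \<le> a j x"
    and a_neg: "\<And>j x. j \<in> {m+1..n} \<Longrightarrow> x \<in> {0..1} \<Longrightarrow> a j x \<le> - \<alpha>"
begin

text \<open>
  The end point at which component \<open>j\<close> enters the interval, where its value belongs to \<open>v_out\<close>, and
  the one at which it leaves, where its value belongs to \<open>v_in\<close>.
\<close>

definition out_pt :: "nat \<Rightarrow> real" where "out_pt j = (if j \<le> m then 0 else 1)"
definition in_pt :: "nat \<Rightarrow> real" where "in_pt j = (if j \<le> m then 1 else 0)"

text \<open>
  Travel time from the entrance to \<open>x\<close>, which is positive for both directions of travel because
  \<open>a\<^sub>j\<close> and the direction of integration change sign together.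
\<close>

definition \<theta> :: "nat \<Rightarrow> real \<Rightarrow> real"
  where "\<theta> j = primitive (\<lambda>x. 1 / a j (clamp01 x)) (out_pt j)"

text \<open>
  The damping exponent collected between the entrance and \<open>x\<close>.
\<close>

definition \<rho> :: "nat \<Rightarrow> real \<Rightarrow> real"
  where "\<rho> j = primitive (\<lambda>x. b j (clamp01 x) / a j (clamp01 x)) (out_pt j)"

definition \<tau> :: "nat \<Rightarrow> real" where "\<tau> j = \<theta> j (in_pt j)"

definition damped_p :: "nat \<Rightarrow> nat \<Rightarrow> real"
  where "damped_p j k = p j k * exp (- \<rho> k (in_pt k))"

lemma pts_in [simp]: "out_pt j \<in> {0..1}" "in_pt j \<in> {0..1}"
  by (auto simp: out_pt_def in_pt_def)

lemma a_nonzero: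
  assumes "j \<in> {1..n}" "x \<in> {0..1}" shows "a j x \<noteq> 0"
proof (cases "j \<le> m")
  case True
  then have "\<alpha> \<le> a j x" using a_pos assms by simp
  then show ?thesis using alpha by simp
next
  case False
  then have "a j x \<le> - \<alpha>" using a_neg assms by simp
  then show ?thesis using alpha by simp
qed

lemma quotient_a_continuous:
  assumes "j \<in> {1..n}" "continuous_on {0..1} g"
  shows "continuous_on {0..1} (\<lambda>x. g x / a j x)"
  using assms a_nonzero by (intro continuous_on_divide a_cont) auto

lemma \<theta>_deriv: "j \<in> {1..n} \<Longrightarrow> (\<theta> j has_real_derivative 1 / a j (clamp01 x)) (at x)"
  unfolding \<theta>_def
  by (rule primitive(1)) (rule continuous_clamp01, rule quotient_a_continuous, auto intro: continuous_intros)

lemma \<rho>_deriv: "j \<in> {1..n} \<Longrightarrow> (\<rho> j has_real_derivative b j (clamp01 x) / a j (clamp01 x)) (at x)"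
  unfolding \<rho>_def
  by (rule primitive(1)) (rule continuous_clamp01, rule quotient_a_continuous, auto intro: b_cont)

lemma \<theta>_out: "j \<in> {1..n} \<Longrightarrow> \<theta> j (out_pt j) = 0"
  unfolding \<theta>_def
  by (rule primitive(2)) (rule continuous_clamp01, rule quotient_a_continuous, auto intro: continuous_intros)

lemma \<rho>_out: "j \<in> {1..n} \<Longrightarrow> \<rho> j (out_pt j) = 0"
  unfolding \<rho>_def
  by (rule primitive(2)) (rule continuous_clamp01, rule quotient_a_continuous, auto intro: b_cont)

lemma \<theta>_monotone:
  assumes j: "j \<in> {1..n}" and "x < y"
  shows "if j \<le> m then \<theta> j x < \<theta> j y else \<theta> j y < \<theta> j x"
proof (cases "j \<le> m")
  case True
  have "\<theta> j x < \<theta> j y"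
  proof (rule DERIV_pos_imp_increasing[OF \<open>x < y\<close>])
    fix s
    have "a j (clamp01 s) > 0" using a_pos[OF _ clamp01_in, of j s] j True alpha by simp
    then show "\<exists>d. (\<theta> j has_real_derivative d) (at s) \<and> 0 < d"
      by (intro exI[of _ "1 / a j (clamp01 s)"] conjI \<theta>_deriv[OF j]) simp
  qed
  then show ?thesis using True by simp
next
  case False
  have "\<theta> j y < \<theta> j x"
  proof (rule DERIV_neg_imp_decreasing[OF \<open>x < y\<close>])
    fix s
    have "a j (clamp01 s) < 0" using a_neg[OF _ clamp01_in, of j s] j False alpha by simp
    then show "\<exists>d. (\<theta> j has_real_derivative d) (at s) \<and> d < 0"
      by (intro exI[of _ "1 / a j (clamp01 s)"] conjI \<theta>_deriv[OF j]) simp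
  qed
  then show ?thesis using False by simp
qed

lemma \<tau>_pos: "j \<in> {1..n} \<Longrightarrow> 0 < \<tau> j"
  using \<theta>_monotone[of j 0 1] \<theta>_out[of j] by (auto simp: \<tau>_def in_pt_def out_pt_def split: if_splits)

text \<open>
  The solution of \<open>z v + a\<^sub>j v' + b\<^sub>j v = 0\<close> with value \<open>1\<close> at the entrance.
\<close>

definition mode :: "complex \<Rightarrow> nat \<Rightarrow> real \<Rightarrow> complex"
  where "mode z j x = exp (- (z * of_real (\<theta> j x) + of_real (\<rho> j x)))"

text \<open>
  The logarithmic derivative of \<open>1 / mode z j\<close>.
\<close>

definition growth :: "complex \<Rightarrow> nat \<Rightarrow> real \<Rightarrow> complex"
  where "growth z j x = (z + of_real (b j x)) / of_real (a j x)"

lemma phase_deriv: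
  assumes j: "j \<in> {1..n}" and x: "x \<in> {0..1}"
  shows "((\<lambda>x. z * of_real (\<theta> j x) + of_real (\<rho> j x)) has_vector_derivative growth z j x) (at x within {0..1})"
proof -
  have t: "((\<lambda>x. complex_of_real (\<theta> j x)) has_vector_derivative of_real (1 / a j x)) (at x within {0..1})"
    using has_field_derivative_at_within[OF \<theta>_deriv[OF j, of x]] clamp01_id[OF x]
    by (intro has_vector_derivative_of_real) (simp add: has_real_derivative_iff_has_vector_derivative)
  have r: "((\<lambda>x. complex_of_real (\<rho> j x)) has_vector_derivative of_real (b j x / a j x)) (at x within {0..1})"
    using has_field_derivative_at_within[OF \<rho>_deriv[OF j, of x]] clamp01_id[OF x]
    by (intro has_vector_derivative_of_real) (simp add: has_real_derivative_iff_has_vector_derivative)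
  have "((\<lambda>x. z * of_real (\<theta> j x) + of_real (\<rho> j x)) has_vector_derivative
      (z * of_real (1 / a j x) + of_real (b j x / a j x))) (at x within {0..1})"
    by (rule has_vector_derivative_add[OF has_vector_derivative_mult_right[OF t] r])
  then show ?thesis by (simp add: growth_def add_divide_distrib)
qed

lemma mode_deriv:
  assumes "j \<in> {1..n}" "x \<in> {0..1}"
  shows "(mode z j has_vector_derivative - growth z j x * mode z j x) (at x within {0..1})"
  using has_vector_derivative_cexp[OF has_vector_derivative_minus[OF phase_deriv[OF assms]], of z]
  by (simp add: mode_def[abs_def])

lemma inverse_mode_deriv:
  assumes "j \<in> {1..n}" "x \<in> {0..1}"
  shows "((\<lambda>x. inverse (mode z j x)) has_vector_derivative growth z j x * inverse (mode z j x)) (at x within {0..1})"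
  unfolding mode_def exp_minus inverse_inverse_eq
  by (rule has_vector_derivative_cexp[OF phase_deriv[OF assms]])

lemma mode_nonzero: "mode z j x \<noteq> 0"
  by (simp add: mode_def)

lemma mode_out: "j \<in> {1..n} \<Longrightarrow> mode z j (out_pt j) = 1"
  by (simp add: mode_def \<theta>_out \<rho>_out)

lemma mode_in: "of_real (p j k) * mode z k (in_pt k) = of_real (damped_p j k) * exp (- (of_real (\<tau> k) * z))"
  unfolding mode_def damped_p_def \<tau>_def of_real_mult exp_of_real[symmetric] of_real_minus exp_minus exp_add
  by (simp add: mult_ac exp_of_real)

lemma mode_continuous: "j \<in> {1..n} \<Longrightarrow> continuous_on {0..1} (mode z j)"
  by (rule continuous_on_vector_derivative) (rule mode_deriv)

lemma inverse_mode_continuous: "j \<in> {1..n} \<Longrightarrow> continuous_on {0..1} (\<lambda>x. inverse (mode z j x))"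
  by (rule continuous_on_vector_derivative) (rule inverse_mode_deriv)

lemma of_real_a_divide_continuous:
  assumes "j \<in> {1..n}" "continuous_on {0..1} g"
  shows "continuous_on {0..1} (\<lambda>x. g x / complex_of_real (a j x))"
  using assms a_nonzero by (intro continuous_on_divide continuous_on_of_real a_cont) auto

lemma growth_continuous: "j \<in> {1..n} \<Longrightarrow> continuous_on {0..1} (growth z j)"
  unfolding growth_def
  by (rule of_real_a_divide_continuous) (auto intro!: continuous_on_add continuous_on_of_real b_cont)

lemma v_out_eq: "v_out m v j = v j (out_pt j)" and v_in_eq: "v_in m v j = v j (in_pt j)"
  by (simp_all add: v_out_def out_pt_def v_in_def in_pt_def)

abbreviation "char z \<equiv> char_mat \<tau> damped_p z"

lemma char_sum:
  assumes "j \<in> {1..n}"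
  shows "(\<Sum>k=1..n. char z j k * x k) =
    x j - (\<Sum>k=1..n. of_real (p j k) * mode z k (in_pt k) * x k)"
proof -
  have "(\<Sum>k=1..n. char z j k * x k) =
      (\<Sum>k=1..n. (if j = k then x k else 0) - of_real (p j k) * mode z k (in_pt k) * x k)"
    unfolding mode_in by (intro sum.cong) (auto simp: char_mat_def algebra_simps)
  also have "\<dots> = x j - (\<Sum>k=1..n. of_real (p j k) * mode z k (in_pt k) * x k)"
    using assms by (simp add: sum_subtractf)
  finally show ?thesis .
qed

text \<open>
  A continuous function given as a primitive is its own continuous representative.
\<close>

lemma A_domainI:
  assumes v: "\<And>j. j \<in> {1..n} \<Longrightarrow> continuous_on {0..1} (v j)" and w: "\<And>j. j \<in> {1..n} \<Longrightarrow> w j \<in> L2"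
    and prim: "\<And>j x. j \<in> {1..n} \<Longrightarrow> x \<in> {0..1} \<Longrightarrow> v j x = v j 0 + integral {0..x} (w j)"
    and bc: "\<And>j. j \<in> {1..n} \<Longrightarrow> v j (out_pt j) = (\<Sum>k=1..n. of_real (p j k) * v k (in_pt k))"
    and eq: "\<And>j x. j \<in> {1..n} \<Longrightarrow> x \<in> {0..1} \<Longrightarrow>
      of_real (a j x) * w j x = f j x - (z + of_real (b j x)) * v j x"
  shows "v \<in> A_domain n m p" "ae_eq n (\<lambda>j x. z * v j x - A_op a b v j x) f"
proof -
  have wd: "has_weak_deriv (v j) (w j)" if j: "j \<in> {1..n}" for j
    by (rule has_weak_deriv_primitive[OF w[OF j] prim[OF j]])
  show "v \<in> A_domain n m p"
    unfolding A_domain_def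
  proof (intro CollectI conjI ballI exI[of _ v])
    show "v \<in> L2_vec n" unfolding L2_vec_def using L2_continuous[OF v] by blast
    show "\<exists>w\<in>L2. has_weak_deriv (v j) w" if "j \<in> {1..n}" for j
      using wd[OF that] w[OF that] by blast
    show "ae_eq n v v" by (simp add: ae_eq_def)
    show "continuous_on {0..1} (v j)" if "j \<in> {1..n}" for j by (rule v[OF that])
    show "v_out m v j = (\<Sum>k=1..n. of_real (p j k) * v_in m v k)" if "j \<in> {1..n}" for j
      unfolding v_out_eq v_in_eq by (rule bc[OF that])
  qed
  show "ae_eq n (\<lambda>j x. z * v j x - A_op a b v j x) f"
    unfolding ae_eq_def
  proof
    fix j assume j: "j \<in> {1..n}"
    show "AE s in M01. z * v j s - A_op a b v j s = f j s"
      using weak_deriv_AE_eq(3)[OF w[OF j] wd[OF j]] AE_space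
    proof eventually_elim
      case (elim s)
      then have "of_real (a j s) * w j s = f j s - (z + of_real (b j s)) * v j s"
        using eq[OF j, of s] by simp
      then show ?case unfolding A_op_def elim(1) by (simp add: algebra_simps)
    qed
  qed
qed

text \<open>
  A kernel vector of the characteristic matrix is the vector of values at the entrances of an
  eigenfunction whose components are multiples of the modes.
\<close>

lemma char_zero_in_spectrum:
  assumes "fdet n (char z) = 0"
  shows "z \<in> op_spectrum n (A_domain n m p) (A_op a b)"
  unfolding op_spectrum_def
proof
  assume res: "z \<in> resolvent_set n (A_domain n m p) (A_op a b)"
  obtain x where x: "\<exists>i\<in>{1..n}. x i \<noteq> 0" "\<And>i. i \<in> {1..n} \<Longrightarrow> (\<Sum>k=1..n. char z i k * x k) = 0"
    using fdet_zero_kernel[OF assms] by metis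
  define v where "v j s = x j * mode z j s" for j s
  define w where "w j s = x j * (- growth z j s * mode z j s)" for j s
  have cv: "continuous_on {0..1} (v j)" if "j \<in> {1..n}" for j
    unfolding v_def by (intro continuous_on_mult continuous_on_const mode_continuous that)
  have cw: "continuous_on {0..1} (w j)" if "j \<in> {1..n}" for j
    unfolding w_def
      by (intro continuous_on_mult continuous_on_minus continuous_on_const mode_continuous growth_continuous that)
  have prim: "v j s = v j 0 + integral {0..s} (w j)" if j: "j \<in> {1..n}" and s: "s \<in> {0..1}" for j s
  proof -
    have "(w j has_integral v j s - v j 0) {0..s}"
    proof (rule fundamental_theorem_of_calculus)
      fix t assume "t \<in> {0..s}"
      then have t: "t \<in> {0..1}" using s by simp
      have "(v j has_vector_derivative w j t) (at t within {0..1})"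
        unfolding v_def w_def by (rule has_vector_derivative_mult_right[OF mode_deriv[OF j t]])
      then show "(v j has_vector_derivative w j t) (at t within {0..s})"
        by (rule has_vector_derivative_within_subset) (use s in simp)
    qed (use s in simp)
    then show ?thesis by (simp add: integral_unique)
  qed
  have bc: "v j (out_pt j) = (\<Sum>k=1..n. of_real (p j k) * v k (in_pt k))" if j: "j \<in> {1..n}" for j
    using x(2)[OF j] char_sum[OF j, of z x] j by (simp add: v_def mode_out mult_ac)
  have eq: "of_real (a j s) * w j s = 0 - (z + of_real (b j s)) * v j s"
    if "j \<in> {1..n}" "s \<in> {0..1}" for j s
    using a_nonzero[OF that] by (simp add: w_def v_def growth_def)
  note A = A_domainI[of v w "\<lambda>j x. 0", OF cv L2_continuous[OF cw] prim bc eq]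
  have "ae_eq n v (\<lambda>j x. 0)" using res A unfolding resolvent_set_def by blast
  then have "AE s in M01. v j s = 0" if "j \<in> {1..n}" for j using that by (auto simp: ae_eq_def)
  from continuous_AE_eq_const[OF cv this, of _ 0] have "v j 0 = 0" if "j \<in> {1..n}" for j using that
    by simp
  then show False using x(1) by (auto simp: v_def mode_nonzero)
qed

text \<open>
  The contribution of the right-hand side \<open>f\<close> in the formula of variation of constants, relative to
  the mode; it is zero at the entrance.
\<close>

definition source_integral :: "complex \<Rightarrow> nat \<Rightarrow> (real \<Rightarrow> complex) \<Rightarrow> real \<Rightarrow> complex"
  where "source_integral z j f x =
    integral {0..x} (\<lambda>s. f s * (inverse (mode z j s) / of_real (a j s))) -
    integral {0..out_pt j} (\<lambda>s. f s * (inverse (mode z j s) / of_real (a j s)))"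

lemma source_abs_integrable:
  assumes "j \<in> {1..n}" "f \<in> L2"
  shows "(\<lambda>s. f s * (inverse (mode z j s) / of_real (a j s))) absolutely_integrable_on {0..1}"
  by (intro absolutely_integrable_mult_continuous L2_absolutely_integrable assms
      of_real_a_divide_continuous inverse_mode_continuous)

text \<open>
  The product of \<open>c\<close> and the inverse of the mode is a primitive of \<open>f\<close> times the inverse of the mode,
  divided by \<open>a\<^sub>j\<close>.
\<close>

lemma variation_of_constants:
  assumes j: "j \<in> {1..n}" and w: "w \<in> L2" and c: "\<And>x. x \<in> {0..1} \<Longrightarrow> c x = c 0 + integral {0..x} w"
    and f: "f \<in> L2" and eq: "AE x in M01. z * c x + of_real (a j x) * w x + of_real (b j x) * c x = f x"
    and x: "x \<in> {0..1}"
  shows "c x = mode z j x * (c (out_pt j) + source_integral z j f x)"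
proof -
  let ?h = "\<lambda>x. inverse (mode z j x)"
  let ?q = "\<lambda>s. f s * (?h s / of_real (a j s))"
  have key: "c y * ?h y = c 0 * ?h 0 + integral {0..y} ?q" if y: "y \<in> {0..1}" for y
  proof -
    have "c y * ?h y = c 0 * ?h 0 + integral {0..y} (\<lambda>s. w s * ?h s + c s * (growth z j s * ?h s))"
      by (rule primitive_product_rule[OF L2_absolutely_integrable[OF w] c inverse_mode_deriv[OF j] _ y])
        (auto intro!: continuous_on_mult growth_continuous inverse_mode_continuous j)
    also have "integral {0..y} (\<lambda>s. w s * ?h s + c s * (growth z j s * ?h s)) = integral {0..y} ?q"
    proof -
      define N
        where "N = {s \<in> {0<..<1}. z * c s + of_real (a j s) * w s + of_real (b j s) * c s \<noteq> f s}"
      have "AE s in lebesgue. s \<in> {0<..<1} \<longrightarrow>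
          z * c s + of_real (a j s) * w s + of_real (b j s) * c s = f s"
        using eq by (subst (asm) AE_restrict_space_iff) simp_all
      then obtain M where M: "M \<in> null_sets lebesgue"
        "{s \<in> space lebesgue. \<not> (s \<in> {0<..<1} \<longrightarrow>
          z * c s + of_real (a j s) * w s + of_real (b j s) * c s = f s)} \<subseteq> M"
        unfolding eventually_ae_filter by blast
      then have "N \<subseteq> M" unfolding N_def by auto
      with M(1) have "negligible N" using negligible_iff_null_sets negligible_subset by blast
      then have "negligible (N \<union> {0, 1})" by (simp add: negligible_Un)
      then show ?thesis
      proof (rule integral_spike)
        fix s assume "s \<in> {0..y} - (N \<union> {0, 1})"
        then have s: "s \<in> {0..1}" "s \<in> {0<..<1}" "s \<notin> N" using y by auto
        then have e: "z * c s + of_real (a j s) * w s + of_real (b j s) * c s = f s"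
          by (simp add: N_def)
        have "a j s \<noteq> 0" using a_nonzero[OF j s(1)] .
        then show "f s * (?h s / of_real (a j s)) = w s * ?h s + c s * (growth z j s * ?h s)"
          unfolding e[symmetric] growth_def by (simp add: divide_simps) (simp add: algebra_simps)
      qed
    qed
    finally show ?thesis .
  qed
  have "c x * ?h x - c (out_pt j) * ?h (out_pt j) = source_integral z j f x"
    unfolding source_integral_def using key[OF x] key[OF pts_in(1)[of j]] by simp
  then have "c x * ?h x = c (out_pt j) + source_integral z j f x"
    using j by (simp add: mode_out algebra_simps)
  moreover have "c x = mode z j x * (c x * ?h x)" using mode_nonzero[of z j x] by simp
  ultimately show ?thesis by metis
qed

lemma variation_of_constants_solution:
  fixes z k :: complex
  assumes j: "j \<in> {1..n}" and f: "f \<in> L2"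
  defines "c \<equiv> \<lambda>x. mode z j x * (k + source_integral z j f x)"
    and "w \<equiv> \<lambda>x. f x / of_real (a j x) - growth z j x * (mode z j x * (k + source_integral z j f x))"
  shows "continuous_on {0..1} c" "w \<in> L2" "\<And>x. x \<in> {0..1} \<Longrightarrow> c x = c 0 + integral {0..x} w"
proof -
  let ?q = "\<lambda>s. f s * (inverse (mode z j s) / of_real (a j s))"
  define F where "F x = k + source_integral z j f x" for x
  have qa: "?q absolutely_integrable_on {0..1}" by (rule source_abs_integrable[OF j f])
  have F: "F x = F 0 + integral {0..x} ?q" for x by (simp add: F_def source_integral_def)
  have "continuous_on {0..1} (\<lambda>x. F 0 + integral {0..x} ?q)"
    by (intro continuous_on_add continuous_on_const primitive_continuous qa)
  then have cF: "continuous_on {0..1} F" by (rule continuous_on_eq) (rule F[symmetric])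
  have c: "c x = F x * mode z j x" for x by (simp add: c_def F_def)
  show cc: "continuous_on {0..1} c"
    unfolding c by (intro continuous_on_mult cF mode_continuous j)
  have "(\<lambda>x. (1 / of_real (a j x)) * f x) \<in> L2"
    by (rule L2_mult_continuous[OF f of_real_a_divide_continuous[OF j]]) (rule continuous_on_const)
  from L2_diff[OF this L2_continuous[OF continuous_on_mult[OF growth_continuous[OF j] cc]]]
  have "(\<lambda>x. (1 / of_real (a j x)) * f x - growth z j x * c x) \<in> L2" .
  then show "w \<in> L2" by (simp add: w_def c_def)
  fix x :: real assume x: "x \<in> {0..1}"
  have "F x * mode z j x = F 0 * mode z j 0 +
      integral {0..x} (\<lambda>s. ?q s * mode z j s + F s * (- growth z j s * mode z j s))"
    by (rule primitive_product_rule[OF qa F mode_deriv[OF j] _ x])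
      (assumption, intro continuous_on_mult continuous_on_minus growth_continuous mode_continuous j)
  also have "(\<lambda>s. ?q s * mode z j s + F s * (- growth z j s * mode z j s)) = w"
    by (rule ext) (simp add: w_def F_def mode_nonzero field_simps)
  finally show "c x = c 0 + integral {0..x} w" by (simp add: c)
qed

lemma source_integral_bound:
  obtains C where "C > 0"
    "\<forall>j\<in>{1..n}. \<forall>f\<in>L2. \<forall>x\<in>{0..1}. norm (source_integral z j f x) \<le> C * L2_norm f"
proof -
  obtain K
    where K: "K > 0" "\<forall>j\<in>{1..n}. \<forall>x\<in>{0..1}. norm (inverse (mode z j x) / of_real (a j x)) \<le> K"
    by (rule finite_family_bounded[of n "\<lambda>j x. inverse (mode z j x) / of_real (a j x)",
        OF of_real_a_divide_continuous[OF _ inverse_mode_continuous]])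
  show ?thesis
  proof (rule that[of "2 * K"]; (intro ballI)?)
    fix j and f :: "real \<Rightarrow> complex" and x :: real assume j: "j \<in> {1..n}" and f: "f \<in> L2" and x: "x \<in> {0..1}"
    let ?q = "\<lambda>s. f s * (inverse (mode z j s) / of_real (a j s))"
    have fi: "(\<lambda>s. norm (f s) * K) integrable_on {0..1}"
      using L2_absolutely_integrable[OF f] unfolding absolutely_integrable_on_def
        by (intro integrable_on_mult_left) blast
    have qi: "?q integrable_on {0..1}"
      using source_abs_integrable[OF j f] unfolding absolutely_integrable_on_def by blast
    have b: "norm (integral {0..y} ?q) \<le> K * L2_norm f" if y: "y \<in> {0..1}" for y
    proof -
      have "norm (integral {0..y} ?q) \<le> integral {0..y} (\<lambda>s. norm (f s) * K)"
      proof (rule integral_norm_bound_integral)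
        show "?q integrable_on {0..y}" by (rule integrable_on_subinterval[OF qi]) (use y in simp)
        show "(\<lambda>s. norm (f s) * K) integrable_on {0..y}"
          by (rule integrable_on_subinterval[OF fi]) (use y in simp)
        fix s assume "s \<in> {0..y}"
        then have "norm (inverse (mode z j s) / of_real (a j s)) \<le> K"
          using K(2)[rule_format, OF j, of s] y by simp
        then show "norm (?q s) \<le> norm (f s) * K" unfolding norm_mult by (rule mult_left_mono) simp
      qed
      also have "\<dots> \<le> integral {0..1} (\<lambda>s. norm (f s) * K)"
        by (rule integral_subset_le) (use y K(1) integrable_on_subinterval[OF fi, of 0 y] fi in auto)
      also have "\<dots> = integral {0..1} (\<lambda>s. norm (f s)) * K" by simp
      also have "\<dots> \<le> L2_norm f * K" using integral_norm_le_L2_norm[OF f] K(1) by simp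
      finally show ?thesis by (simp add: mult.commute)
    qed
    show "norm (source_integral z j f x) \<le> 2 * K * L2_norm f"
      unfolding source_integral_def
      using norm_triangle_ineq4[of "integral {0..x} ?q" "integral {0..out_pt j} ?q"] b[OF x] b[OF pts_in(1)[of j]]
      by linarith
  qed (use K(1) in simp)
qed

lemma boundary_sum:
  assumes "j \<in> {1..n}"
    and B: "\<And>i j. i \<in> {1..n} \<Longrightarrow> j \<in> {1..n} \<Longrightarrow> (\<Sum>k=1..n. B i k * A k j) = (if i = j then 1 else (0::'a::comm_ring_1))"
  shows "(\<Sum>k=1..n. B j k * (\<Sum>l=1..n. A k l * x l)) = x j"
proof -
  have "(\<Sum>k=1..n. B j k * (\<Sum>l=1..n. A k l * x l)) = (\<Sum>l=1..n. (\<Sum>k=1..n. B j k * A k l) * x l)"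
    by (simp add: sum_distrib_left sum_distrib_right mult.assoc) (rule sum.swap)
  also have "\<dots> = (\<Sum>l=1..n. (if j = l then 1 else 0) * x l)"
    by (intro sum.cong refl) (simp only: B[OF assms(1)])
  also have "\<dots> = x j" using assms(1) by (simp add: if_distrib[of "\<lambda>q. q * _"] cong: if_cong)
  finally show ?thesis .
qed

text \<open>
  By variation of constants, a function in the domain of \<open>\<A>\<close> is determined by its values at the
  entrances and by \<open>f\<close>. The boundary condition says that the characteristic matrix maps the vector of
  these values to a vector \<open>S f\<close> that is linear in the source integrals of \<open>f\<close>. So the inverse
  \<open>B\<close> of the matrix yields existence, and it bounds the values at the entrances, hence the function,
  by the norm of \<open>f\<close>. Uniqueness is a consequence of the bound.
\<close>

lemma char_nonzero_in_resolvent: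
  assumes "fdet n (char z) \<noteq> 0"
  shows "z \<in> resolvent_set n (A_domain n m p) (A_op a b)"
proof -
  obtain B where
    AB: "\<And>i j. i \<in> {1..n} \<Longrightarrow> j \<in> {1..n} \<Longrightarrow> (\<Sum>k=1..n. char z i k * B k j) = (if i = j then 1 else 0)" and
    BA: "\<And>i j. i \<in> {1..n} \<Longrightarrow> j \<in> {1..n} \<Longrightarrow> (\<Sum>k=1..n. B i k * char z k j) = (if i = j then 1 else 0)"
    by (rule fdet_unit_inverse[of n "char z" "inverse (fdet n (char z))"]) (use assms in auto)
  define S
    where "S f j = (\<Sum>k=1..n. of_real (p j k) * mode z k (in_pt k) * source_integral z k (f k) (in_pt k))"
    for f :: "nat \<Rightarrow> real \<Rightarrow> complex" and j
  obtain C where C: "C > 0"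
    "\<forall>j\<in>{1..n}. \<forall>f\<in>L2. \<forall>x\<in>{0..1}. norm (source_integral z j f x) \<le> C * L2_norm f"
    by (rule source_integral_bound)
  obtain K where K: "K > 0" "\<forall>j\<in>{1..n}. \<forall>x\<in>{0..1}. norm (mode z j x) \<le> K"
    by (rule finite_family_bounded[of n "mode z", OF mode_continuous])
  \<comment> \<open>\<open>G\<close> bounds the inverse matrix composed with the map from source integrals to \<open>S f\<close>\<close>
  define Q where "Q k = (\<Sum>l=1..n. norm (of_real (p k l) * mode z l (in_pt l)))" for k
  define G where "G = (\<Sum>j=1..n. \<Sum>k=1..n. norm (B j k) * Q k)"
  have "G \<ge> 0" unfolding G_def Q_def by (intro sum_nonneg mult_nonneg_nonneg) auto
  have bound: "L2_vec_norm n v \<le> K * (G * C + C) * L2_vec_norm n (\<lambda>j x. z * v j x - A_op a b v j x)"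
    if v: "v \<in> A_domain n m p" for v
  proof -
    from v have vL: "\<And>j. j \<in> {1..n} \<Longrightarrow> v j \<in> L2"
      and wex: "\<And>j. j \<in> {1..n} \<Longrightarrow> \<exists>w\<in>L2. has_weak_deriv (v j) w"
      unfolding A_domain_def L2_vec_def by blast+
    from v obtain c where cc: "\<And>j. j \<in> {1..n} \<Longrightarrow> continuous_on {0..1} (c j)"
      and vc: "\<And>j. j \<in> {1..n} \<Longrightarrow> AE x in M01. v j x = c j x"
      and bc: "\<And>j. j \<in> {1..n} \<Longrightarrow> v_out m c j = (\<Sum>k=1..n. of_real (p j k) * v_in m c k)"
      unfolding A_domain_def ae_eq_def by blast
    define w where "w j = weak_deriv (v j)" for j
    define f where "f = (\<lambda>j x. z * v j x - A_op a b v j x)"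
    have fe: "f j x = z * v j x + of_real (a j x) * w j x + of_real (b j x) * v j x" for j x
      by (simp add: f_def A_op_def w_def)
    define N where "N = L2_vec_norm n f"
    have N0: "N \<ge> 0" unfolding N_def by (rule L2_vec_norm_nonneg[OF n])
    have wL: "w j \<in> L2" and wd: "has_weak_deriv (v j) (w j)" if j: "j \<in> {1..n}" for j
    proof -
      obtain w0 where "w0 \<in> L2" "has_weak_deriv (v j) w0" using wex[OF j] by blast
      from weak_deriv_AE_eq[OF this] show "w j \<in> L2" "has_weak_deriv (v j) (w j)" unfolding w_def
        by blast+
    qed
    have fL: "f j \<in> L2" if j: "j \<in> {1..n}" for j
    proof -
      have "(\<lambda>x. (z + of_real (b j x)) * v j x + of_real (a j x) * w j x) \<in> L2"
        by (intro L2_add L2_mult_continuous vL wL j continuous_on_add continuous_on_const continuous_on_of_real a_cont b_cont)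
      then show ?thesis by (simp add: fe[abs_def] algebra_simps)
    qed
    have rep: "c j x = mode z j x * (c j (out_pt j) + source_integral z j (f j) x)"
      if j: "j \<in> {1..n}" and x: "x \<in> {0..1}" for j x
    proof (rule variation_of_constants[OF j wL[OF j] _ fL[OF j] _ x])
      have "AE x in M01. c j x = v j x" using vc[OF j] by eventually_elim simp
      then have "has_weak_deriv (c j) (w j)"
        by (rule has_weak_deriv_cong_AE[OF wd[OF j] _ measurable_M01_continuous[OF cc[OF j]] L2D(1)[OF vL[OF j]]])
      then show "c j y = c j 0 + integral {0..y} (w j)" if "y \<in> {0..1}" for y
        by (rule weak_deriv_fundamental_theorem[OF cc[OF j] wL[OF j] _ that])
      show "AE x in M01. z * c j x + of_real (a j x) * w j x + of_real (b j x) * c j x = f j x"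
        using vc[OF j] by eventually_elim (simp add: fe)
    qed
    have sb: "norm (source_integral z j (f j) x) \<le> C * N" if "j \<in> {1..n}" "x \<in> {0..1}" for j x
    proof -
      have "norm (source_integral z j (f j) x) \<le> C * L2_norm (f j)"
        by (rule C(2)[rule_format, OF that(1) fL[OF that(1)] that(2)])
      also have "\<dots> \<le> C * N"
        unfolding N_def using C(1) L2_norm_le_L2_vec_norm[OF that(1)] by (intro mult_left_mono) auto
      finally show ?thesis .
    qed
    have lin: "(\<Sum>k=1..n. char z j k * c k (out_pt k)) = S f j" if j: "j \<in> {1..n}" for j
    proof -
      have "c j (out_pt j) = (\<Sum>k=1..n. of_real (p j k) * (mode z k (in_pt k) * (c k (out_pt k) + source_integral z k (f k) (in_pt k))))"
        unfolding bc[OF j, unfolded v_out_eq v_in_eq]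
      proof (rule sum.cong[OF refl])
        fix k assume k: "k \<in> {1..n}"
        show "of_real (p j k) * c k (in_pt k) =
            of_real (p j k) * (mode z k (in_pt k) * (c k (out_pt k) + source_integral z k (f k) (in_pt k)))"
          by (simp only: rep[OF k pts_in(2)])
      qed
      also have "\<dots> = (\<Sum>k=1..n. of_real (p j k) * mode z k (in_pt k) * c k (out_pt k)) + S f j"
        by (simp add: S_def sum.distrib algebra_simps)
      finally show ?thesis unfolding char_sum[OF j] by simp
    qed
    have ob: "norm (c j (out_pt j)) \<le> G * (C * N)" if j: "j \<in> {1..n}" for j
    proof -
      have "c j (out_pt j) = (\<Sum>k=1..n. B j k * (\<Sum>l=1..n. char z k l * c l (out_pt l)))"
        by (rule boundary_sum[OF j BA, symmetric])
      also have "\<dots> = (\<Sum>k=1..n. B j k * S f k)"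
        by (rule sum.cong[OF refl]) (simp only: lin)
      also have "norm \<dots> \<le> (\<Sum>k=1..n. norm (B j k) * (Q k * (C * N)))"
      proof (rule sum_norm_le)
        fix k assume "k \<in> {1..n}"
        have "norm (S f k) \<le> (\<Sum>l=1..n. norm (of_real (p k l) * mode z l (in_pt l)) * (C * N))"
          unfolding S_def
        proof (rule sum_norm_le)
          fix l assume l: "l \<in> {1..n}"
          show "norm (of_real (p k l) * mode z l (in_pt l) * source_integral z l (f l) (in_pt l)) \<le>
              norm (of_real (p k l) * mode z l (in_pt l)) * (C * N)"
            unfolding norm_mult[of "of_real (p k l) * mode z l (in_pt l)"]
            by (rule mult_left_mono[OF sb[OF l pts_in(2)]]) simp
        qed
        then show "norm (B j k * S f k) \<le> norm (B j k) * (Q k * (C * N))"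
          unfolding norm_mult[of "B j k"] Q_def sum_distrib_right[symmetric]
            by (rule mult_left_mono) simp
      qed
      also have "\<dots> = (\<Sum>k=1..n. norm (B j k) * Q k) * (C * N)"
        by (simp add: sum_distrib_right mult.assoc)
      also have "\<dots> \<le> G * (C * N)"
      proof (rule mult_right_mono)
        show "(\<Sum>k=1..n. norm (B j k) * Q k) \<le> G"
          unfolding G_def Q_def
            by (rule member_le_sum[OF j]) (auto intro!: sum_nonneg mult_nonneg_nonneg)
        show "0 \<le> C * N" using C(1) N0 by simp
      qed
      finally show ?thesis .
    qed
    have "L2_vec_norm n v \<le> K * (G * (C * N) + C * N)"
    proof (rule L2_vec_norm_le[OF n])
      fix j assume j: "j \<in> {1..n}"
      show "L2_norm (v j) \<le> K * (G * (C * N) + C * N)"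
      proof (rule L2_norm_le_bound[OF vL[OF j] vc[OF j]])
        fix x :: real assume x: "x \<in> {0..1}"
        have "norm (c j (out_pt j) + source_integral z j (f j) x) \<le> G * (C * N) + C * N"
          using norm_triangle_ineq[of "c j (out_pt j)" "source_integral z j (f j) x"] ob[OF j] sb[OF j x]
            by linarith
        then show "norm (c j x) \<le> K * (G * (C * N) + C * N)"
          unfolding rep[OF j x] norm_mult using K(1)
            by (intro mult_mono K(2)[rule_format, OF j x]) auto
      qed (use K(1) C(1) N0 \<open>G \<ge> 0\<close> in simp)
    qed
    then show ?thesis by (simp add: N_def f_def algebra_simps)
  qed
  have inj: "ae_eq n v (\<lambda>j x. 0)"
    if v: "v \<in> A_domain n m p" and zero: "ae_eq n (\<lambda>j x. z * v j x - A_op a b v j x) (\<lambda>j x. 0)"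
      for v
  proof -
    have "L2_vec_norm n (\<lambda>j x. z * v j x - A_op a b v j x) \<le> 0"
    proof (rule L2_vec_norm_le[OF n])
      fix j assume j: "j \<in> {1..n}"
      have "AE x in M01. (norm (z * v j x - A_op a b v j x))\<^sup>2 = 0"
        using zero j unfolding ae_eq_def by (auto elim: eventually_mono)
      then have "L2_sq (\<lambda>x. z * v j x - A_op a b v j x) = 0"
        unfolding L2_sq_def by (rule integral_eq_zero_AE)
      then show "L2_norm (\<lambda>x. z * v j x - A_op a b v j x) \<le> 0" by (simp add: L2_norm_eq_sqrt)
    qed
    moreover have "K * (G * C + C) \<ge> 0" using K(1) C(1) \<open>G \<ge> 0\<close> by simp
    ultimately have vn: "L2_vec_norm n v \<le> 0"
      using bound[OF v] by (meson mult_nonneg_nonpos order_trans)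
    have "v \<in> L2_vec n" using v unfolding A_domain_def by blast
    then show ?thesis using vn by (rule L2_vec_norm_le_0_iff)
  qed
  have surj: "\<exists>v\<in>A_domain n m p. ae_eq n (\<lambda>j x. z * v j x - A_op a b v j x) f" if "f \<in> L2_vec n"
    for f
  proof -
    have fL: "f j \<in> L2" if "j \<in> {1..n}" for j using \<open>f \<in> L2_vec n\<close> that by (simp add: L2_vec_def)
    define k where "k j = (\<Sum>l=1..n. B j l * S f l)" for j
    define v where "v j x = mode z j x * (k j + source_integral z j (f j) x)" for j x
    define w where "w j x = f j x / of_real (a j x) - growth z j x * v j x" for j x
    have cv: "continuous_on {0..1} (v j)" and wL: "w j \<in> L2"
      and prim: "\<And>x. x \<in> {0..1} \<Longrightarrow> v j x = v j 0 + integral {0..x} (w j)" if j: "j \<in> {1..n}" for j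
      using variation_of_constants_solution[OF j fL[OF j], where z = z and k = "k j"]
        unfolding v_def[abs_def] w_def[abs_def] by blast+
    have bc: "v j (out_pt j) = (\<Sum>l=1..n. of_real (p j l) * v l (in_pt l))" if j: "j \<in> {1..n}" for j
    proof -
      have "(\<Sum>l=1..n. char z j l * k l) = S f j"
        unfolding k_def by (rule boundary_sum[OF j AB])
      then have "k j = (\<Sum>l=1..n. of_real (p j l) * mode z l (in_pt l) * k l) + S f j"
        unfolding char_sum[OF j] by (simp add: algebra_simps)
      also have "\<dots> = (\<Sum>l=1..n. of_real (p j l) * v l (in_pt l))"
        by (simp add: v_def S_def sum.distrib algebra_simps)
      finally show ?thesis using j by (simp add: v_def mode_out source_integral_def)
    qed
    have eq: "of_real (a j s) * w j s = f j s - (z + of_real (b j s)) * v j s"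
      if "j \<in> {1..n}" "s \<in> {0..1}" for j s
      using a_nonzero[OF that] by (simp add: w_def growth_def right_diff_distrib)
    show ?thesis using A_domainI[of v w f, OF cv wL prim bc eq] by blast
  qed
  show ?thesis unfolding resolvent_set_def using inj surj bound by blast
qed

theorem spectrum_empty_iff:
  "op_spectrum n (A_domain n m p) (A_op a b) = {} \<longleftrightarrow> (\<forall>z. fdet n (char z) \<noteq> 0)"
  using char_zero_in_spectrum char_nonzero_in_resolvent unfolding op_spectrum_def by blast

end


section \<open>The energy estimate\<close>

lemma C1_with_partials:
  assumes C: "C1_with f fx ft" and x: "x \<in> {0..1}" and t: "0 \<le> t"
  shows "((\<lambda>s. f (x, s)) has_real_derivative ft (x, t)) (at t within {0..})"
    and "((\<lambda>y. f (y, t)) has_real_derivative fx (x, t)) (at x within {0..1})"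
proof -
  have z: "(x, t) \<in> Pi_strip" using x t by (simp add: Pi_strip_def)
  have d: "(f has_derivative (\<lambda>h. fx (x, t) * fst h + ft (x, t) * snd h)) (at (x, t) within Pi_strip)"
    using C z unfolding C1_with_def by blast
  have "((\<lambda>s. f (x, s)) has_derivative (\<lambda>h. fx (x, t) * fst (0::real, h) + ft (x, t) * snd (0::real, h))) (at t within {0..})"
  proof (rule has_derivative_in_compose[where g = f and f = "\<lambda>s. (x, s)" and s = "{0..}"])
    show "(Pair x has_derivative (\<lambda>h. (0, h))) (at t within {0..})"
      by (intro has_derivative_Pair has_derivative_const has_derivative_ident)
    show "(f has_derivative (\<lambda>h. fx (x, t) * fst h + ft (x, t) * snd h)) (at (x, t) within Pair x ` {0..})"
      by (rule has_derivative_subset[OF d]) (use x in \<open>auto simp: Pi_strip_def\<close>)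
  qed
  then show "((\<lambda>s. f (x, s)) has_real_derivative ft (x, t)) (at t within {0..})"
    by (simp add: has_field_derivative_def)
  have "((\<lambda>y. f (y, t)) has_derivative (\<lambda>h. fx (x, t) * fst (h, 0::real) + ft (x, t) * snd (h, 0::real))) (at x within {0..1})"
  proof (rule has_derivative_in_compose[where g = f and f = "\<lambda>y. (y, t)" and s = "{0..1}"])
    show "((\<lambda>y. (y, t)) has_derivative (\<lambda>h. (h, 0))) (at x within {0..1})"
      by (intro has_derivative_Pair has_derivative_const has_derivative_ident)
    show "(f has_derivative (\<lambda>h. fx (x, t) * fst h + ft (x, t) * snd h)) (at (x, t) within (\<lambda>y. (y, t)) ` {0..1})"
      by (rule has_derivative_subset[OF d]) (use t in \<open>auto simp: Pi_strip_def\<close>)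
  qed
  then show "((\<lambda>y. f (y, t)) has_real_derivative fx (x, t)) (at x within {0..1})"
    by (simp add: has_field_derivative_def)
qed

lemma C1_with_deriv:
  assumes "C1_with f fx ft" "0 < x" "x < 1" "0 < t"
  shows "deriv (\<lambda>s. f (x, s)) t = ft (x, t)" "deriv (\<lambda>y. f (y, t)) x = fx (x, t)"
proof -
  have "at x within {0..1} = at x" "at t within {0..} = at t"
    using assms by (auto intro!: at_within_interior simp: interior_real_atLeast)
  then show "deriv (\<lambda>s. f (x, s)) t = ft (x, t)" "deriv (\<lambda>y. f (y, t)) x = fx (x, t)"
    using C1_with_partials[OF assms(1), of x t] assms by (auto intro!: DERIV_imp_deriv)
qed

lemma C1_with_continuous: "C1_with f fx ft \<Longrightarrow> continuous_on Pi_strip f"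
  unfolding C1_with_def continuous_on_eq_continuous_within using has_derivative_continuous by blast

lemma C1_with_diff:
  assumes "C1_with f fx ft" "C1_with g gx gt"
  shows "C1_with (\<lambda>z. f z - g z) (\<lambda>z. fx z - gx z) (\<lambda>z. ft z - gt z)"
  unfolding C1_with_def
proof (intro conjI ballI)
  show "continuous_on Pi_strip (\<lambda>z. fx z - gx z)" "continuous_on Pi_strip (\<lambda>z. ft z - gt z)"
    using assms unfolding C1_with_def by (auto intro: continuous_on_diff)
  fix z assume z: "z \<in> Pi_strip"
  have "((\<lambda>z. f z - g z) has_derivative (\<lambda>h. (fx z * fst h + ft z * snd h) - (gx z * fst h + gt z * snd h))) (at z within Pi_strip)"
    using assms z unfolding C1_with_def by (intro has_derivative_diff) blast+
  then show "((\<lambda>z. f z - g z) has_derivative (\<lambda>h. (fx z - gx z) * fst h + (ft z - gt z) * snd h)) (at z within Pi_strip)"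
    by (rule has_derivative_eq_rhs) (simp add: fun_eq_iff algebra_simps)
qed

lemma strip_slice_continuous:
  assumes "continuous_on Pi_strip u" "0 \<le> t"
  shows "continuous_on {0..1} (\<lambda>x. u (x, t))"
  by (rule continuous_on_compose2[OF assms(1)]) (use assms(2) in \<open>auto simp: Pi_strip_def intro!: continuous_intros\<close>)

lemma L2_sq_continuous_eq:
  fixes f :: "real \<Rightarrow> real"
  assumes "continuous_on {0..1} f"
  shows "L2_sq f = integral {0..1} (\<lambda>x. (f x)\<^sup>2)"
proof -
  have "integrable M01 (\<lambda>x. (f x)\<^sup>2)" using L2D(2)[OF L2_continuous[OF assms]] by simp
  from M01_integral_eq[OF this] show ?thesis by (simp add: L2_sq_def)
qed

context hyperbolic_system
begin

text \<open>
  Classical solutions with their partial derivatives made explicit, which makes the notion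
  visibly linear.
\<close>

definition strong_solution ::
  "(nat \<Rightarrow> real \<Rightarrow> real) \<Rightarrow> (nat \<Rightarrow> real \<times> real \<Rightarrow> real) \<Rightarrow> (nat \<Rightarrow> real \<times> real \<Rightarrow> real) \<Rightarrow>
   (nat \<Rightarrow> real \<times> real \<Rightarrow> real) \<Rightarrow> bool"
  where "strong_solution \<phi> u ux ut \<longleftrightarrow>
    (\<forall>j\<in>{1..n}. C1_with (u j) (ux j) (ut j) \<and>
      (\<forall>x t. 0 < x \<and> x < 1 \<and> 0 < t \<longrightarrow>
        ut j (x, t) + a j x * ux j (x, t) + b j x * u j (x, t) = 0) \<and>
      (\<forall>t\<ge>0. u j (out_pt j, t) = (\<Sum>k=1..n. p j k * u k (in_pt k, t))) \<and>
      (\<forall>x\<in>{0..1}. u j (x, 0) = \<phi> j x))"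

lemma sum_split_in_pt: "(\<Sum>k=1..n. f k (in_pt k)) = (\<Sum>k=1..m. f k (1::real)) + (\<Sum>k=m+1..n. f k (0::real))"
proof -
  have "(\<Sum>k=1..n. f k (in_pt k)) = (\<Sum>k=1..m. f k (in_pt k)) + (\<Sum>k=m+1..n. f k (in_pt k))"
    by (subst sum.union_disjoint[symmetric]) (use m in \<open>auto intro!: sum.cong\<close>)
  then show ?thesis by (simp add: in_pt_def)
qed

abbreviation "classical \<equiv> classical_solution n m p (\<lambda>j (x, t). a j x) (\<lambda>j (x, t). b j x)"

lemma boundary_condition_iff:
  "(\<forall>j\<in>{1..n}. \<forall>t\<ge>0. u j (out_pt j, t) = (\<Sum>k=1..n. p j k * u k (in_pt k, t))) \<longleftrightarrow>
    (\<forall>j\<in>{1..m}. \<forall>t\<ge>0.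
       u j (0, t) = (\<Sum>k=1..m. p j k * u k (1, t)) + (\<Sum>k=m+1..n. p j k * u k (0, t))) \<and>
    (\<forall>j\<in>{m+1..n}. \<forall>t\<ge>0.
       u j (1, t) = (\<Sum>k=1..m. p j k * u k (1, t)) + (\<Sum>k=m+1..n. p j k * u k (0, t)))"
proof -
  have s: "{1..n} = {1..m} \<union> {m+1..n}" using m by auto
  have o: "\<forall>j\<in>{1..m}. out_pt j = 0" "\<forall>j\<in>{m+1..n}. out_pt j = 1" by (simp_all add: out_pt_def)
  have e: "(\<Sum>k=1..n. p j k * u k (in_pt k, t)) =
      (\<Sum>k=1..m. p j k * u k (1, t)) + (\<Sum>k=m+1..n. p j k * u k (0, t))" for j t
    by (rule sum_split_in_pt[where f = "\<lambda>k x. p j k * u k (x, t)"])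
  show ?thesis unfolding e unfolding s ball_Un using o by simp
qed

lemma classical_iff_strong:
  "classical \<phi> u \<longleftrightarrow> (\<exists>ux ut. strong_solution \<phi> u ux ut)"
proof
  assume cl: "classical \<phi> u"
  then have "\<forall>j. \<exists>ux ut. j \<in> {1..n} \<longrightarrow> C1_with (u j) ux ut"
    unfolding classical_solution_def C1_def by blast
  then obtain ux ut where C: "\<And>j. j \<in> {1..n} \<Longrightarrow> C1_with (u j) (ux j) (ut j)"
    unfolding choice_iff by blast
  have "ut j (x, t) + a j x * ux j (x, t) + b j x * u j (x, t) = 0"
    if "j \<in> {1..n}" "0 < x" "x < 1" "0 < t" for j x t
  proof -
    have "deriv (\<lambda>s. u j (x, s)) t + a j x * deriv (\<lambda>y. u j (y, t)) x + b j x * u j (x, t) = 0"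
      using cl that unfolding classical_solution_def by simp
    then show ?thesis unfolding C1_with_deriv[OF C[OF that(1)] that(2-4)] .
  qed
  moreover have "\<forall>j\<in>{1..n}. \<forall>t\<ge>0. u j (out_pt j, t) = (\<Sum>k=1..n. p j k * u k (in_pt k, t))"
    unfolding boundary_condition_iff using cl unfolding classical_solution_def by blast
  moreover have "\<forall>j\<in>{1..n}. \<forall>x\<in>{0..1}. u j (x, 0) = \<phi> j x"
    using cl unfolding classical_solution_def by blast
  ultimately have "strong_solution \<phi> u ux ut" using C by (simp add: strong_solution_def)
  then show "\<exists>ux ut. strong_solution \<phi> u ux ut" by blast
next
  assume "\<exists>ux ut. strong_solution \<phi> u ux ut"
  then obtain ux ut where S: "strong_solution \<phi> u ux ut" by blast
  then have C: "C1_with (u j) (ux j) (ut j)" if "j \<in> {1..n}" for j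
    using that unfolding strong_solution_def by blast
  have "deriv (\<lambda>s. u j (x, s)) t + a j x * deriv (\<lambda>y. u j (y, t)) x + b j x * u j (x, t) = 0"
    if "j \<in> {1..n}" "0 < x" "x < 1" "0 < t" for j x t
    using S that unfolding C1_with_deriv[OF C[OF that(1)] that(2-4)] strong_solution_def by blast
  moreover have "\<forall>j\<in>{1..n}. \<forall>t\<ge>0. u j (out_pt j, t) = (\<Sum>k=1..n. p j k * u k (in_pt k, t))"
    using S unfolding strong_solution_def by blast
  moreover have "\<forall>j\<in>{1..n}. \<forall>x\<in>{0..1}. u j (x, 0) = \<phi> j x"
    using S unfolding strong_solution_def by blast
  moreover have "\<forall>j\<in>{1..n}. C1 (u j)" using C unfolding C1_def by blast
  ultimately show "classical \<phi> u"
    unfolding classical_solution_def boundary_condition_iff by simp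
qed

lemma strong_solution_diff:
  assumes "strong_solution \<phi> u ux ut" "strong_solution \<psi> v vx vt"
  shows "strong_solution (\<lambda>j x. \<phi> j x - \<psi> j x) (\<lambda>j z. u j z - v j z) (\<lambda>j z. ux j z - vx j z) (\<lambda>j z. ut j z - vt j z)"
  unfolding strong_solution_def
proof (intro ballI conjI allI impI)
  fix j assume j: "j \<in> {1..n}"
  show "C1_with (\<lambda>z. u j z - v j z) (\<lambda>z. ux j z - vx j z) (\<lambda>z. ut j z - vt j z)"
    using assms j unfolding strong_solution_def by (intro C1_with_diff) blast+
  show "u j (x, 0) - v j (x, 0) = \<phi> j x - \<psi> j x" if "x \<in> {0..1}" for x
    using assms j that unfolding strong_solution_def by simp
  show "u j (out_pt j, t) - v j (out_pt j, t) = (\<Sum>k=1..n. p j k * (u k (in_pt k, t) - v k (in_pt k, t)))"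
    if "0 \<le> t" for t
    using assms j that unfolding strong_solution_def by (simp add: right_diff_distrib sum_subtractf)
  fix x t :: real assume "0 < x \<and> x < 1 \<and> 0 < t"
  then have "ut j (x, t) + a j x * ux j (x, t) + b j x * u j (x, t) = 0"
    "vt j (x, t) + a j x * vx j (x, t) + b j x * v j (x, t) = 0"
    using assms j unfolding strong_solution_def by blast+
  then show "ut j (x, t) - vt j (x, t) + a j x * (ux j (x, t) - vx j (x, t)) + b j x * (u j (x, t) - v j (x, t)) = 0"
    by (simp add: algebra_simps)
qed

definition in_gain :: real
  where "in_gain = 1 + (\<Sum>j=1..n. \<Sum>k=1..n. (p j k)\<^sup>2)"

text \<open>
  The energy density is \<open>weight j * u\<^sub>j\<^sup>2\<close>. The product \<open>flux j\<close> of weight and speed is chosen affine, with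
  absolute value \<open>1\<close> at the entrance and \<open>in_gain\<close> at the exit: then the energy that
  leaves at the exits dominates what the boundary conditions feed back at the entrances
  (\<open>boundary_dissipation\<close>). The derivative of the flux is the constant \<open>in_gain - 1\<close>.
\<close>

definition flux :: "nat \<Rightarrow> real \<Rightarrow> real"
  where "flux j x = (in_gain - 1) * x + (if j \<le> m then 1 else - in_gain)"

definition weight :: "nat \<Rightarrow> real \<Rightarrow> real"
  where "weight j x = flux j x / a j x"

lemma in_gain_ge: "1 \<le> in_gain"
  by (simp add: in_gain_def sum_nonneg)

lemma weight_pos:
  assumes j: "j \<in> {1..n}" and x: "x \<in> {0..1}"
  shows "0 < weight j x"
proof (cases "j \<le> m")
  case True
  have "0 \<le> (in_gain - 1) * x" using in_gain_ge x by simp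
  moreover have "0 < a j x" using a_pos[of j x] True j x alpha by simp
  ultimately show ?thesis using True by (simp add: weight_def flux_def)
next
  case False
  have "(in_gain - 1) * x \<le> (in_gain - 1) * 1" using in_gain_ge x by (intro mult_left_mono) auto
  then have "flux j x < 0" using False by (simp add: flux_def)
  moreover have "a j x < 0" using a_neg[of j x] False j x alpha by simp
  ultimately show ?thesis by (simp add: weight_def divide_neg_neg)
qed

lemma weight_continuous: "j \<in> {1..n} \<Longrightarrow> continuous_on {0..1} (weight j)"
  unfolding weight_def flux_def by (rule quotient_a_continuous) (auto intro!: continuous_intros)

lemma flux_ends:
  "flux j 1 * v 1 - flux j 0 * v 0 = in_gain * v (in_pt j) - v (out_pt j :: real)"
  by (auto simp: flux_def in_pt_def out_pt_def algebra_simps)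

lemma boundary_dissipation:
  assumes "\<And>j. j \<in> {1..n} \<Longrightarrow> y j = (\<Sum>k=1..n. p j k * x k)"
  shows "(\<Sum>j=1..n. (y j)\<^sup>2) \<le> in_gain * (\<Sum>k=1..n. (x k)\<^sup>2)"
proof -
  have "(\<Sum>j=1..n. (y j)\<^sup>2) \<le> (\<Sum>j=1..n. (\<Sum>k=1..n. (p j k)\<^sup>2) * (\<Sum>k=1..n. (x k)\<^sup>2))"
    by (rule sum_mono) (simp only: assms Cauchy_Schwarz_ineq_sum)
  also have "\<dots> = (in_gain - 1) * (\<Sum>k=1..n. (x k)\<^sup>2)"
    by (simp add: in_gain_def sum_distrib_right)
  also have "\<dots> \<le> in_gain * (\<Sum>k=1..n. (x k)\<^sup>2)"
    by (intro mult_right_mono sum_nonneg) auto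
  finally show ?thesis .
qed

text \<open>
  Differentiate under the integral, replace the time derivative by the differential
  equation and integrate \<open>flux j * 2 u \<partial>\<^sub>x u\<close> by parts.
\<close>

lemma component_energy_deriv:
  assumes j: "j \<in> {1..n}" and C: "C1_with u ux ut" and t: "0 < t"
    and pde: "\<And>x. 0 < x \<Longrightarrow> x < 1 \<Longrightarrow> ut (x, t) + a j x * ux (x, t) + b j x * u (x, t) = 0"
  shows "((\<lambda>t. integral {0..1} (\<lambda>x. weight j x * (u (x, t))\<^sup>2)) has_real_derivative
    ((u (out_pt j, t))\<^sup>2 - in_gain * (u (in_pt j, t))\<^sup>2 +
      integral {0..1} (\<lambda>x. (in_gain - 1 - 2 * weight j x * b j x) * (u (x, t))\<^sup>2))) (at t within {0..})"
proof -
  have cu: "continuous_on Pi_strip u" by (rule C1_with_continuous[OF C])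
  have cut: "continuous_on Pi_strip ut" and cux: "continuous_on Pi_strip ux" using C
    unfolding C1_with_def by blast+
  have wc: "continuous_on {0..1} (weight j)" by (rule weight_continuous[OF j])
  have sw: "continuous_on ({0..} \<times> {0..1}) (\<lambda>(t, x). h (x, t))" if "continuous_on Pi_strip h"
    for h :: "real \<times> real \<Rightarrow> real"
    unfolding split_beta
      by (rule continuous_on_compose2[OF that]) (auto simp: Pi_strip_def intro!: continuous_intros)
  have "((\<lambda>t. integral (cbox 0 1) (\<lambda>x. weight j x * (u (x, t))\<^sup>2)) has_real_derivative
      integral (cbox 0 1) (\<lambda>x. weight j x * (2 * u (x, t) * ut (x, t)))) (at t within {0..})"
  proof (rule leibniz_rule_field_derivative)
    fix s x :: real assume s: "s \<in> {0..}" and x: "x \<in> cbox 0 1"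
    have "((\<lambda>s. u (x, s)) has_real_derivative ut (x, s)) (at s within {0..})"
      by (rule C1_with_partials(1)[OF C]) (use s x in auto)
    from DERIV_cmult[OF DERIV_power[OF this, of 2], of "weight j x"]
    show "((\<lambda>s. weight j x * (u (x, s))\<^sup>2) has_real_derivative weight j x * (2 * u (x, s) * ut (x, s))) (at s within {0..})"
      by (simp add: mult_ac)
  next
    fix s :: real assume "s \<in> {0..}"
    then have "continuous_on {0..1} (\<lambda>x. u (x, s))" by (intro strip_slice_continuous[OF cu]) simp
    then show "(\<lambda>x. weight j x * (u (x, s))\<^sup>2) integrable_on cbox 0 1"
      unfolding box_real
        by (intro integrable_continuous_real continuous_on_mult wc continuous_on_power)
  next
    have "continuous_on ({0..} \<times> {0..1}) (\<lambda>(s::real, x). weight j x)"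
      unfolding split_beta by (rule continuous_on_compose2[OF wc]) (auto intro!: continuous_intros)
    then have "continuous_on ({0..} \<times> {0..1}) (\<lambda>z. (case z of (s::real, x) \<Rightarrow> weight j x) *
        (2 * (case z of (s, x) \<Rightarrow> u (x, s)) * (case z of (s, x) \<Rightarrow> ut (x, s))))"
      by (intro continuous_on_mult continuous_on_const sw cu cut)
    then show "continuous_on ({0..} \<times> cbox 0 1) (\<lambda>(s, x). weight j x * (2 * u (x, s) * ut (x, s)))"
      by (simp add: split_beta)
  qed (use t in auto)
  moreover have "integral {0..1} (\<lambda>x. weight j x * (2 * u (x, t) * ut (x, t))) =
      (u (out_pt j, t))\<^sup>2 - in_gain * (u (in_pt j, t))\<^sup>2 +
      integral {0..1} (\<lambda>x. (in_gain - 1 - 2 * weight j x * b j x) * (u (x, t))\<^sup>2)"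
  proof -
    have t0: "0 \<le> t" using t by simp
    note c1 = strip_slice_continuous[OF cu t0] and c2 = strip_slice_continuous[OF cux t0]
    define q where "q x = (in_gain - 1) * (u (x, t))\<^sup>2 + flux j x * (2 * u (x, t) * ux (x, t))"
      for x
    have fc: "continuous_on {0..1} (flux j)" unfolding flux_def by (intro continuous_intros)
    have qc: "continuous_on {0..1} q" unfolding q_def
      by (intro continuous_on_add continuous_on_mult continuous_on_const continuous_on_power c1 c2 fc)
    have "(q has_integral flux j 1 * (u (1, t))\<^sup>2 - flux j 0 * (u (0, t))\<^sup>2) {0..1}"
    proof (rule fundamental_theorem_of_calculus)
      fix x :: real assume x: "x \<in> {0..1}"
      have f: "(flux j has_real_derivative in_gain - 1) (at x within {0..1})"
        unfolding flux_def by (auto intro!: derivative_eq_intros)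
      have "((\<lambda>y. u (y, t)) has_real_derivative ux (x, t)) (at x within {0..1})"
        by (rule C1_with_partials(2)[OF C x t0])
      from DERIV_mult[OF f DERIV_power[OF this, of 2]]
      have "((\<lambda>x. flux j x * (u (x, t))\<^sup>2) has_real_derivative q x) (at x within {0..1})"
        by (rule DERIV_cong) (simp add: q_def)
      then show "((\<lambda>x. flux j x * (u (x, t))\<^sup>2) has_vector_derivative q x) (at x within {0..1})"
        by (simp add: has_real_derivative_iff_has_vector_derivative)
    qed simp
    then have bd: "integral {0..1} q = in_gain * (u (in_pt j, t))\<^sup>2 - (u (out_pt j, t))\<^sup>2"
      using flux_ends[of j "\<lambda>x. (u (x, t))\<^sup>2"] by (simp add: integral_unique)
    define r where "r x = (in_gain - 1 - 2 * weight j x * b j x) * (u (x, t))\<^sup>2" for x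
    have rc: "continuous_on {0..1} r" unfolding r_def
      by (intro continuous_on_mult continuous_on_diff continuous_on_const continuous_on_power c1 wc b_cont j)
    have "integral {0..1} (\<lambda>x. weight j x * (2 * u (x, t) * ut (x, t))) = integral {0..1} (\<lambda>x. r x - q x)"
    \<comment> \<open>the differential equation is only available in the interior\<close>
    proof (rule integral_spike[of "{0, 1}"])
      fix x :: real assume x: "x \<in> {0..1} - {0, 1}"
      then have u: "ut (x, t) = - a j x * ux (x, t) - b j x * u (x, t)" using pde[of x] by simp
      have "weight j x * a j x = flux j x" using a_nonzero[OF j, of x] x by (simp add: weight_def)
      then show "r x - q x = weight j x * (2 * u (x, t) * ut (x, t))"
        unfolding u r_def q_def by (simp add: algebra_simps power2_eq_square)
    qed simp
    also have "\<dots> = integral {0..1} r - integral {0..1} q"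
      by (intro Henstock_Kurzweil_Integration.integral_diff integrable_continuous_real qc rc)
    finally show ?thesis unfolding bd r_def by simp
  qed
  ultimately show ?thesis by simp
qed

lemma weight_bounds:
  obtains K where "K > 0" "\<forall>j\<in>{1..n}. \<forall>x\<in>{0..1}. weight j x \<le> K"
    "\<forall>j\<in>{1..n}. \<forall>x\<in>{0..1}. 1 \<le> K * weight j x"
    "\<forall>j\<in>{1..n}. \<forall>x\<in>{0..1}. in_gain - 1 - 2 * weight j x * b j x \<le> K * weight j x"
proof -
  let ?g = "\<lambda>j x. \<bar>weight j x\<bar> + \<bar>1 / weight j x\<bar> + \<bar>(in_gain - 1 - 2 * weight j x * b j x) / weight j x\<bar>"
  have "continuous_on {0..1} (?g j)" if "j \<in> {1..n}" for j
  proof -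
    have nz: "\<forall>x\<in>{0..1}. weight j x \<noteq> 0" using weight_pos[OF that] by force
    show ?thesis
      by (intro continuous_on_add continuous_on_rabs continuous_on_divide continuous_on_diff
          continuous_on_mult continuous_on_const weight_continuous b_cont that nz)
  qed
  then obtain K where K: "K > 0" "\<forall>j\<in>{1..n}. \<forall>x\<in>{0..1}. norm (?g j x) \<le> K"
    by (rule finite_family_bounded[of n ?g])
  have "weight j x \<le> K \<and> 1 \<le> K * weight j x \<and> in_gain - 1 - 2 * weight j x * b j x \<le> K * weight j x"
    if jx: "j \<in> {1..n}" "x \<in> {0..1}" for j x
  proof -
    have "norm (?g j x) \<le> K" using K(2) jx by blast
    then have "weight j x \<le> K" "1 / weight j x \<le> K" "(in_gain - 1 - 2 * weight j x * b j x) / weight j x \<le> K"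
      unfolding real_norm_def by linarith+
    then show ?thesis using weight_pos[OF jx] by (simp add: pos_divide_le_eq)
  qed
  then show ?thesis using that[OF K(1)] by blast
qed

definition energy :: "(nat \<Rightarrow> real \<times> real \<Rightarrow> real) \<Rightarrow> real \<Rightarrow> real"
  where "energy u t = (\<Sum>j=1..n. integral {0..1} (\<lambda>x. weight j x * (u j (x, t))\<^sup>2))"

text \<open>
  Gronwall: the boundary terms have the favourable sign, so the energy multiplied by
  \<open>exp (- K t)\<close> is decreasing.
\<close>

lemma energy_growth:
  assumes S: "strong_solution \<phi> u ux ut" and t: "0 \<le> t"
    and K: "\<forall>j\<in>{1..n}. \<forall>x\<in>{0..1}. in_gain - 1 - 2 * weight j x * b j x \<le> K * weight j x"
  shows "energy u t \<le> exp (K * t) * energy u 0"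
proof -
  have C: "C1_with (u j) (ux j) (ut j)" if "j \<in> {1..n}" for j
    using S that unfolding strong_solution_def by blast
  define D where "D j t = (u j (out_pt j, t))\<^sup>2 - in_gain * (u j (in_pt j, t))\<^sup>2 +
      integral {0..1} (\<lambda>x. (in_gain - 1 - 2 * weight j x * b j x) * (u j (x, t))\<^sup>2)" for j t
  have der: "(energy u has_real_derivative (\<Sum>j=1..n. D j s)) (at s within {0..})" if s: "0 < s"
    for s
    unfolding energy_def D_def
  proof (rule DERIV_sum)
    fix j assume j: "j \<in> {1..n}"
    show "((\<lambda>t. integral {0..1} (\<lambda>x. weight j x * (u j (x, t))\<^sup>2)) has_real_derivative
      ((u j (out_pt j, s))\<^sup>2 - in_gain * (u j (in_pt j, s))\<^sup>2 +
      integral {0..1} (\<lambda>x. (in_gain - 1 - 2 * weight j x * b j x) * (u j (x, s))\<^sup>2))) (at s within {0..})"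
    proof (rule component_energy_deriv[OF j C[OF j] s])
      show "ut j (x, s) + a j x * ux j (x, s) + b j x * u j (x, s) = 0" if "0 < x" "x < 1" for x
        using S j that s unfolding strong_solution_def by blast
    qed
  qed
  have ci: "continuous_on {0..1} (\<lambda>x. u j (x, s))" if "j \<in> {1..n}" "0 \<le> s" for j s
    by (rule strip_slice_continuous[OF C1_with_continuous[OF C[OF that(1)]] that(2)])
  have le: "(\<Sum>j=1..n. D j s) \<le> K * energy u s" if s: "0 < s" for s
  proof -
    have "(\<Sum>j=1..n. (u j (out_pt j, s))\<^sup>2) \<le> in_gain * (\<Sum>k=1..n. (u k (in_pt k, s))\<^sup>2)"
      by (rule boundary_dissipation) (use S s in \<open>simp add: strong_solution_def\<close>)
    then have "(\<Sum>j=1..n. D j s) \<le> (\<Sum>j=1..n. integral {0..1} (\<lambda>x. (in_gain - 1 - 2 * weight j x * b j x) * (u j (x, s))\<^sup>2))"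
      by (simp add: D_def sum.distrib sum_subtractf sum_distrib_left)
    also have "\<dots> \<le> (\<Sum>j=1..n. integral {0..1} (\<lambda>x. K * (weight j x * (u j (x, s))\<^sup>2)))"
    proof (rule sum_mono)
      fix j assume j: "j \<in> {1..n}"
      note c = ci[OF j, of s] and w = weight_continuous[OF j]
      show "integral {0..1} (\<lambda>x. (in_gain - 1 - 2 * weight j x * b j x) * (u j (x, s))\<^sup>2) \<le>
          integral {0..1} (\<lambda>x. K * (weight j x * (u j (x, s))\<^sup>2))"
      proof (rule integral_le)
        have c: "continuous_on {0..1} (\<lambda>x. u j (x, s))" using ci[OF j] s by simp
        show "(\<lambda>x. (in_gain - 1 - 2 * weight j x * b j x) * (u j (x, s))\<^sup>2) integrable_on {0..1}"
          by (intro integrable_continuous_real continuous_on_mult continuous_on_diff continuous_on_const continuous_on_power w b_cont j c)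
        show "(\<lambda>x. K * (weight j x * (u j (x, s))\<^sup>2)) integrable_on {0..1}"
          by (intro integrable_continuous_real continuous_on_mult continuous_on_const continuous_on_power w c)
        fix x :: real assume "x \<in> {0..1}"
        then have "in_gain - 1 - 2 * weight j x * b j x \<le> K * weight j x" using K j by blast
        then have "(in_gain - 1 - 2 * weight j x * b j x) * (u j (x, s))\<^sup>2 \<le> K * weight j x * (u j (x, s))\<^sup>2"
          by (rule mult_right_mono) simp
        then show "(in_gain - 1 - 2 * weight j x * b j x) * (u j (x, s))\<^sup>2 \<le> K * (weight j x * (u j (x, s))\<^sup>2)"
          by (simp only: mult.assoc)
      qed
    qed
    also have "\<dots> = K * energy u s" by (simp add: energy_def sum_distrib_left)
    finally show ?thesis .
  qed
  have ec: "continuous_on {0..t} (energy u)"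
    unfolding energy_def
  proof (intro continuous_on_sum)
    fix j assume j: "j \<in> {1..n}"
    have cu: "continuous_on Pi_strip (u j)" by (rule C1_with_continuous[OF C[OF j]])
    have "continuous_on ({0..t} \<times> cbox 0 1) (\<lambda>(s, x). weight j x * (u j (x, s))\<^sup>2)"
      unfolding split_beta
      by (intro continuous_on_mult continuous_on_power continuous_on_compose2[OF weight_continuous[OF j]]
          continuous_on_compose2[OF cu]) (auto simp: Pi_strip_def intro!: continuous_intros)
    from integral_continuous_on_param[OF this]
    show "continuous_on {0..t} (\<lambda>s. integral {0..1} (\<lambda>x. weight j x * (u j (x, s))\<^sup>2))" by simp
  qed
  have "exp (- (K * 0)) * energy u 0 \<ge> exp (- (K * t)) * energy u t"
  proof (rule DERIV_nonpos_imp_decreasing_open[OF t])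
    fix s assume s: "0 < s" "s < t"
    have "at s within {0..} = at s" using s
      by (intro at_within_interior) (simp add: interior_real_atLeast)
    then have d: "(energy u has_real_derivative (\<Sum>j=1..n. D j s)) (at s)" using der[OF s(1)] by simp
    have e: "((\<lambda>s. exp (- (K * s))) has_real_derivative - K * exp (- (K * s))) (at s)"
      by (auto intro!: derivative_eq_intros)
    from DERIV_mult[OF e d]
    have "((\<lambda>s. exp (- (K * s)) * energy u s) has_real_derivative
        exp (- (K * s)) * ((\<Sum>j=1..n. D j s) - K * energy u s)) (at s)"
      by (rule DERIV_cong) (simp add: algebra_simps)
    moreover have "exp (- (K * s)) * ((\<Sum>j=1..n. D j s) - K * energy u s) \<le> 0"
      using le[OF s(1)] by (intro mult_nonneg_nonpos) auto
    ultimately show "\<exists>y. ((\<lambda>s. exp (- (K * s)) * energy u s) has_real_derivative y) (at s) \<and> y \<le> 0"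
      by blast
  next
    show "continuous_on {0..t} (\<lambda>s. exp (- (K * s)) * energy u s)" by (intro continuous_intros ec)
  qed
  then have "exp (K * t) * (exp (- (K * t)) * energy u t) \<le> exp (K * t) * energy u 0" by simp
  then show ?thesis by (simp flip: mult.assoc exp_add)
qed

text \<open>
  The weights lie between positive constants, so the energy is comparable to the square of the norm.
\<close>

theorem energy_estimate:
  obtains C where "\<And>T. C T \<ge> 0"
    "\<And>T \<phi> u ux ut t. strong_solution \<phi> u ux ut \<Longrightarrow> t \<in> {0..T} \<Longrightarrow>
      L2_vec_norm n (\<lambda>j x. u j (x, t)) \<le> C T * L2_vec_norm n \<phi>"
proof -
  obtain K where K: "K > 0" "\<forall>j\<in>{1..n}. \<forall>x\<in>{0..1}. weight j x \<le> K"
    "\<forall>j\<in>{1..n}. \<forall>x\<in>{0..1}. 1 \<le> K * weight j x"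
    "\<forall>j\<in>{1..n}. \<forall>x\<in>{0..1}. in_gain - 1 - 2 * weight j x * b j x \<le> K * weight j x"
    by (rule weight_bounds)
  define C where "C T = sqrt (K * exp (K * T) * (real n * K))" for T
  have main: "L2_vec_norm n (\<lambda>j x. u j (x, t)) \<le> C T * L2_vec_norm n \<phi>"
    if S: "strong_solution \<phi> u ux ut" and t: "t \<in> {0..T}" for T \<phi> u ux ut t
  proof -
    define N where "N = L2_vec_norm n \<phi>"
    have N0: "N \<ge> 0" unfolding N_def by (rule L2_vec_norm_nonneg[OF n])
    have ci: "continuous_on {0..1} (\<lambda>x. u j (x, s))" if "j \<in> {1..n}" "0 \<le> s" for j s
      by (rule strip_slice_continuous[OF C1_with_continuous])
        (use S that in \<open>auto simp: strong_solution_def\<close>)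
    have L: "L2_sq (\<lambda>x. u j (x, s)) = integral {0..1} (\<lambda>x. (u j (x, s))\<^sup>2)" if "j \<in> {1..n}" "0 \<le> s"
      for j s
      by (rule L2_sq_continuous_eq[OF ci[OF that]])
    have i1: "(\<lambda>x. (u j (x, s))\<^sup>2) integrable_on {0..1}" if "j \<in> {1..n}" "0 \<le> s" for j s
      by (intro integrable_continuous_real continuous_on_power ci that)
    have i2: "(\<lambda>x. weight j x * (u j (x, s))\<^sup>2) integrable_on {0..1}" if "j \<in> {1..n}" "0 \<le> s"
      for j s
      by (intro integrable_continuous_real continuous_on_mult continuous_on_power weight_continuous ci that)
    have e0: "energy u 0 \<le> real n * K * N\<^sup>2"
    proof -
      have "energy u 0 \<le> (\<Sum>j=1..n. K * N\<^sup>2)"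
        unfolding energy_def
      proof (rule sum_mono)
        fix j assume j: "j \<in> {1..n}"
        have "integral {0..1} (\<lambda>x. weight j x * (u j (x, 0))\<^sup>2) \<le> integral {0..1} (\<lambda>x. K * (u j (x, 0))\<^sup>2)"
        proof (rule integral_le[OF i2[OF j order_refl]])
          show "(\<lambda>x. K * (u j (x, 0))\<^sup>2) integrable_on {0..1}" using i1[OF j order_refl]
            by (rule integrable_on_mult_right)
          fix x :: real assume "x \<in> {0..1}"
          then show "weight j x * (u j (x, 0))\<^sup>2 \<le> K * (u j (x, 0))\<^sup>2"
            using K(2) j by (intro mult_right_mono) auto
        qed
        also have "\<dots> = K * L2_sq (\<lambda>x. u j (x, 0))" using L[OF j order_refl] by simp
        also have "L2_sq (\<lambda>x. u j (x, 0)) = L2_sq (\<phi> j)"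
          unfolding L2_sq_def using S j
            by (intro Bochner_Integration.integral_cong) (auto simp: strong_solution_def)
        also have "\<dots> \<le> N\<^sup>2"
        proof -
          have "sqrt (L2_sq (\<phi> j)) \<le> N"
            using L2_norm_le_L2_vec_norm[OF j, of \<phi>] by (simp add: N_def L2_norm_eq_sqrt)
          then show ?thesis using sqrt_le_D by blast
        qed
        finally show "integral {0..1} (\<lambda>x. weight j x * (u j (x, 0))\<^sup>2) \<le> K * N\<^sup>2" using K(1)
          by simp
      qed
      then show ?thesis by simp
    qed
    have "L2_norm (\<lambda>x. u j (x, t)) \<le> C T * N" if j: "j \<in> {1..n}" for j
    proof -
      have t0: "0 \<le> t" "t \<le> T" using t by auto
      have nn: "0 \<le> integral {0..1} (\<lambda>x. weight k x * (u k (x, t))\<^sup>2)" if "k \<in> {1..n}" for k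
        using weight_pos[OF that] by (intro integral_nonneg i2 that t0) (simp add: less_imp_le)
      have "L2_sq (\<lambda>x. u j (x, t)) \<le> integral {0..1} (\<lambda>x. K * (weight j x * (u j (x, t))\<^sup>2))"
        unfolding L[OF j t0(1)]
      proof (rule integral_le[OF i1[OF j t0(1)]])
        show "(\<lambda>x. K * (weight j x * (u j (x, t))\<^sup>2)) integrable_on {0..1}"
          using i2[OF j t0(1)] by (rule integrable_on_mult_right)
        fix x :: real assume "x \<in> {0..1}"
        then have "1 * (u j (x, t))\<^sup>2 \<le> K * weight j x * (u j (x, t))\<^sup>2"
          using K(3) j by (intro mult_right_mono) auto
        then show "(u j (x, t))\<^sup>2 \<le> K * (weight j x * (u j (x, t))\<^sup>2)" by (simp add: mult.assoc)
      qed
      also have "\<dots> = K * integral {0..1} (\<lambda>x. weight j x * (u j (x, t))\<^sup>2)" by simp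
      also have "\<dots> \<le> K * energy u t"
        unfolding energy_def using K(1) by (intro mult_left_mono member_le_sum[OF j] nn) auto
      also have "\<dots> \<le> K * (exp (K * t) * energy u 0)"
        using energy_growth[OF S t0(1) K(4)] K(1) by simp
      also have "\<dots> \<le> K * (exp (K * t) * (real n * K * N\<^sup>2))"
        using e0 K(1) by simp
      also have "\<dots> \<le> K * (exp (K * T) * (real n * K * N\<^sup>2))"
        using t0 K(1) by (intro mult_left_mono mult_right_mono) auto
      also have "\<dots> = (C T * N)\<^sup>2"
        using K(1) by (simp add: C_def power_mult_distrib)
      finally show ?thesis
        unfolding L2_norm_eq_sqrt
          by (rule real_le_lsqrt[rotated 1]) (use K(1) N0 in \<open>simp add: C_def\<close>)
    qed
    then show ?thesis unfolding N_def by (rule L2_vec_norm_le[OF n])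
  qed
  have "C T \<ge> 0" for T using K(1) by (simp add: C_def)
  then show ?thesis using main by (rule that)
qed

end


section \<open>Solutions given by profiles\<close>

text \<open>
  Vanishing near the end points makes the extension by zero continuously differentiable on the line.
\<close>

lemma C0_inf_zero_extension:
  assumes psi: "\<psi> \<in> C0_inf"
  defines "\<psi>0 \<equiv> \<lambda>x. if x \<in> {0..1} then \<psi> x else 0"
  obtains \<psi>' where "\<And>x. (\<psi>0 has_real_derivative \<psi>' x) (at x)" "continuous_on UNIV \<psi>'"
proof -
  obtain D d where der: "\<forall>x\<in>{0..1}. (\<psi> has_real_derivative D x) (at x within {0..1})"
    and cD: "continuous_on {0..1} D" and d: "0 < d"
    and z: "\<forall>x\<in>{0..1}. x < d \<or> 1 - d < x \<longrightarrow> \<psi> x = 0"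
    by (rule C0_inf_D[OF psi])
  define \<psi>' where "\<psi>' x = (if x \<in> {0<..<1} then D x else 0)" for x
  have zero: "\<psi>0 x = 0" if "x < d \<or> 1 - d < x" for x using z that by (auto simp: \<psi>0_def)
  have out: "(\<psi>0 has_real_derivative 0) (at x)" if x: "x < d \<or> 1 - d < x" for x
  proof -
    have op: "open ({..<d} \<union> {1 - d<..})" by auto
    have "((\<lambda>x. 0) has_real_derivative 0) (at x)" by simp
    then show ?thesis
      by (rule has_field_derivative_transform_within_open[OF _ op]) (use x zero in auto)
  qed
  have inn: "(\<psi>0 has_real_derivative D x) (at x)" if x: "x \<in> {0<..<1}" for x
  proof -
    have "at x within {0..1} = at x" by (rule at_within_interior) (use x in simp)
    moreover have "x \<in> {0..1}" using x by simp
    ultimately have "(\<psi> has_real_derivative D x) (at x)" using der by metis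
    then show ?thesis
      by (rule has_field_derivative_transform_within_open[where S = "{0<..<1}"]) (use x in \<open>auto simp: \<psi>0_def\<close>)
  qed
  have D0: "\<psi>' x = 0" if "x < d \<or> 1 - d < x" for x
    using DERIV_unique[OF inn out[OF that]] by (simp add: \<psi>'_def)
  show ?thesis
  proof (rule that)
    show "(\<psi>0 has_real_derivative \<psi>' x) (at x)" for x
    proof (cases "x \<in> {0<..<1}")
      case True then show ?thesis using inn by (simp add: \<psi>'_def)
    next
      case False
      then have "x < d \<or> 1 - d < x" using d by auto
      from out[OF this] D0[OF this] show ?thesis by simp
    qed
    show "continuous_on UNIV \<psi>'"
    proof (rule continuous_at_imp_continuous_on, rule ballI)
      fix x :: real
      show "isCont \<psi>' x"
      proof (cases "x \<in> {0<..<1}")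
        case True
        have "isCont D x"
          by (rule continuous_on_interior[OF cD]) (use True in simp)
        moreover have "\<forall>\<^sub>F y in nhds x. D y = \<psi>' y"
          using eventually_nhds_in_open[of "{0<..<1}" x] True
            by (auto elim!: eventually_mono simp: \<psi>'_def)
        ultimately show ?thesis using isCont_cong by blast
      next
        case False
        have "\<forall>\<^sub>F y in nhds x. y \<in> {..<d} \<union> {1 - d<..}"
          by (rule eventually_nhds_in_open) (use False d in auto)
        then have "\<forall>\<^sub>F y in nhds x. 0 = \<psi>' y" by eventually_elim (use D0 in auto)
        then show ?thesis using isCont_cong[of "\<lambda>_. 0" \<psi>' x] by simp
      qed
    qed
  qed
qed

lemma increasing_inverse_C1:
  fixes T :: "real \<Rightarrow> real"
  assumes T: "\<And>x. (T has_real_derivative T' x) (at x)" and c: "0 < c" "\<And>x. c \<le> T' x"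
  obtains X where "\<And>x. X (T x) = x" "\<And>s. T (X s) = s" "continuous_on UNIV X"
    "\<And>s. (X has_real_derivative inverse (T' (X s))) (at s)"
proof -
  have grow: "c * (y - x) \<le> T y - T x" if "x \<le> y" for x y
  proof -
    have "T x - c * x \<le> T y - c * y"
    proof (rule DERIV_nonneg_imp_nondecreasing[OF that])
      fix s show "\<exists>z. ((\<lambda>x. T x - c * x) has_real_derivative z) (at s) \<and> 0 \<le> z"
        using c(2)[of s] by (intro exI[of _ "T' s - c"] conjI) (auto intro!: derivative_eq_intros T)
    qed
    then show ?thesis by (simp add: algebra_simps)
  qed
  have contT: "continuous_on S T" for S using T DERIV_isCont continuous_at_imp_continuous_on
    by blast
  have "\<exists>x. T x = s" for s
  proof -
    define r where "r = \<bar>s - T 0\<bar> / c"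
    have r: "r \<ge> 0" "c * r = \<bar>s - T 0\<bar>" using c(1) by (simp_all add: r_def)
    have "T (- r) \<le> s" "s \<le> T r" using grow[of "- r" 0] grow[of 0 r] r by auto
    then show ?thesis using IVT'[of T "- r" s r] r(1) contT by auto
  qed
  then obtain X where TX: "\<And>s. T (X s) = s" by metis
  have lip: "\<bar>x - y\<bar> \<le> \<bar>T x - T y\<bar> / c" for x y
  proof -
    have "c * \<bar>x - y\<bar> \<le> \<bar>T x - T y\<bar>" using grow[of x y] grow[of y x] c(1) by (cases "x \<le> y") auto
    then show ?thesis using c(1) by (simp add: pos_le_divide_eq mult.commute)
  qed
  have XT: "X (T x) = x" for x using lip[of "X (T x)" x] by (simp add: TX)
  have contX: "isCont X s" for s
  proof -
    have "((\<lambda>t. \<bar>t - s\<bar> / c) \<longlongrightarrow> \<bar>s - s\<bar> / c) (at s)" by (intro tendsto_intros) (use c(1) in simp)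
    then have l: "((\<lambda>t. \<bar>t - s\<bar> / c) \<longlongrightarrow> 0) (at s)" by simp
    have "((\<lambda>t. X t - X s) \<longlongrightarrow> 0) (at s)"
    proof (rule Lim_null_comparison[OF always_eventually l], rule allI)
      fix t show "norm (X t - X s) \<le> \<bar>t - s\<bar> / c" using lip[of "X t" "X s"] by (simp add: TX)
    qed
    then show ?thesis by (simp add: isCont_def LIM_zero_iff)
  qed
  show ?thesis
  proof (rule that[OF XT TX])
    show "continuous_on UNIV X" using contX continuous_at_imp_continuous_on by blast
    fix s
    show "(X has_real_derivative inverse (T' (X s))) (at s)"
    proof (rule DERIV_inverse_function[where a = "s - 1" and b = "s + 1"])
      show "(T has_real_derivative T' (X s)) (at (X s))" by (rule T)
      show "T' (X s) \<noteq> 0" using c(1) c(2)[of "X s"] by linarith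
      show "isCont X s" by (rule contX)
    qed (simp_all add: TX)
  qed
qed

lemma shift_sum_add: "shift_sum q (\<lambda>t. g t + h t) s = shift_sum q g s + shift_sum q h s"
  by (simp add: shift_sum_def gr_lin_def distrib_left sum.distrib)

lemma shift_sum_zero: "shift_sum q (\<lambda>t. 0) s = 0"
  by (simp add: shift_sum_def gr_lin_def)

lemma shift_sum_sum: "shift_sum q (\<lambda>t. \<Sum>k\<in>K. h k t) s = (\<Sum>k\<in>K. shift_sum q (h k) s)"
  by (induction K rule: infinite_finite_induct) (simp_all add: shift_sum_add shift_sum_zero)

lemma shift_sum_sum_left: "shift_sum (\<Sum>k\<in>K. q k) h s = (\<Sum>k\<in>K. shift_sum (q k) h s)"
  by (simp add: shift_sum_def gr_lin_sum)

lemma shift_sum_eq_0: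
  assumes "\<And>r. r \<in> Poly_Mapping.keys q \<Longrightarrow> h (t - r) = 0"
  shows "shift_sum q h t = 0"
  unfolding shift_sum_def gr_lin_def by (rule sum.neutral) (simp add: assms)

lemma shift_sum_unit: "shift_sum (if b then 1 else 0) h t = (if b then h t else 0)"
  by (simp add: shift_sum_def gr_lin_one)

text \<open>
  Applied to functions of time, \<open>delay_mat\<close> is the left-hand side of the delay system.
\<close>

lemma shift_sum_delay_mat:
  "shift_sum (delay_mat \<tau> c j k) h s = (if j = k then h s else 0) - c j k * h (s - \<tau> k)"
  unfolding shift_sum_def delay_mat_def diff_conv_add_uminus gr_lin_add gr_lin_uminus gr_lin_single
  by (simp add: gr_lin_one)

lemma shift_sum_deriv:
  assumes "\<And>t. (h has_real_derivative h' t) (at t)"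
  shows "(shift_sum q h has_real_derivative shift_sum q h' s) (at s)"
  unfolding shift_sum_def gr_lin_def
proof (rule DERIV_sum)
  fix r
  have "((\<lambda>t. h (t - r)) has_real_derivative h' (s - r) * 1) (at s)"
    by (rule DERIV_chain2[OF assms]) (auto intro!: derivative_eq_intros)
  from DERIV_cmult[OF this, of "Poly_Mapping.lookup q r"]
  show "((\<lambda>t. Poly_Mapping.lookup q r *\<^sub>R h (t - r)) has_real_derivative Poly_Mapping.lookup q r *\<^sub>R h' (s - r)) (at s)"
    by simp
qed

lemma shift_sum_continuous:
  assumes "continuous_on UNIV h"
  shows "continuous_on UNIV (shift_sum q h)"
  unfolding shift_sum_def gr_lin_def
  by (intro continuous_on_sum continuous_on_scaleR continuous_on_const continuous_on_compose2[OF assms])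
    (auto intro!: continuous_intros)

context hyperbolic_system
begin

lemma \<theta>_bounds:
  assumes j: "j \<in> {1..n}"
  shows "x \<in> {0..1} \<Longrightarrow> 0 \<le> \<theta> j x" "x \<in> {0..1} \<Longrightarrow> \<theta> j x \<le> \<tau> j"
    "x \<in> {0<..<1} \<Longrightarrow> 0 < \<theta> j x" "x \<in> {0<..<1} \<Longrightarrow> \<theta> j x < \<tau> j"
proof -
  have strict: "0 < \<theta> j x \<and> \<theta> j x < \<tau> j" if "x \<in> {0<..<1}" for x
    using \<theta>_monotone[OF j, of 0 x] \<theta>_monotone[OF j, of x 1] \<theta>_out[OF j] that
    by (cases "j \<le> m") (simp_all add: \<tau>_def in_pt_def out_pt_def)
  have ends: "0 \<le> \<theta> j x \<and> \<theta> j x \<le> \<tau> j" if "x = 0 \<or> x = 1" for x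
    using that \<tau>_pos[OF j] \<theta>_out[OF j] by (cases "j \<le> m") (auto simp: \<tau>_def in_pt_def out_pt_def)
  show "x \<in> {0<..<1} \<Longrightarrow> 0 < \<theta> j x" "x \<in> {0<..<1} \<Longrightarrow> \<theta> j x < \<tau> j" using strict by blast+
  have "x \<in> {0..1} \<Longrightarrow> x = 0 \<or> x = 1 \<or> x \<in> {0<..<1}" by auto
  then show "x \<in> {0..1} \<Longrightarrow> 0 \<le> \<theta> j x" "x \<in> {0..1} \<Longrightarrow> \<theta> j x \<le> \<tau> j"
    using strict[of x] ends[of x] by fastforce+
qed

text \<open>
  The solution with profile \<open>W\<close>: for \<open>t \<ge> 0\<close> the value \<open>W j t\<close> is the trace at the entrance, and the profile
  at negative times encodes the initial data.
\<close>

definition transport :: "(nat \<Rightarrow> real \<Rightarrow> real) \<Rightarrow> nat \<Rightarrow> real \<times> real \<Rightarrow> real"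
  where "transport W j z = exp (- \<rho> j (fst z)) * W j (snd z - \<theta> j (fst z))"

text \<open>
  Every profile gives a solution of the differential equations; the boundary condition at time
  \<open>t\<close> becomes an equation with delays \<open>\<tau>\<^sub>k\<close> for the profile.
\<close>

lemma transport_strong_solution:
  assumes W: "\<And>j s. j \<in> {1..n} \<Longrightarrow> (W j has_real_derivative W' j s) (at s)"
    and cW': "\<And>j. j \<in> {1..n} \<Longrightarrow> continuous_on UNIV (W' j)"
    and bc: "\<And>j t. j \<in> {1..n} \<Longrightarrow> 0 \<le> t \<Longrightarrow> W j t = (\<Sum>k=1..n. damped_p j k * W k (t - \<tau> k))"
  defines "ut \<equiv> \<lambda>j z. exp (- \<rho> j (fst z)) * W' j (snd z - \<theta> j (fst z))"
    and "ux \<equiv> \<lambda>j z. - (b j (clamp01 (fst z)) * transport W j z +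
        exp (- \<rho> j (fst z)) * W' j (snd z - \<theta> j (fst z))) / a j (clamp01 (fst z))"
  shows "strong_solution (\<lambda>j x. transport W j (x, 0)) (transport W) ux ut"
  unfolding strong_solution_def
proof (intro ballI conjI allI impI)
  fix j assume j: "j \<in> {1..n}"
  have c\<theta>: "continuous_on UNIV (\<theta> j)" and c\<rho>: "continuous_on UNIV (\<rho> j)" and cW: "continuous_on UNIV (W j)"
    by (rule DERIV_continuous_on[where D = "\<lambda>x. 1 / a j (clamp01 x)"], rule has_field_derivative_at_within[OF \<theta>_deriv[OF j]])
      (rule DERIV_continuous_on[where D = "\<lambda>x. b j (clamp01 x) / a j (clamp01 x)"], rule has_field_derivative_at_within[OF \<rho>_deriv[OF j]],
       rule DERIV_continuous_on[where D = "W' j"], rule has_field_derivative_at_within[OF W[OF j]])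
  have der: "(transport W j has_derivative (\<lambda>h. ux j z * fst h + ut j z * snd h)) (at z)" for z
  proof -
    have f: "(fst has_derivative fst) (at z)" and s: "(snd has_derivative snd) (at z)"
      by (auto intro: derivative_intros)
    have t: "((\<lambda>z. \<theta> j (fst z)) has_derivative (\<lambda>h. 1 / a j (clamp01 (fst z)) * fst h)) (at z)"
      using has_derivative_compose[OF f \<theta>_deriv[OF j, unfolded has_field_derivative_def]] .
    have r: "((\<lambda>z. \<rho> j (fst z)) has_derivative (\<lambda>h. b j (clamp01 (fst z)) / a j (clamp01 (fst z)) * fst h)) (at z)"
      using has_derivative_compose[OF f \<rho>_deriv[OF j, unfolded has_field_derivative_def]] .
    have w: "((\<lambda>z. W j (snd z - \<theta> j (fst z))) has_derivative
        (\<lambda>h. W' j (snd z - \<theta> j (fst z)) * (snd h - 1 / a j (clamp01 (fst z)) * fst h))) (at z)"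
      using has_derivative_compose[OF has_derivative_diff[OF s t] W[OF j, unfolded has_field_derivative_def]] .
    have e: "((\<lambda>z. exp (- \<rho> j (fst z))) has_derivative
        (\<lambda>h. exp (- \<rho> j (fst z)) * - (b j (clamp01 (fst z)) / a j (clamp01 (fst z)) * fst h))) (at z)"
      using has_derivative_compose[OF has_derivative_minus[OF r] DERIV_exp[unfolded has_field_derivative_def]] .
    have "((\<lambda>z. exp (- \<rho> j (fst z)) * W j (snd z - \<theta> j (fst z))) has_derivative (\<lambda>h. ux j z * fst h + ut j z * snd h)) (at z)"
      by (rule has_derivative_eq_rhs[OF has_derivative_mult[OF e w]])
        (simp add: fun_eq_iff ux_def ut_def transport_def divide_inverse algebra_simps)
    then show ?thesis by (simp add: transport_def[abs_def])
  qed
  have cf: "continuous_on UNIV (\<lambda>z::real \<times> real. exp (- \<rho> j (fst z)))"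
    by (intro continuous_on_exp continuous_on_minus continuous_on_compose2[OF c\<rho>] continuous_on_fst continuous_on_id) auto
  have ct: "continuous_on UNIV (\<lambda>z::real \<times> real. snd z - \<theta> j (fst z))"
    by (intro continuous_on_diff continuous_on_snd continuous_on_id continuous_on_compose2[OF c\<theta>] continuous_on_fst) auto
  have cut: "continuous_on UNIV (ut j)"
    unfolding ut_def by (intro continuous_on_mult cf continuous_on_compose2[OF cW'[OF j] ct]) auto
  have ctr: "continuous_on UNIV (transport W j)"
    unfolding transport_def[abs_def]
      by (intro continuous_on_mult cf continuous_on_compose2[OF cW ct]) auto
  have ca: "continuous_on UNIV (\<lambda>z::real \<times> real. a j (clamp01 (fst z)))"
    by (rule continuous_on_compose2[OF continuous_clamp01[OF a_cont[OF j]]]) (auto intro!: continuous_intros)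
  have cb: "continuous_on UNIV (\<lambda>z::real \<times> real. b j (clamp01 (fst z)))"
    by (rule continuous_on_compose2[OF continuous_clamp01[OF b_cont[OF j]]]) (auto intro!: continuous_intros)
  have "continuous_on UNIV (\<lambda>z. - (b j (clamp01 (fst z)) * transport W j z + ut j z) / a j (clamp01 (fst z)))"
    by (intro continuous_on_divide continuous_on_minus continuous_on_add continuous_on_mult ca cb ctr cut)
      (use a_nonzero[OF j clamp01_in] in blast)
  then have cux: "continuous_on UNIV (ux j)" by (simp add: ux_def ut_def)
  show "C1_with (transport W j) (ux j) (ut j)"
    unfolding C1_with_def
  proof (intro conjI ballI)
    show "continuous_on Pi_strip (ux j)" "continuous_on Pi_strip (ut j)"
      by (rule continuous_on_subset[OF cux] continuous_on_subset[OF cut], simp)+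
    show "(transport W j has_derivative (\<lambda>h. ux j z * fst h + ut j z * snd h)) (at z within Pi_strip)"
      for z
      by (rule has_derivative_at_withinI[OF der])
  qed
  show "ut j (x, t) + a j x * ux j (x, t) + b j x * transport W j (x, t) = 0"
    if "0 < x \<and> x < 1 \<and> 0 < t" for x t
  proof -
    have x: "x \<in> {0..1}" using that by simp
    show ?thesis using a_nonzero[OF j x] by (simp add: ux_def ut_def clamp01_id[OF x])
  qed
  show "transport W j (out_pt j, t) = (\<Sum>k=1..n. p j k * transport W k (in_pt k, t))" if "0 \<le> t"
    for t
    using bc[OF j that]
      by (simp add: transport_def \<theta>_out[OF j] \<rho>_out[OF j] damped_p_def \<tau>_def mult_ac)
qed simp

text \<open>
  The initial data, carried back in time along the characteristics. As the data vanish near the end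
  points of the interval, so does the profile at both ends of \<open>(- \<tau>\<^sub>j, 0)\<close>.
\<close>

lemma initial_profile:
  assumes j: "j \<in> {1..n}" and \<phi>: "\<phi> \<in> C0_inf"
  obtains H H' where "\<And>s. (H has_real_derivative H' s) (at s)" "continuous_on UNIV H'"
    "\<And>s. 0 \<le> s \<or> s \<le> - \<tau> j \<Longrightarrow> H s = 0"
    "\<And>x. x \<in> {0..1} \<Longrightarrow> exp (- \<rho> j x) * H (- \<theta> j x) = \<phi> x"
proof -
  \<comment> \<open>the sign makes \<open>\<sigma> \<theta>\<^sub>j\<close> increasing for both directions of travel\<close>
  define \<sigma> :: real where "\<sigma> = (if j \<le> m then 1 else -1)"
  have s2: "\<sigma> * \<sigma> = 1" by (simp add: \<sigma>_def)
  have pos: "0 < \<sigma> * a j (clamp01 x)" for x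
    using a_pos[OF _ clamp01_in, of j x] a_neg[OF _ clamp01_in, of j x] j alpha
      by (auto simp: \<sigma>_def)
  have "compact (a j ` {0..1})" using a_cont[OF j] by (intro compact_continuous_image) auto
  from compact_imp_bounded[OF this] obtain M where M: "\<forall>y\<in>a j ` {0..1}. norm y \<le> M"
    unfolding bounded_iff by blast
  have le: "\<sigma> * a j (clamp01 x) \<le> M" for x
  proof -
    have "\<bar>a j (clamp01 x)\<bar> \<le> M" using M clamp01_in[of x] by (metis image_eqI real_norm_def)
    then show ?thesis by (auto simp: \<sigma>_def)
  qed
  have M0: "0 < M" using pos[of 0] le[of 0] by linarith
  define T where "T x = \<sigma> * \<theta> j x" for x
  obtain X where X: "\<And>x. X (T x) = x" "\<And>s. T (X s) = s" "continuous_on UNIV X"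
    "\<And>s. (X has_real_derivative inverse (1 / (\<sigma> * a j (clamp01 (X s))))) (at s)"
  proof (rule increasing_inverse_C1[of T "\<lambda>x. 1 / (\<sigma> * a j (clamp01 x))" "1 / M"])
    fix x
    have "(T has_real_derivative \<sigma> * (1 / a j (clamp01 x))) (at x)"
      unfolding T_def by (rule DERIV_cmult[OF \<theta>_deriv[OF j]])
    moreover have "\<sigma> * (1 / a j (clamp01 x)) = 1 / (\<sigma> * a j (clamp01 x))"
      by (simp add: \<sigma>_def)
    ultimately show "(T has_real_derivative 1 / (\<sigma> * a j (clamp01 x))) (at x)" by simp
    show "1 / M \<le> 1 / (\<sigma> * a j (clamp01 x))" using pos[of x] le[of x]
      by (intro divide_left_mono) auto
  qed (use M0 in auto)
  define \<phi>0 where "\<phi>0 = (\<lambda>x. if x \<in> {0..1} then \<phi> x else 0)"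
  obtain \<phi>' where p: "\<And>x. (\<phi>0 has_real_derivative \<phi>' x) (at x)" "continuous_on UNIV \<phi>'"
    using C0_inf_zero_extension[OF \<phi>] unfolding \<phi>0_def by blast
  obtain d where d: "0 < d" "\<forall>x\<in>{0..1}. x < d \<or> 1 - d < x \<longrightarrow> \<phi> x = 0" by (rule C0_inf_D[OF \<phi>])
  define h where "h x = \<phi>0 x * exp (\<rho> j x)" for x
  define h'
    where "h' x = \<phi>' x * exp (\<rho> j x) + b j (clamp01 x) / a j (clamp01 x) * exp (\<rho> j x) * \<phi>0 x" for x
  have hd: "(h has_real_derivative h' x) (at x)" for x
    unfolding h_def h'_def
    by (rule DERIV_cong[OF DERIV_mult[OF p(1) DERIV_chain2[OF DERIV_exp \<rho>_deriv[OF j]]]]) simp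
  have c\<rho>: "continuous_on UNIV (\<rho> j)"
    by (rule DERIV_continuous_on) (rule has_field_derivative_at_within[OF \<rho>_deriv[OF j]])
  have c\<phi>0: "continuous_on UNIV \<phi>0"
    by (rule DERIV_continuous_on) (rule has_field_derivative_at_within[OF p(1)])
  have cba: "continuous_on UNIV (\<lambda>x. b j (clamp01 x) / a j (clamp01 x))"
    by (rule continuous_clamp01[OF quotient_a_continuous[OF j b_cont[OF j]]])
  have ch': "continuous_on UNIV h'"
    unfolding h'_def
      by (intro continuous_on_add continuous_on_mult continuous_on_exp p(2) c\<rho> c\<phi>0 cba)
  have h0: "h x = 0" if "x \<notin> {0<..<1}" for x
  proof -
    have "\<phi>0 x = 0" using that d by (auto simp: \<phi>0_def)
    then show ?thesis by (simp add: h_def)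
  qed
  define H where "H s = h (X (- \<sigma> * s))" for s
  define H' where "H' s = h' (X (- \<sigma> * s)) * ((\<sigma> * a j (clamp01 (X (- \<sigma> * s)))) * (- \<sigma>))" for s
  have \<theta>X: "\<theta> j (X (- \<sigma> * s)) = - s" for s
  proof -
    have "\<sigma> * (\<sigma> * \<theta> j (X (- \<sigma> * s))) = \<sigma> * (- \<sigma> * s)" using X(2)[of "- \<sigma> * s"] by (simp add: T_def)
    then show ?thesis using s2 by (simp flip: mult.assoc)
  qed
  show ?thesis
  proof (rule that[of H H'])
    fix s
    have "((\<lambda>s. - \<sigma> * s) has_real_derivative - \<sigma>) (at s)" by (auto intro!: derivative_eq_intros)
    from DERIV_chain2[OF hd DERIV_chain2[OF X(4) this]]
    show "(H has_real_derivative H' s) (at s)"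
      unfolding H_def H'_def by (simp add: inverse_eq_divide)
  next
    have cX: "continuous_on UNIV (\<lambda>s. X (- \<sigma> * s))"
      by (rule continuous_on_compose2[OF X(3)]) (auto intro!: continuous_intros)
    show "continuous_on UNIV H'"
      unfolding H'_def
      by (intro continuous_on_mult continuous_on_const continuous_on_compose2[OF ch' cX]
          continuous_on_compose2[OF continuous_clamp01[OF a_cont[OF j]] cX]) auto
  next
    fix s assume s: "0 \<le> s \<or> s \<le> - \<tau> j"
    have "X (- \<sigma> * s) \<notin> {0<..<1}"
      using \<theta>_bounds(3,4)[OF j, of "X (- \<sigma> * s)"] s unfolding \<theta>X by auto
    then show "H s = 0" unfolding H_def by (rule h0)
  next
    fix x :: real assume x: "x \<in> {0..1}"
    have "H (- \<theta> j x) = h (X (T x))" by (simp add: H_def T_def)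
    then show "exp (- \<rho> j x) * H (- \<theta> j x) = \<phi> x"
      using x by (simp add: X(1) h_def \<phi>0_def exp_minus)
  qed
qed

end


section \<open>Extinction and the spectrum\<close>

text \<open>
  Applying the inverse matrix, read as a matrix of shift operators, to the inhomogeneity \<open>G\<close> solves the
  delay system on the whole line.
\<close>

lemma delay_system_solution:
  fixes G :: "nat \<Rightarrow> real \<Rightarrow> real"
  assumes inv: "\<And>i j. i \<in> {1..n} \<Longrightarrow> j \<in> {1..n} \<Longrightarrow>
      (\<Sum>k=1..n. delay_mat \<tau> c i k * B k j) = (if i = j then 1 else 0)"
    and j: "j \<in> {1..n}"
  defines "w \<equiv> \<lambda>j t. \<Sum>k=1..n. shift_sum (B j k) (G k) t"
  shows "w j t = (\<Sum>k=1..n. c j k * w k (t - \<tau> k)) + G j t"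
proof -
  have "(\<Sum>k=1..n. shift_sum (delay_mat \<tau> c j k) (w k) t) =
      (\<Sum>k=1..n. \<Sum>l=1..n. shift_sum (delay_mat \<tau> c j k * B k l) (G l) t)"
    unfolding w_def shift_sum_sum shift_sum_mult ..
  also have "\<dots> = (\<Sum>l=1..n. \<Sum>k=1..n. shift_sum (delay_mat \<tau> c j k * B k l) (G l) t)"
    by (rule sum.swap)
  also have "\<dots> = (\<Sum>l=1..n. shift_sum (if j = l then 1 else 0) (G l) t)"
    by (rule sum.cong[OF refl]) (simp only: inv[OF j] flip: shift_sum_sum_left)
  also have "\<dots> = G j t" using j by (simp add: shift_sum_unit)
  finally have "(\<Sum>k=1..n. (if j = k then w k t else 0) - c j k * w k (t - \<tau> k)) = G j t"
    by (simp only: shift_sum_delay_mat)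
  then show ?thesis using j by (simp add: sum_subtractf)
qed

text \<open>
  The formula for the solution by itself only shows that it is zero in the remote past. It stays
  zero as long as there is no inhomogeneity, by induction in time steps of the smallest delay.
\<close>

lemma delay_system_causal:
  fixes w :: "nat \<Rightarrow> real \<Rightarrow> real"
  assumes tau: "\<And>k. k \<in> {1..n} \<Longrightarrow> 0 < \<tau> k"
    and eq: "\<And>j t. j \<in> {1..n} \<Longrightarrow> t \<le> 0 \<Longrightarrow> w j t = (\<Sum>k=1..n. c j k * w k (t - \<tau> k))"
    and past: "\<And>j t. j \<in> {1..n} \<Longrightarrow> t \<le> - L \<Longrightarrow> w j t = 0"
    and j: "j \<in> {1..n}" and t: "t \<le> 0"
  shows "w j t = 0"
proof -
  define \<delta> where "\<delta> = Min (\<tau> ` {1..n})"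
  have "\<delta> \<in> \<tau> ` {1..n}" unfolding \<delta>_def by (rule Min_in) (use j in auto)
  then have pos: "\<delta> > 0" using tau by auto
  have \<delta>: "\<delta> \<le> \<tau> k" if "k \<in> {1..n}" for k unfolding \<delta>_def by (rule Min_le) (use that in auto)
  have step: "\<forall>j\<in>{1..n}. \<forall>t\<le>0. t \<le> - L + real N * \<delta> \<longrightarrow> w j t = 0" for N
  proof (induction N)
    case 0
    then show ?case using past by simp
  next
    case (Suc N)
    show ?case
    proof (intro ballI allI impI)
      fix j t assume j: "j \<in> {1..n}" and t: "t \<le> 0" "t \<le> - L + real (Suc N) * \<delta>"
      have "w k (t - \<tau> k) = 0" if k: "k \<in> {1..n}" for k
      proof -
        have "t - \<tau> k \<le> - L + real N * \<delta>" "t - \<tau> k \<le> 0"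
          using t \<delta>[OF k] pos by (simp_all add: algebra_simps)
        then show ?thesis using Suc.IH k by blast
      qed
      then show "w j t = 0" using eq[OF j t(1)] by simp
    qed
  qed
  obtain N :: nat where "L / \<delta> \<le> real N" using real_arch_simple by blast
  then have "L \<le> real N * \<delta>" using pos by (simp add: pos_divide_le_eq)
  then have "t \<le> - L + real N * \<delta>" using t by simp
  then show ?thesis using step[of N] j t by blast
qed

context hyperbolic_system
begin

text \<open>
  Let \<open>H\<close> be the profile of the initial data and \<open>G\<close> what it feeds into the entrances at positive times; \<open>G\<close> is
  supported in \<open>[0, S]\<close>. The solution \<open>w\<close> of the delay system with inhomogeneity \<open>G\<close> is a sum of shifts
  of \<open>G\<close> by at most \<open>L\<close>, and it is zero at negative times. So \<open>W = w + H\<close> is the profile of a classical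
  solution with the right initial data, and it is supported in \<open>[- S, S + L]\<close>.
\<close>

theorem finite_time_extinction:
  assumes nz: "\<And>z. fdet n (char z) \<noteq> 0"
  obtains Te where "Te > 0"
    "\<forall>\<phi>. (\<forall>j\<in>{1..n}. \<phi> j \<in> C0_inf) \<longrightarrow>
      (\<exists>u. classical \<phi> u \<and> (\<forall>t\<ge>Te. \<forall>j\<in>{1..n}. \<forall>x\<in>{0..1}. u j (x, t) = 0))"
proof -
  have "fdet n (delay_mat \<tau> damped_p) * 1 = 1" using zero_free_delay_det[OF \<tau>_pos nz] by simp
  then obtain B where inv: "\<And>i j. i \<in> {1..n} \<Longrightarrow> j \<in> {1..n} \<Longrightarrow>
      (\<Sum>k=1..n. delay_mat \<tau> damped_p i k * B k j) = (if i = j then 1 else 0)"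
    and "\<And>i j. i \<in> {1..n} \<Longrightarrow> j \<in> {1..n} \<Longrightarrow>
      (\<Sum>k=1..n. B i k * delay_mat \<tau> damped_p k j) = (if i = j then 1 else 0)"
    by (rule fdet_unit_inverse) (rule that)
  define L where "L = (\<Sum>j=1..n. \<Sum>k=1..n. \<Sum>r\<in>Poly_Mapping.keys (B j k). \<bar>r\<bar>)"
  have L: "\<bar>r\<bar> \<le> L" if "j \<in> {1..n}" "k \<in> {1..n}" "r \<in> Poly_Mapping.keys (B j k)" for j k r
  proof -
    have "\<bar>r\<bar> \<le> (\<Sum>r\<in>Poly_Mapping.keys (B j k). \<bar>r\<bar>)"
      by (rule member_le_sum[OF that(3), of abs]) auto
    also have "\<dots> \<le> (\<Sum>k=1..n. \<Sum>r\<in>Poly_Mapping.keys (B j k). \<bar>r\<bar>)"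
      by (rule member_le_sum[OF that(2), of "\<lambda>k. \<Sum>r\<in>Poly_Mapping.keys (B j k). \<bar>r\<bar>"]) (auto intro: sum_nonneg)
    also have "\<dots> \<le> L" unfolding L_def
      by (rule member_le_sum[OF that(1), of "\<lambda>j. \<Sum>k=1..n. \<Sum>r\<in>Poly_Mapping.keys (B j k). \<bar>r\<bar>"]) (auto intro!: sum_nonneg)
    finally show ?thesis .
  qed
  define S where "S = (\<Sum>k=1..n. \<tau> k)"
  have S: "\<tau> k \<le> S" if "k \<in> {1..n}" for k
    unfolding S_def by (rule member_le_sum[OF that]) (simp_all add: less_imp_le \<tau>_pos)
  have L0: "0 \<le> L" unfolding L_def by (intro sum_nonneg) simp
  have S0: "0 \<le> S" unfolding S_def by (intro sum_nonneg less_imp_le \<tau>_pos)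
  \<comment> \<open>a point \<open>x\<close> sees its profile with a delay of at most \<open>S\<close>; the summand 1 keeps the time positive\<close>
  have main: "\<exists>u. classical \<phi> u \<and> (\<forall>t\<ge>2 * S + L + 1. \<forall>j\<in>{1..n}. \<forall>x\<in>{0..1}. u j (x, t) = 0)"
    if \<phi>: "\<forall>j\<in>{1..n}. \<phi> j \<in> C0_inf" for \<phi>
  proof -
    define profile
      where "profile j H H' \<longleftrightarrow> (\<forall>s. (H has_real_derivative H' s) (at s)) \<and> continuous_on UNIV H' \<and>
        (\<forall>s. 0 \<le> s \<or> s \<le> - \<tau> j \<longrightarrow> H s = 0) \<and> (\<forall>x\<in>{0..1}. exp (- \<rho> j x) * H (- \<theta> j x) = \<phi> j x)" for j H H'
    have "\<exists>H H'. j \<in> {1..n} \<longrightarrow> profile j H H'" for j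
    proof (cases "j \<in> {1..n}")
      case True
      then have "\<phi> j \<in> C0_inf" using \<phi> by blast
      show ?thesis unfolding profile_def by (rule initial_profile[OF True \<open>\<phi> j \<in> C0_inf\<close>]) blast
    qed blast
    then have "\<forall>j. \<exists>H H'. j \<in> {1..n} \<longrightarrow> profile j H H'" by (rule allI)
    from this[unfolded choice_iff] obtain H H' where
      HH: "\<forall>j. j \<in> {1..n} \<longrightarrow> profile j (H j) (H' j)"
      by blast
    have H: "(H j has_real_derivative H' j s) (at s)" and cH': "continuous_on UNIV (H' j)"
      and H0: "0 \<le> s \<or> s \<le> - \<tau> j \<Longrightarrow> H j s = 0"
      and Hi: "x \<in> {0..1} \<Longrightarrow> exp (- \<rho> j x) * H j (- \<theta> j x) = \<phi> j x" if "j \<in> {1..n}" for j s x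
      using HH that unfolding profile_def by blast+
    define G where "G k t = (\<Sum>l=1..n. damped_p k l * H l (t - \<tau> l))" for k t
    define G' where "G' k t = (\<Sum>l=1..n. damped_p k l * H' l (t - \<tau> l))" for k t
    have G: "(G k has_real_derivative G' k t) (at t)" for k t
      unfolding G_def G'_def
    proof (rule DERIV_sum)
      fix l assume l: "l \<in> {1..n}"
      have "((\<lambda>t. H l (t - \<tau> l)) has_real_derivative H' l (t - \<tau> l) * 1) (at t)"
        by (rule DERIV_chain2[OF H[OF l]]) (auto intro!: derivative_eq_intros)
      from DERIV_cmult[OF this]
      show "((\<lambda>t. damped_p k l * H l (t - \<tau> l)) has_real_derivative damped_p k l * H' l (t - \<tau> l)) (at t)"
        by simp
    qed
    have cG': "continuous_on UNIV (G' k)" for k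
      unfolding G'_def
      by (intro continuous_on_sum continuous_on_mult continuous_on_const continuous_on_compose2[OF cH'])
        (auto intro!: continuous_intros)
    have G0: "G k t = 0" if "t \<le> 0 \<or> S \<le> t" for k t
      unfolding G_def
    proof (rule sum.neutral, rule ballI)
      fix l assume l: "l \<in> {1..n}"
      \<comment> \<open>the profile is supported in \<open>(- \<tau> l, 0)\<close>, so its shift lives in \<open>(0, \<tau> l)\<close>\<close>
      have "0 \<le> t - \<tau> l \<or> t - \<tau> l \<le> - \<tau> l" using that S[OF l] by linarith
      then have "H l (t - \<tau> l) = 0" by (rule H0[OF l])
      then show "damped_p k l * H l (t - \<tau> l) = 0" by simp
    qed
    define w where "w = (\<lambda>j t. \<Sum>k=1..n. shift_sum (B j k) (G k) t)"
    have w: "w j t = (\<Sum>k=1..n. damped_p j k * w k (t - \<tau> k)) + G j t" if "j \<in> {1..n}" for j t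
      unfolding w_def by (rule delay_system_solution[OF inv that])
    have w0: "w j t = 0" if j: "j \<in> {1..n}" and t: "t \<le> - L \<or> S + L \<le> t" for j t
      unfolding w_def
    proof (rule sum.neutral, rule ballI)
      fix k assume k: "k \<in> {1..n}"
      show "shift_sum (B j k) (G k) t = 0"
      proof (rule shift_sum_eq_0)
        fix r assume "r \<in> Poly_Mapping.keys (B j k)"
        from L[OF j k this] show "G k (t - r) = 0" using t by (intro G0) linarith
      qed
    qed
    have wneg: "w j t = 0" if "j \<in> {1..n}" "t \<le> 0" for j t
    proof (rule delay_system_causal[OF \<tau>_pos _ _ that])
      show "w j t = (\<Sum>k=1..n. damped_p j k * w k (t - \<tau> k))" if "j \<in> {1..n}" "t \<le> 0" for j t
        using w[OF that(1), of t] G0[of t j] that(2) by simp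
      show "w j t = 0" if "j \<in> {1..n}" "t \<le> - L" for j t using w0 that by blast
    qed
    define W where "W j t = w j t + H j t" for j t
    define W' where "W' j t = (\<Sum>k=1..n. shift_sum (B j k) (G' k) t) + H' j t" for j t
    have Wd: "(W j has_real_derivative W' j t) (at t)" if j: "j \<in> {1..n}" for j t
      unfolding W_def W'_def w_def by (intro DERIV_add DERIV_sum shift_sum_deriv G H j)
    have cW': "continuous_on UNIV (W' j)" if j: "j \<in> {1..n}" for j
      unfolding W'_def by (intro continuous_on_add continuous_on_sum shift_sum_continuous cG' cH' j)
    have bc: "W j t = (\<Sum>k=1..n. damped_p j k * W k (t - \<tau> k))" if j: "j \<in> {1..n}" and t: "0 \<le> t"
      for j t
      using w[OF j, of t] H0[OF j, of t] t by (simp add: W_def G_def distrib_left sum.distrib)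
    note strong = transport_strong_solution[of W W', OF Wd cW' bc]
    have ic: "transport W j (x, 0) = \<phi> j x" if "j \<in> {1..n}" "x \<in> {0..1}" for j x
    proof -
      have "w j (- \<theta> j x) = 0" by (rule wneg[OF that(1)]) (use \<theta>_bounds(1)[OF that] in simp)
      then show ?thesis using Hi[OF that] by (simp add: transport_def W_def)
    qed
    have "classical (\<lambda>j x. transport W j (x, 0)) (transport W)"
      unfolding classical_iff_strong using strong by blast
    then have "classical \<phi> (transport W)"
      unfolding classical_solution_def using ic by auto
    moreover have "transport W j (x, t) = 0"
      if t: "2 * S + L + 1 \<le> t" and j: "j \<in> {1..n}" and x: "x \<in> {0..1}" for t j x
    proof -
      have "S + L \<le> t - \<theta> j x" "0 \<le> t - \<theta> j x"
        using t \<theta>_bounds(2)[OF j x] S[OF j] L0 S0 by linarith+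
      then have "W j (t - \<theta> j x) = 0" using w0[OF j, of "t - \<theta> j x"] H0[OF j, of "t - \<theta> j x"]
        by (simp add: W_def)
      then show ?thesis by (simp add: transport_def)
    qed
    ultimately show ?thesis by blast
  qed
  have "0 < 2 * S + L + 1" using L0 S0 by linarith
  then show ?thesis using main by (intro that[of "2 * S + L + 1"]) blast+
qed

abbreviation "FTS_autonomous \<equiv> FTS n m p (\<lambda>j (x, t). a j x) (\<lambda>j (x, t). b j x)"
abbreviation "generalized \<equiv> L2_generalized_solution n m p (\<lambda>j (x, t). a j x) (\<lambda>j (x, t). b j x)"

text \<open>
  The extinct classical solutions for approximating initial data converge to the generalized solution.
\<close>

theorem char_nonzero_imp_FTS:
  assumes "\<And>z. fdet n (char z) \<noteq> 0"
  shows FTS_autonomous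
proof -
  obtain Te where Te: "Te > 0" and ext: "\<forall>\<phi>. (\<forall>j\<in>{1..n}. \<phi> j \<in> C0_inf) \<longrightarrow>
      (\<exists>u. classical \<phi> u \<and> (\<forall>t\<ge>Te. \<forall>j\<in>{1..n}. \<forall>x\<in>{0..1}. u j (x, t) = 0))"
    by (rule finite_time_extinction[OF assms])
  have "ae_eq n (u t) (\<lambda>j x. 0)"
    if \<phi>: "\<phi> \<in> L2_vec n" and u: "generalized \<phi> u" and t: "Te < t" for \<phi> u t
  proof -
    obtain \<phi>l where pl: "\<forall>l. \<forall>j\<in>{1..n}. \<phi>l l j \<in> C0_inf"
      "(\<lambda>l. L2_vec_norm n (\<lambda>j x. \<phi>l l j x - \<phi> j x)) \<longlonglongrightarrow> 0"
      by (rule C0_inf_dense_vec[OF \<phi> n])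
    have "\<forall>l. \<exists>u. classical (\<phi>l l) u \<and> (\<forall>t\<ge>Te. \<forall>j\<in>{1..n}. \<forall>x\<in>{0..1}. u j (x, t) = 0)"
      using ext pl(1) by blast
    then obtain ul where ul: "\<And>l. classical (\<phi>l l) (ul l)"
      "\<And>l t j x. Te \<le> t \<Longrightarrow> j \<in> {1..n} \<Longrightarrow> x \<in> {0..1} \<Longrightarrow> ul l j (x, t) = 0"
      unfolding choice_iff by blast
    have "t > 0" using t Te by simp
    have "uniform_limit {0..t} (\<lambda>l t. L2_vec_norm n (\<lambda>j x. u t j x - ul l j (x, t))) (\<lambda>t. 0) sequentially"
      using u pl ul(1) \<open>t > 0\<close> unfolding L2_generalized_solution_def by blast
    then have "(\<lambda>l. L2_vec_norm n (\<lambda>j x. u t j x - ul l j (x, t))) \<longlonglongrightarrow> 0"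
      by (rule tendsto_uniform_limitI) (use \<open>t > 0\<close> in simp)
    moreover have "L2_vec_norm n (\<lambda>j x. u t j x - ul l j (x, t)) = L2_vec_norm n (u t)" for l
      by (rule L2_vec_norm_cong) (use ul(2)[of t] t in simp)
    ultimately have "L2_vec_norm n (u t) = 0" by (simp add: LIMSEQ_const_iff)
    moreover have "u t \<in> L2_vec n" using u \<open>t > 0\<close> unfolding L2_generalized_solution_def by simp
    ultimately show ?thesis by (intro L2_vec_norm_le_0_iff) simp_all
  qed
  with Te show ?thesis unfolding FTS_def by blast
qed

lemma strong_solution_continuous_in_time:
  assumes S: "strong_solution \<phi> u ux ut" and t: "0 \<le> t"
  shows "((\<lambda>s. L2_vec_norm n (\<lambda>j x. u j (x, s) - u j (x, t))) \<longlongrightarrow> 0) (at t within {0..})"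
proof (rule tendstoI)
  fix e :: real assume "e > 0"
  have cu: "continuous_on Pi_strip (u j)" if "j \<in> {1..n}" for j
    by (rule C1_with_continuous) (use S that in \<open>auto simp: strong_solution_def\<close>)
  have "\<forall>\<^sub>F s in at t within {0..}. L2_norm (\<lambda>x. u j (x, s) - u j (x, t)) \<le> e / 2"
    if j: "j \<in> {1..n}" for j
  proof -
    have "compact ({0..1::real} \<times> {0..t + 1})" by (intro compact_Times compact_Icc)
    moreover have "continuous_on ({0..1} \<times> {0..t + 1}) (u j)"
      by (rule continuous_on_subset[OF cu[OF j]]) (auto simp: Pi_strip_def)
    ultimately have "uniformly_continuous_on ({0..1} \<times> {0..t + 1}) (u j)"
      by (rule compact_uniformly_continuous[rotated])
    moreover have "e / 2 > 0" using \<open>e > 0\<close> by simp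
    ultimately obtain d where d: "d > 0" "\<forall>y\<in>{0..1} \<times> {0..t + 1}. \<forall>y'\<in>{0..1} \<times> {0..t + 1}.
        dist y' y < d \<longrightarrow> dist (u j y') (u j y) < e / 2"
      unfolding uniformly_continuous_on_def by blast
    have "\<forall>\<^sub>F s in at t within {0..}. s \<in> {0..} \<and> dist s t < min d 1"
      unfolding eventually_at by (intro exI[of _ "min d 1"]) (use d in auto)
    then show ?thesis
    proof eventually_elim
      case (elim s)
      then have s: "0 \<le> s" "s \<le> t + 1" "dist s t < d" by (auto simp: dist_real_def)
      have cs: "continuous_on {0..1} (\<lambda>x. u j (x, s) - u j (x, t))"
        by (intro continuous_on_diff strip_slice_continuous cu j s t)
      show ?case
      proof (rule L2_norm_le_bound[OF L2_continuous[OF cs]])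
        show "AE x in M01. u j (x, s) - u j (x, t) = u j (x, s) - u j (x, t)" by simp
        fix x :: real assume x: "x \<in> {0..1}"
        have "dist (x, s) (x, t) < d" using s(3) by (simp add: dist_Pair_Pair)
        then have "dist (u j (x, s)) (u j (x, t)) < e / 2" using d(2) x s t by auto
        then show "norm (u j (x, s) - u j (x, t)) \<le> e / 2" by (simp add: dist_norm)
      qed (use \<open>e > 0\<close> in simp)
    qed
  qed
  then have "\<forall>\<^sub>F s in at t within {0..}. \<forall>j\<in>{1..n}. L2_norm (\<lambda>x. u j (x, s) - u j (x, t)) \<le> e / 2"
    by (intro eventually_ball_finite) auto
  then show "\<forall>\<^sub>F s in at t within {0..}. dist (L2_vec_norm n (\<lambda>j x. u j (x, s) - u j (x, t))) 0 < e"
  proof eventually_elim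
    case (elim s)
    then have "L2_vec_norm n (\<lambda>j x. u j (x, s) - u j (x, t)) \<le> e / 2"
      by (intro L2_vec_norm_le[OF n]) blast
    then show ?case using L2_vec_norm_nonneg[OF n, of "\<lambda>j x. u j (x, s) - u j (x, t)"] \<open>e > 0\<close>
      by simp
  qed
qed

text \<open>
  The difference to any approximating classical solution is again a solution, so it is controlled by the
  energy estimate. Eigenfunctions qualify as initial data, although they do not vanish at the end points.
\<close>

theorem strong_solution_generalized:
  assumes S: "strong_solution \<phi> u ux ut"
  shows "generalized \<phi> (\<lambda>t j x. u j (x, t))"
  unfolding L2_generalized_solution_def
proof (intro conjI allI impI)
  have cu: "continuous_on Pi_strip (u j)" if "j \<in> {1..n}" for j
    by (rule C1_with_continuous) (use S that in \<open>auto simp: strong_solution_def\<close>)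
  show "(\<lambda>j x. u j (x, t)) \<in> L2_vec n" if "0 \<le> t" for t
    unfolding L2_vec_def using L2_continuous[OF strip_slice_continuous[OF cu that]] by blast
  show "((\<lambda>s. L2_vec_norm n (\<lambda>j x. u j (x, s) - u j (x, t))) \<longlongrightarrow> 0) (at t within {0..})" if "0 \<le> t"
    for t
    by (rule strong_solution_continuous_in_time[OF S that])
  fix \<phi>l ul and T :: real
  assume A: "(\<forall>l. \<forall>j\<in>{1..n}. \<phi>l l j \<in> C0_inf) \<and>
       (\<lambda>l. L2_vec_norm n (\<lambda>j x. \<phi>l l j x - \<phi> j x)) \<longlonglongrightarrow> 0 \<and>
       (\<forall>l. classical (\<phi>l l) (ul l))" and "0 < T"
  obtain C where C: "\<And>T. C T \<ge> 0" "\<And>T \<phi> u ux ut t. strong_solution \<phi> u ux ut \<Longrightarrow> t \<in> {0..T} \<Longrightarrow>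
      L2_vec_norm n (\<lambda>j x. u j (x, t)) \<le> C T * L2_vec_norm n \<phi>"
    by (rule energy_estimate) (rule that)
  have est: "L2_vec_norm n (\<lambda>j x. u j (x, t) - ul l j (x, t)) \<le> C T * L2_vec_norm n (\<lambda>j x. \<phi>l l j x - \<phi> j x)"
    if t: "t \<in> {0..T}" for l t
  proof -
    have "classical (\<phi>l l) (ul l)" using A by blast
    then obtain vx vt where "strong_solution (\<phi>l l) (ul l) vx vt" unfolding classical_iff_strong
      by blast
    from C(2)[OF strong_solution_diff[OF S this] t]
    show ?thesis by (simp only: L2_vec_norm_minus_commute[of n \<phi> "\<phi>l l"])
  qed
  have "(\<lambda>l. C T * L2_vec_norm n (\<lambda>j x. \<phi>l l j x - \<phi> j x)) \<longlonglongrightarrow> C T * 0"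
    using A by (intro tendsto_mult tendsto_const) blast
  then have lim: "(\<lambda>l. C T * L2_vec_norm n (\<lambda>j x. \<phi>l l j x - \<phi> j x)) \<longlonglongrightarrow> 0" by simp
  show "uniform_limit {0..T} (\<lambda>l t. L2_vec_norm n (\<lambda>j x. u j (x, t) - ul l j (x, t))) (\<lambda>t. 0) sequentially"
  proof (rule uniform_limitI)
    fix e :: real assume "e > 0"
    from order_tendstoD(2)[OF lim this]
    show "\<forall>\<^sub>F l in sequentially. \<forall>t\<in>{0..T}. dist (L2_vec_norm n (\<lambda>j x. u j (x, t) - ul l j (x, t))) 0 < e"
    proof eventually_elim
      case (elim l)
      show ?case
      proof
        fix t assume "t \<in> {0..T}"
        from est[OF this, of l] elim L2_vec_norm_nonneg[OF n, of "\<lambda>j x. u j (x, t) - ul l j (x, t)"]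
        show "dist (L2_vec_norm n (\<lambda>j x. u j (x, t) - ul l j (x, t))) 0 < e" by simp
      qed
    qed
  qed
qed

text \<open>
  The profile \<open>Re (x\<^sub>j exp (z s))\<close> belongs to the real part of \<open>exp (z t)\<close> times an eigenfunction. Its
  generalized solution must be extinct, and at the entrances it equals the profile.
\<close>

lemma FTS_eigenmode_real_part:
  assumes Te: "\<And>\<phi> u t. \<phi> \<in> L2_vec n \<Longrightarrow> generalized \<phi> u \<Longrightarrow> Te < t \<Longrightarrow> ae_eq n (u t) (\<lambda>j x. 0)"
    and x: "\<And>j. j \<in> {1..n} \<Longrightarrow> (\<Sum>k=1..n. char z j k * x k) = 0"
    and j: "j \<in> {1..n}" and t: "Te < t" "0 \<le> t"
  shows "Re (x j * exp (z * of_real t)) = 0"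
proof -
  define W where "W j s = Re (x j * exp (z * of_real s))" for j and s :: real
  define W' where "W' j s = Re (x j * (z * exp (z * of_real s)))" for j and s :: real
  have Wd: "(W j has_real_derivative W' j s) (at s)" for j s
  proof -
    have "((\<lambda>s. complex_of_real s) has_vector_derivative of_real 1) (at s)"
      by (rule has_vector_derivative_of_real[OF DERIV_ident])
    from has_vector_derivative_mult_right[OF this, of z]
    have "((\<lambda>s. z * complex_of_real s) has_vector_derivative z) (at s)" by simp
    from has_vector_derivative_mult_right[OF has_vector_derivative_cexp[OF this], of "x j"]
    have "((\<lambda>s. x j * exp (z * complex_of_real s)) has_vector_derivative x j * (z * exp (z * of_real s))) (at s)" .
    from bounded_linear.has_vector_derivative[OF bounded_linear_Re this]
    show ?thesis by (simp add: W_def[abs_def] W'_def has_real_derivative_iff_has_vector_derivative)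
  qed
  have cW': "continuous_on UNIV (W' j)" for j
    unfolding W'_def by (intro continuous_intros)
  have bc: "W j s = (\<Sum>k=1..n. damped_p j k * W k (s - \<tau> k))" if j: "j \<in> {1..n}" for j s
  proof -
    have "x j = (\<Sum>k=1..n. of_real (damped_p j k) * exp (- (of_real (\<tau> k) * z)) * x k)"
      using x[OF j] char_sum[OF j, of z x] unfolding mode_in by simp
    then have "x j * exp (z * of_real s) =
        (\<Sum>k=1..n. of_real (damped_p j k) * exp (- (of_real (\<tau> k) * z)) * x k) * exp (z * of_real s)" by simp
    also have "\<dots> = (\<Sum>k=1..n. of_real (damped_p j k) * (x k * exp (z * of_real (s - \<tau> k))))"
      unfolding sum_distrib_right
    proof (rule sum.cong[OF refl])
      fix k
      have "exp (z * of_real (s - \<tau> k)) = exp (- (of_real (\<tau> k) * z)) * exp (z * of_real s)"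
        by (simp add: algebra_simps flip: exp_add)
      then show "of_real (damped_p j k) * exp (- (of_real (\<tau> k) * z)) * x k * exp (z * of_real s) =
          of_real (damped_p j k) * (x k * exp (z * of_real (s - \<tau> k)))"
        by (simp only: mult_ac)
    qed
    finally show ?thesis by (simp add: W_def)
  qed
  note S = transport_strong_solution[of W W', OF Wd cW' bc]
  have cu: "continuous_on Pi_strip (transport W k)" if "k \<in> {1..n}" for k
    by (rule C1_with_continuous) (use S that in \<open>unfold strong_solution_def, blast\<close>)
  have "(\<lambda>j x. transport W j (x, 0)) \<in> L2_vec n"
    unfolding L2_vec_def using L2_continuous[OF strip_slice_continuous[OF cu order_refl]] by blast
  from Te[OF this strong_solution_generalized[OF S] t(1)]
  have "AE x in M01. transport W j (x, t) = 0" using j unfolding ae_eq_def by blast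
  from continuous_AE_eq_const[OF strip_slice_continuous[OF cu[OF j] t(2)] this pts_in(1)[of j]]
  have "transport W j (out_pt j, t) = 0" .
  then show ?thesis by (simp add: transport_def \<theta>_out[OF j] \<rho>_out[OF j] W_def)
qed

text \<open>
  A real part may be zero at particular times. Replacing the kernel vector \<open>x\<close> by \<open>- \<i> x\<close>
  covers the imaginary part as well.
\<close>

theorem FTS_imp_char_nonzero:
  assumes FTS_autonomous
  shows "fdet n (char z) \<noteq> 0"
proof
  assume "fdet n (char z) = 0"
  then obtain x where nz: "\<exists>i\<in>{1..n}. x i \<noteq> 0"
    and x: "\<And>i. i \<in> {1..n} \<Longrightarrow> (\<Sum>k=1..n. char z i k * x k) = 0"
    by (rule fdet_zero_kernel) blast
  obtain i where i: "i \<in> {1..n}" "x i \<noteq> 0" using nz by blast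
  obtain Te where Te: "Te > 0" "\<forall>\<phi>\<in>L2_vec n. \<forall>u. generalized \<phi> u \<longrightarrow> (\<forall>t>Te. ae_eq n (u t) (\<lambda>j x. 0))"
    using assms unfolding FTS_def by blast
  have T: "ae_eq n (u t) (\<lambda>j x. 0)" if "\<phi> \<in> L2_vec n" "generalized \<phi> u" "Te < t" for \<phi> u t
    using Te(2) that by blast
  have t: "Te < Te + 1" "0 \<le> Te + 1" using Te(1) by simp_all
  have x': "(\<Sum>k=1..n. char z j k * (- \<i> * x k)) = 0" if "j \<in> {1..n}" for j
  proof -
    have "(\<Sum>k=1..n. char z j k * (- \<i> * x k)) = - \<i> * (\<Sum>k=1..n. char z j k * x k)"
      by (simp add: sum_distrib_left mult_ac)
    then show ?thesis by (simp only: x[OF that] mult_zero_right)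
  qed
  have "Re (x i * exp (z * of_real (Te + 1))) = 0"
    by (rule FTS_eigenmode_real_part[where Te = Te and x = x, OF _ _ i(1) t]) (fact T, fact x)
  moreover have "Re (- \<i> * x i * exp (z * of_real (Te + 1))) = 0"
    by (rule FTS_eigenmode_real_part[where Te = Te and x = "\<lambda>k. - \<i> * x k", OF _ _ i(1) t]) (fact T, fact x')
  then have "Im (x i * exp (z * of_real (Te + 1))) = 0" by (simp add: mult.assoc)
  ultimately have "x i * exp (z * of_real (Te + 1)) = 0"
    by (simp only: complex_eq_iff zero_complex.sel)
  then show False using i(2) by simp
qed

theorem FTS_iff_spectrum_empty:
  "FTS_autonomous \<longleftrightarrow> op_spectrum n (A_domain n m p) (A_op a b) = {}"
  unfolding spectrum_empty_iff using FTS_imp_char_nonzero char_nonzero_imp_FTS by blast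

end

lemma C1_bounded_slice_continuous:
  assumes "C1_bounded (\<lambda>(x, t). g x)"
  shows "continuous_on {0..1} g"
proof -
  obtain fx ft where "C1_with (\<lambda>(x, t). g x) fx ft" using assms unfolding C1_bounded_def by blast
  from strip_slice_continuous[OF C1_with_continuous[OF this] order_refl]
  show ?thesis by simp
qed

theorem theorem1p5:
  fixes n m :: nat
    and p :: "nat \<Rightarrow> nat \<Rightarrow> real"
    and a b :: "nat \<Rightarrow> real \<Rightarrow> real"
  assumes "2 \<le> n" and "m \<le> n"
    and "standing_assumptions n m (\<lambda>j (x, t). a j x) (\<lambda>j (x, t). b j x)"
  shows "FTS n m p (\<lambda>j (x, t). a j x) (\<lambda>j (x, t). b j x) \<longleftrightarrow>
    op_spectrum n (A_domain n m p) (A_op a b) = {}"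
proof -
  obtain \<alpha> where \<alpha>: "\<alpha> > 0"
    "\<forall>j\<in>{1..m}. \<forall>z\<in>Pi_strip. (case z of (x, t) \<Rightarrow> a j x) \<ge> \<alpha>"
    "\<forall>j\<in>{m+1..n}. \<forall>z\<in>Pi_strip. (case z of (x, t) \<Rightarrow> a j x) \<le> - \<alpha>"
    using assms(3) unfolding standing_assumptions_def by blast
  have C1: "\<forall>j\<in>{1..n}. C1_bounded (\<lambda>(x, t). a j x) \<and> C1_bounded (\<lambda>(x, t). b j x)"
    using assms(3) unfolding standing_assumptions_def by blast
  have strip: "(x, 0) \<in> Pi_strip" if "x \<in> {0..1}" for x using that by (simp add: Pi_strip_def)
  interpret hyperbolic_system n m p a b \<alpha>
  proof
    show "1 \<le> n" "m \<le> n" "0 < \<alpha>" using assms(1,2) \<alpha>(1) by simp_all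
    show "continuous_on {0..1} (a j)" "continuous_on {0..1} (b j)" if "j \<in> {1..n}" for j
      using C1 that by (blast intro: C1_bounded_slice_continuous)+
    show "\<alpha> \<le> a j x" if "j \<in> {1..m}" "x \<in> {0..1}" for j x
      using bspec[OF bspec[OF \<alpha>(2) that(1)] strip[OF that(2)]] by simp
    show "a j x \<le> - \<alpha>" if "j \<in> {m+1..n}" "x \<in> {0..1}" for j x
      using bspec[OF bspec[OF \<alpha>(3) that(1)] strip[OF that(2)]] by simp
  qed
  show ?thesis by (rule FTS_iff_spectrum_empty)
qed

end
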